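(* \textsc{DC Deletion (Edge Dist)} is fixed-parameter tractable when parameterized by the budget $k$. \textsc{DC Completion (Matching Dist)} and \textsc{DC Completion (Edge Dist)} are fixed-parameter tractable when parameterized by the distance $d$.
   Context: A cluster graph is a disjoint union of cliques. $A\oplus B$ denotes symmetric difference. Matching-based distance: for cluster graphs $G_1,G_2$ on vertex set $V$, build the complete bipartite graph between the clusters of $G_1$ and the clusters of $G_2$ with edge weight $|C\cap C'|$ between clusters $C,C'$; with $W$ the weight of a maximum-weight matching, $d_M(G_1,G_2)=|V|-W$. Edge-based distance: $d_E(G_1,G_2)=|E(G_1)\oplus E(G_2)|$. Given a graph $G$ and a cluster graph $G_c$ on the same vertex set and nonnegative integers $k,d$: \textsc{DC Deletion (Edge Dist)} asks for a cluster graph $G'$ on the same vertex set with $E(G')\subseteq E(G)$, $|E(G)\oplus E(G')|\le k$ and $d_E(G',G_c)\le d$; \textsc{DC Completion (X)} asks for a cluster graph $G'$ with $E(G)\subseteq E(G')$, $|E(G)\oplus E(G')|\le k$ and $\mathrm{dist}(G',G_c)\le d$, where $\mathrm{dist}=d_M$ for X = Matching Dist and $d_E$ for X = Edge Dist. *)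

theory Defs
  imports Main "HOL-Library.Disjoint_Sets"
begin

definition simple_graph :: "'a set \<Rightarrow> 'a set set \<Rightarrow> bool" where
  "simple_graph V E \<longleftrightarrow> finite V \<and> (\<forall>e\<in>E. e \<subseteq> V \<and> card e = 2)"

definition clique_edges :: "'a set set \<Rightarrow> 'a set set" where
  "clique_edges P = {{u, v} |u v. u \<noteq> v \<and> (\<exists>C\<in>P. u \<in> C \<and> v \<in> C)}"

definition cluster_graph :: "'a set \<Rightarrow> 'a set set \<Rightarrow> bool" where
  "cluster_graph V E \<longleftrightarrow> finite V \<and> (\<exists>P. partition_on V P \<and> E = clique_edges P)"

text \<open>The vertex sets of the cliques; the partition is unique, see \<open>clusters_clique_edges\<close> below.\<close>

definition clusters :: "'a set \<Rightarrow> 'a set set \<Rightarrow> 'a set set" where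
  "clusters V E = (THE P. partition_on V P \<and> E = clique_edges P)"

text \<open>A matching of the complete bipartite graph with sides \<open>A\<close> and \<open>B\<close>. An edge is an ordered
  pair, so the two sides stay apart even if the same cluster occurs in both graphs.\<close>

definition bip_matching :: "'b set \<Rightarrow> 'c set \<Rightarrow> ('b \<times> 'c) set \<Rightarrow> bool" where
  "bip_matching A B M \<longleftrightarrow> M \<subseteq> A \<times> B \<and> inj_on fst M \<and> inj_on snd M"

definition overlap_weight :: "('a set \<times> 'a set) set \<Rightarrow> nat" where
  "overlap_weight M = (\<Sum>(C, C')\<in>M. card (C \<inter> C'))"

text \<open>The subtraction on \<^typ>\<open>nat\<close> never truncates, see \<open>overlap_weight_le\<close> below.\<close>

definition matching_dist :: "'a set \<Rightarrow> 'a set set \<Rightarrow> 'a set set \<Rightarrow> nat" where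
  "matching_dist V E1 E2 =
     card V - Max {overlap_weight M |M. bip_matching (clusters V E1) (clusters V E2) M}"

definition edge_dist :: "'a set \<Rightarrow> 'a set set \<Rightarrow> 'a set set \<Rightarrow> nat" where
  "edge_dist V E1 E2 = card (sym_diff E1 E2)"

definition dc_deletion ::
  "('a set \<Rightarrow> 'a set set \<Rightarrow> 'a set set \<Rightarrow> nat) \<Rightarrow> 'a set \<Rightarrow> 'a set set \<Rightarrow> 'a set set \<Rightarrow> nat \<Rightarrow> nat \<Rightarrow> bool"
where
  "dc_deletion dist V E Ec k d \<longleftrightarrow>
     (\<exists>E'. cluster_graph V E' \<and> E' \<subseteq> E \<and> card (sym_diff E E') \<le> k \<and> dist V E' Ec \<le> d)"

definition dc_completion ::
  "('a set \<Rightarrow> 'a set set \<Rightarrow> 'a set set \<Rightarrow> nat) \<Rightarrow> 'a set \<Rightarrow> 'a set set \<Rightarrow> 'a set set \<Rightarrow> nat \<Rightarrow> nat \<Rightarrow> bool"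
where
  "dc_completion dist V E Ec k d \<longleftrightarrow>
     (\<exists>E'. cluster_graph V E' \<and> E \<subseteq> E' \<and> card (sym_diff E E') \<le> k \<and> dist V E' Ec \<le> d)"

lemma clique_edges_cluster:
  assumes "partition_on V P" "C \<in> P" "v \<in> C"
  shows "C = {u \<in> V. u = v \<or> {u, v} \<in> clique_edges P}"
proof -
  have uniq: "D = C" if "D \<in> P" "v \<in> D" for D
  proof (rule ccontr)
    assume "D \<noteq> C"
    with partition_onD2[OF assms(1)] that(1) assms(2) have "D \<inter> C = {}"
      by (simp add: disjoint_def)
    with that(2) assms(3) show False by blast
  qed
  have CV: "C \<subseteq> V" using assms(2) partition_onD1[OF assms(1)] by blast
  show ?thesis
  proof (rule subset_antisym; rule subsetI)
    fix u assume u: "u \<in> C"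
    have "{u, v} \<in> clique_edges P" if "u \<noteq> v"
      unfolding clique_edges_def using that u assms(2,3) by blast
    then show "u \<in> {u \<in> V. u = v \<or> {u, v} \<in> clique_edges P}" using u CV by blast
  next
    fix u assume "u \<in> {u \<in> V. u = v \<or> {u, v} \<in> clique_edges P}"
    then consider "u = v" | "{u, v} \<in> clique_edges P" by blast
    then show "u \<in> C"
    proof cases
      case 2
      then obtain a b D where D: "{u, v} = {a, b}" "D \<in> P" "a \<in> D" "b \<in> D"
        unfolding clique_edges_def by blast
      then have "u \<in> D" "v \<in> D" by (auto simp: doubleton_eq_iff)
      then show ?thesis using uniq[OF D(2)] by blast
    qed (use assms(3) in simp)
  qed
qed

lemma clusters_clique_edges:
  assumes "partition_on V P"
  shows "clusters V (clique_edges P) = P"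
proof -
  have sub: "P \<subseteq> Q" if PQ: "partition_on V P" "partition_on V Q" "clique_edges P = clique_edges Q"
    for P Q :: "'a set set"
  proof
    fix C assume C: "C \<in> P"
    then obtain v where v: "v \<in> C" using PQ(1) partition_onD3 by (metis ex_in_conv)
    then obtain D where D: "D \<in> Q" "v \<in> D"
      using PQ(1,2) C partition_onD1 by (metis Union_iff)
    have "C = D"
      using clique_edges_cluster[OF PQ(1) C v] clique_edges_cluster[OF PQ(2) D] PQ(3) by simp
    then show "C \<in> Q" using D by simp
  qed
  show ?thesis
    unfolding clusters_def
  proof (rule the_equality)
    show "partition_on V P \<and> clique_edges P = clique_edges P" using assms by simp
    show "Q = P" if "partition_on V Q \<and> clique_edges P = clique_edges Q" for Q
    proof (rule subset_antisym)
      show "Q \<subseteq> P" by (rule sub) (use that assms in simp_all)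
      show "P \<subseteq> Q" by (rule sub) (use that assms in simp_all)
    qed
  qed
qed

lemma overlap_weight_le:
  assumes V: "finite V" "partition_on V P" "partition_on V Q" and M: "bip_matching P Q M"
  shows "overlap_weight M \<le> card V"
proof -
  have MPQ: "M \<subseteq> P \<times> Q" and inj: "inj_on fst M" using M by (simp_all add: bip_matching_def)
  have PV: "C \<subseteq> V" if "C \<in> P" for C using that partition_onD1[OF V(2)] by blast
  have "finite (P \<times> Q)"
    by (intro finite_cartesian_product finite_elements[OF V(1)] V)
  with MPQ have fin: "finite M" by (rule finite_subset)
  have sub: "fst p \<inter> snd p \<subseteq> V" if "p \<in> M" for p
  proof -
    have "fst p \<in> P" using that MPQ by auto
    then show ?thesis using PV by blast
  qed
  have disj: "(fst p \<inter> snd p) \<inter> (fst q \<inter> snd q) = {}" if "p \<in> M" "q \<in> M" "p \<noteq> q" for p q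
  proof -
    have "fst p \<noteq> fst q" using inj_onD[OF inj] that by blast
    moreover have "fst p \<in> P" "fst q \<in> P" using that MPQ by auto
    ultimately have "fst p \<inter> fst q = {}"
      using partition_onD2[OF V(2)] by (simp add: disjoint_def)
    then show ?thesis by blast
  qed
  have "card (\<Union>p\<in>M. fst p \<inter> snd p) = (\<Sum>p\<in>M. card (fst p \<inter> snd p))"
  proof (rule card_UN_disjoint[OF fin])
    show "\<forall>p\<in>M. finite (fst p \<inter> snd p)"
      using finite_subset[OF sub V(1)] by blast
    show "\<forall>p\<in>M. \<forall>q\<in>M. p \<noteq> q \<longrightarrow> fst p \<inter> snd p \<inter> (fst q \<inter> snd q) = {}"
      using disj by simp
  qed
  then have "overlap_weight M = card (\<Union>p\<in>M. fst p \<inter> snd p)"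
    by (simp add: overlap_weight_def case_prod_beta)
  also have "\<dots> \<le> card V"
  proof (rule card_mono[OF V(1)])
    show "(\<Union>p\<in>M. fst p \<inter> snd p) \<subseteq> V" using sub by (rule UN_least)
  qed
  finally show ?thesis .
qed

text \<open>
  A first-order functional language over binary trees (pure first-order Lisp with the single atom
  nil; compare the languages F and WHILE in N. D. Jones, Computability and Complexity). A program
  is a list of bodies of mutually recursive functions, each of one argument; function 0 is called
  on the input. Evaluation is call by value, and every evaluated node of an expression, calls
  included, costs one time unit.

  Trees can be represented with sharing, so that each unit step becomes a constant number of
  pointer operations. The language is therefore polynomially equivalent to Turing machines
  and to random access machines with logarithmic cost, even though a short computation can build
  a tree with exponentially many nodes.
\<close>

datatype tree = Leaf | Node tree tree

fun left :: "tree \<Rightarrow> tree" where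
  "left Leaf = Leaf"
| "left (Node l r) = l"

fun right :: "tree \<Rightarrow> tree" where
  "right Leaf = Leaf"
| "right (Node l r) = r"

datatype expr =
    Arg
  | Nil_Expr
  | Cons_Expr expr expr
  | Hd_Expr expr
  | Tl_Expr expr
  | If_Expr expr expr expr
  | Call nat expr

type_synonym program = "expr list"

text \<open>\<open>eval p x e y t\<close>: in program \<open>p\<close>, with argument \<open>x\<close>, the expression \<open>e\<close> evaluates to \<open>y\<close>
  in exactly \<open>t\<close> steps.\<close>

inductive eval :: "program \<Rightarrow> tree \<Rightarrow> expr \<Rightarrow> tree \<Rightarrow> nat \<Rightarrow> bool" for p :: program where
  eval_Arg: "eval p x Arg x 1"
| eval_Nil: "eval p x Nil_Expr Leaf 1"
| eval_Cons: "eval p x a y s \<Longrightarrow> eval p x b z t \<Longrightarrow> eval p x (Cons_Expr a b) (Node y z) (s + t + 1)"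
| eval_Hd: "eval p x a y t \<Longrightarrow> eval p x (Hd_Expr a) (left y) (t + 1)"
| eval_Tl: "eval p x a y t \<Longrightarrow> eval p x (Tl_Expr a) (right y) (t + 1)"
| eval_If_True: "eval p x c v s \<Longrightarrow> v \<noteq> Leaf \<Longrightarrow> eval p x a y t \<Longrightarrow> eval p x (If_Expr c a b) y (s + t + 1)"
| eval_If_False: "eval p x c Leaf s \<Longrightarrow> eval p x b y t \<Longrightarrow> eval p x (If_Expr c a b) y (s + t + 1)"
| eval_Call: "eval p x a v s \<Longrightarrow> f < length p \<Longrightarrow> eval p v (p ! f) y t \<Longrightarrow>
    eval p x (Call f a) y (s + t + 1)"

definition runs :: "program \<Rightarrow> tree \<Rightarrow> tree \<Rightarrow> nat \<Rightarrow> bool" where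
  "runs p x y t \<longleftrightarrow> eval p x (Call 0 Arg) y t"

lemma eval_deterministic:
  "eval p x e y t \<Longrightarrow> eval p x e y' t' \<Longrightarrow> y' = y \<and> t' = t"
proof (induction arbitrary: y' t' rule: eval.induct)
  case (eval_Arg x)
  then show ?case by cases auto
next
  case (eval_Nil x)
  then show ?case by cases auto
next
  case (eval_Cons x a y s b z t)
  from eval_Cons.prems show ?case by cases (use eval_Cons.IH in blast)
next
  case (eval_Hd x a y t)
  from eval_Hd.prems show ?case by cases (use eval_Hd.IH in blast)
next
  case (eval_Tl x a y t)
  from eval_Tl.prems show ?case by cases (use eval_Tl.IH in blast)
next
  case (eval_If_True x c v s a y t b)
  from eval_If_True.prems show ?case
    by cases (use eval_If_True.IH eval_If_True.hyps in blast)+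
next
  case (eval_If_False x c s b y t a)
  from eval_If_False.prems show ?case by cases (use eval_If_False.IH in blast)+
next
  case (eval_Call x a v s f y t)
  from eval_Call.prems show ?case by cases (use eval_Call.IH in blast)
qed

definition enc_bool :: "bool \<Rightarrow> tree" where
  "enc_bool b = (if b then Node Leaf Leaf else Leaf)"

text \<open>Binary, least significant bit first.\<close>

fun enc_nat :: "nat \<Rightarrow> tree" where
  "enc_nat n = (if n = 0 then Leaf else Node (enc_bool (odd n)) (enc_nat (n div 2)))"

declare enc_nat.simps [simp del]

fun enc_list :: "tree list \<Rightarrow> tree" where
  "enc_list [] = Leaf"
| "enc_list (x # xs) = Node x (enc_list xs)"

text \<open>The adjacency matrix, row by row, of a graph with vertices \<open>0, \<dots>, n - 1\<close>.\<close>

definition enc_graph :: "nat \<Rightarrow> nat set set \<Rightarrow> tree" where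
  "enc_graph n E = enc_list (map (\<lambda>i. enc_list (map (\<lambda>j. enc_bool ({i, j} \<in> E)) [0..<n])) [0..<n])"

definition enc_instance :: "nat \<Rightarrow> nat set set \<Rightarrow> nat set set \<Rightarrow> nat \<Rightarrow> tree" where
  "enc_instance n E Ec m = Node (enc_graph n E) (Node (enc_graph n Ec) (enc_nat m))"

lemma enc_bool_inject: "enc_bool a = enc_bool b \<longleftrightarrow> a = b"
  by (auto simp: enc_bool_def)

lemma enc_nat_inject: "enc_nat m = enc_nat n \<longleftrightarrow> m = n"
proof (induction m arbitrary: n rule: less_induct)
  case (less m)
  show ?case
  proof (cases "m = 0 \<or> n = 0")
    case True
    then show ?thesis by (subst (1 2) enc_nat.simps) auto
  next
    case False
    then have "enc_nat m = enc_nat n \<longleftrightarrow> odd m = odd n \<and> m div 2 = n div 2"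
      by (subst (1 2) enc_nat.simps) (auto simp: enc_bool_inject less.IH)
    also have "\<dots> \<longleftrightarrow> m = n"
      by presburger
    finally show ?thesis .
  qed
qed

lemma enc_list_inject: "enc_list xs = enc_list ys \<longleftrightarrow> xs = ys"
proof (induction xs arbitrary: ys)
  case Nil
  then show ?case by (cases ys) auto
next
  case (Cons x xs)
  then show ?case by (cases ys) auto
qed

lemma enc_graph_inject:
  assumes "simple_graph {..<n} E" "simple_graph {..<n'} E'"
  shows "enc_graph n E = enc_graph n' E' \<longleftrightarrow> n = n' \<and> E = E'"
proof
  assume eq: "enc_graph n E = enc_graph n' E'"
  then have n: "n = n'"
    unfolding enc_graph_def enc_list_inject by (metis length_map length_upt minus_nat.diff_0)
  have adj: "{i, j} \<in> E \<longleftrightarrow> {i, j} \<in> E'" if "i < n" "j < n" for i j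
  proof -
    have "\<forall>i\<in>{0..<n}. \<forall>j\<in>{0..<n}. {i, j} \<in> E \<longleftrightarrow> {i, j} \<in> E'"
      using eq by (simp add: n enc_graph_def enc_list_inject enc_bool_inject)
    then show ?thesis using that by simp
  qed
  have sub: "F \<subseteq> F'"
    if F: "simple_graph {..<n} F" "\<And>i j. i < n \<Longrightarrow> j < n \<Longrightarrow> {i, j} \<in> F \<Longrightarrow> {i, j} \<in> F'"
    for F F' :: "nat set set"
  proof
    fix e assume e: "e \<in> F"
    then have e': "e \<subseteq> {..<n}" "card e = 2" using F(1) by (auto simp: simple_graph_def)
    then obtain i j where ij: "e = {i, j}" unfolding card_2_iff by blast
    with e'(1) have "i < n" "j < n" by auto
    with F(2) e ij show "e \<in> F'" by simp
  qed
  have "E \<subseteq> E'" by (rule sub[OF assms(1)]) (rule iffD1[OF adj])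
  moreover have "E' \<subseteq> E" by (rule sub[OF assms(2)[folded n]]) (rule iffD2[OF adj])
  ultimately show "n = n' \<and> E = E'" using n by blast
qed simp

lemma enc_instance_inject:
  assumes "simple_graph {..<n} E" "simple_graph {..<n'} E'"
    and "simple_graph {..<n} Ec" "simple_graph {..<n'} Ec'"
  shows "enc_instance n E Ec m = enc_instance n' E' Ec' m' \<longleftrightarrow> n = n' \<and> E = E' \<and> Ec = Ec' \<and> m = m'"
  unfolding enc_instance_def tree.inject enc_nat_inject
    enc_graph_inject[OF assms(1,2)] enc_graph_inject[OF assms(3,4)] by blast

lemma cluster_graph_imp_simple_graph:
  assumes "cluster_graph V E"
  shows "simple_graph V E"
  unfolding simple_graph_def
proof (intro conjI ballI)
  from assms show "finite V" by (simp add: cluster_graph_def)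
  fix e assume e: "e \<in> E"
  from assms obtain P where P: "partition_on V P" "E = clique_edges P"
    by (auto simp: cluster_graph_def)
  with e obtain u v C where uv: "e = {u, v}" "u \<noteq> v" "C \<in> P" "u \<in> C" "v \<in> C"
    by (auto simp: clique_edges_def)
  have "C \<subseteq> V" using uv(3) partition_onD1[OF P(1)] by blast
  with uv show "e \<subseteq> V" "card e = 2" by auto
qed

definition computable :: "(nat \<Rightarrow> nat) \<Rightarrow> bool" where
  "computable f \<longleftrightarrow> (\<exists>p. \<forall>n. \<exists>t. runs p (enc_nat n) (enc_nat (f n)) t)"

text \<open>A parameterized problem is a set of pairs of an input and a parameter value. The algorithm
  gets the pair, has to answer correctly on every pair (also when the first component encodes
  no instance), and the running time is measured against the number of inner nodes of its input.\<close>

definition fixed_parameter_tractable :: "(tree \<times> nat) set \<Rightarrow> bool" where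
  "fixed_parameter_tractable L \<longleftrightarrow>
     (\<exists>p f c. computable f \<and>
        (\<forall>x k. \<exists>t. runs p (Node x (enc_nat k)) (enc_bool ((x, k) \<in> L)) t \<and>
                   t \<le> f k * size (Node x (enc_nat k)) ^ c))"

definition DC_Deletion_by_budget ::
  "(nat set \<Rightarrow> nat set set \<Rightarrow> nat set set \<Rightarrow> nat) \<Rightarrow> (tree \<times> nat) set" where
  "DC_Deletion_by_budget dist =
     {(enc_instance n E Ec d, k) |n E Ec d k.
        simple_graph {..<n} E \<and> cluster_graph {..<n} Ec \<and> dc_deletion dist {..<n} E Ec k d}"

definition DC_Completion_by_distance ::
  "(nat set \<Rightarrow> nat set set \<Rightarrow> nat set set \<Rightarrow> nat) \<Rightarrow> (tree \<times> nat) set" where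
  "DC_Completion_by_distance dist =
     {(enc_instance n E Ec k, d) |n E Ec k d.
        simple_graph {..<n} E \<and> cluster_graph {..<n} Ec \<and> dc_completion dist {..<n} E Ec k d}"

end

theory Submission
  imports Defs
begin

text \<open>
  All trees whose height is linear in the parameter are listed in advance. Their number depends on
  the parameter only, so it suffices to decide each problem in time polynomial in the input padded
  with this list of certificates.

  Deletion: of an induced path \<open>u - v - w\<close>, one edge has to be deleted; a certificate of at most \<open>k\<close>
  bits guides these choices until a cluster graph is left. Its cliques are then split independently.
  In a clique that is split at all, every vertex is incident with a deleted edge, so the clique has at
  most \<open>2 * k\<close> vertices and its labelling is a certificate. A knapsack over the cliques, whose two
  resources are both at most \<open>n * n\<close>, combines the choices.

  Completion, edge distance: the connected components of the graph are merged. Every component that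
  meets several clusters of \<open>G\<^sub>c\<close>, or shares such a cluster with one that does, contains an endpoint
  of one of the at most \<open>d\<close> differing pairs. So these components number at most \<open>2 * d\<close> and form one
  block; the other components are merged within their cluster of \<open>G\<^sub>c\<close>, and if they are not all merged,
  again there are at most \<open>2 * d\<close> of them. The same knapsack over blocks applies.

  Completion, matching distance: the distance is at most \<open>d\<close> iff both graphs agree on all but \<open>d\<close>
  vertices. At most \<open>d\<close> components meet several clusters of \<open>G\<^sub>c\<close>, and a certificate assigns a cluster
  to each of them. Whether a component joins its cluster or stays alone is decided by a nested
  knapsack on sizes.
\<close>

section \<open>Polynomial-time functions\<close>

text \<open>Tractability asks here for a concrete program and a computable bound, so every function
  used by an algorithm has to be realised by code. The predicate \<open>PT\<close> records
  polynomial time and polynomial output size at once and is closed under the constructions needed,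
  mainly folds whose accumulator stays small; the algorithms are then ordinary functions whose
  complexity follows from closure rules. Numbers are unary inside the programs, so a number of the
  input, which is binary and may be huge, is cut down to \<open>n * n\<close>, a bound on every
  quantity compared with it. Only the production of the certificates leaves polynomial time. As
  these are all trees below some height, that time can be measured in their number, and a power of
  two with this number as exponent is a time factor whose binary digits a program can write down
  without arithmetic. Edges are kept as ordered pairs, which accounts for the factors of
  two.\<close>

class encodable =
  fixes repr :: "'a \<Rightarrow> tree"
  assumes repr_inject: "repr x = repr y \<longleftrightarrow> x = y"

instantiation tree :: encodable
begin
definition "repr_tree (x :: tree) = x"
instance by standard (simp add: repr_tree_def)
end

instantiation bool :: encodable
begin
definition repr_bool where "repr = enc_bool"
instance by standard (simp add: repr_bool_def enc_bool_inject)
end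

instantiation unit :: encodable
begin
definition "repr_unit (x :: unit) = Leaf"
instance by standard simp
end

text \<open>Unary, in contrast to \<open>enc_nat\<close>: the size of a number is its value, and
  loops and arithmetic become list operations. The price is that values must be kept polynomially
  small.\<close>

instantiation nat :: encodable
begin
definition repr_nat where "repr (n :: nat) = enc_list (replicate n Leaf)"
instance
proof
  show "repr x = repr y \<longleftrightarrow> x = y" for x y :: nat
    unfolding repr_nat_def enc_list_inject by (metis length_replicate)
qed
end

instantiation prod :: (encodable, encodable) encodable
begin
definition "repr_prod z = Node (repr (fst z)) (repr (snd z))"
instance by standard (auto simp: repr_prod_def repr_inject prod_eq_iff)
end

instantiation list :: (encodable) encodable
begin
definition repr_list where "repr xs = enc_list (map repr xs)"
instance
proof
  show "repr x = repr y \<longleftrightarrow> x = y" for x y :: "'a list"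
    unfolding repr_list_def enc_list_inject
    by (rule inj_map_eq_map) (simp add: inj_def repr_inject)
qed
end

section \<open>Sizes of encoded values\<close>

abbreviation sz :: "'a::encodable \<Rightarrow> nat" where "sz x \<equiv> size (repr x)"

lemma repr_simps [simp]:
  "repr (t :: tree) = t"
  "repr True = Node Leaf Leaf" "repr False = Leaf"
  "repr () = Leaf"
  "repr (0::nat) = Leaf" "repr (Suc n) = Node Leaf (repr n)"
  "repr (a, b) = Node (repr a) (repr b)"
  "repr ([] :: 'a::encodable list) = Leaf" "repr (x # xs) = Node (repr x) (repr xs)"
  by (simp_all add: repr_tree_def repr_bool_def enc_bool_def repr_unit_def repr_nat_def
      repr_prod_def repr_list_def)

lemma left_repr [simp]: "left (repr z) = repr (fst z)" and right_repr [simp]: "right (repr z) = repr (snd z)"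
  by (cases z; simp)+

lemma repr_eq_Leaf_list [simp]: "repr (xs :: 'a::encodable list) = Leaf \<longleftrightarrow> xs = []"
  by (cases xs) auto

lemma repr_eq_Leaf_bool [simp]: "repr b = Leaf \<longleftrightarrow> \<not> b"
  by (cases b) auto

lemma sz_nat [simp]: "sz (n::nat) = n"
  by (induction n) auto

lemma sz_append [simp]: "sz (xs @ ys) = sz xs + sz ys"
  by (induction xs) auto

lemma sz_rev [simp]: "sz (rev xs) = sz xs"
  by (induction xs) auto

lemma sz_bool: "sz (b::bool) \<le> 1"
  by (cases b) auto

lemma sz_mem: "x \<in> set xs \<Longrightarrow> sz x < sz xs"
  by (induction xs) auto

lemma length_le_sz: "length xs \<le> sz xs"
  by (induction xs) auto

lemma sz_list_le: "(\<And>x. x \<in> set xs \<Longrightarrow> sz x \<le> b) \<Longrightarrow> sz xs \<le> length xs * (b + 1)"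
proof (induction xs)
  case (Cons x xs)
  have "sz x \<le> b" "sz xs \<le> length xs * (b + 1)" using Cons by auto
  then show ?case by simp
qed simp

text \<open>The base is at least 2, so constant terms and constant factors are absorbed by raising
  the exponent.\<close>

definition polyb :: "('a::encodable \<Rightarrow> nat) \<Rightarrow> bool" where
  "polyb g \<longleftrightarrow> (\<exists>c. \<forall>x. g x \<le> (sz x + 2) ^ c)"

lemma polyb_mono: "polyb g \<Longrightarrow> (\<And>x. h x \<le> g x) \<Longrightarrow> polyb h"
  unfolding polyb_def by (meson le_trans)

lemma polyb_const: "polyb (\<lambda>x. k)"
  unfolding polyb_def
proof (intro exI allI)
  fix x :: 'a
  have "k \<le> 2 ^ k" by (simp add: less_imp_le)
  also have "\<dots> \<le> (sz x + 2) ^ k" by (intro power_mono) auto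
  finally show "k \<le> (sz x + 2) ^ k" .
qed

lemma polyb_sz: "polyb (\<lambda>x. sz x)"
  unfolding polyb_def by (rule exI[of _ 1]) auto

lemma polyb_add:
  assumes "polyb f" "polyb g" shows "polyb (\<lambda>x. f x + g x)"
proof -
  obtain c d where cd: "\<And>x. f x \<le> (sz x + 2) ^ c" "\<And>x. g x \<le> (sz x + 2) ^ d"
    using assms unfolding polyb_def by blast
  have "f x + g x \<le> (sz x + 2) ^ (max c d + 1)" for x
  proof -
    have "f x \<le> (sz x + 2) ^ max c d" "g x \<le> (sz x + 2) ^ max c d"
      by (rule le_trans[OF cd(1)], rule power_increasing; simp)
         (rule le_trans[OF cd(2)], rule power_increasing; simp)
    then have "f x + g x \<le> 2 * (sz x + 2) ^ max c d" by simp
    also have "\<dots> \<le> (sz x + 2) ^ (max c d + 1)" by simp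
    finally show ?thesis .
  qed
  then show ?thesis unfolding polyb_def by blast
qed

lemma polyb_mult:
  assumes "polyb f" "polyb g" shows "polyb (\<lambda>x. f x * g x)"
proof -
  obtain c d where cd: "\<And>x. f x \<le> (sz x + 2) ^ c" "\<And>x. g x \<le> (sz x + 2) ^ d"
    using assms unfolding polyb_def by blast
  have "f x * g x \<le> (sz x + 2) ^ (c + d)" for x
    unfolding power_add using cd by (intro mult_mono) auto
  then show ?thesis unfolding polyb_def by blast
qed

lemma polyb_power: "polyb f \<Longrightarrow> polyb (\<lambda>x. f x ^ k)"
  proof (induction k)
  case 0
  show ?case using polyb_const[of 1] by simp
next
  case (Suc k)
  then show ?case using polyb_mult[of f "\<lambda>x. f x ^ k"] by simp
qed

lemma polyb_comp:
  assumes "polyb g" "polyb (\<lambda>x. sz (f x))" shows "polyb (\<lambda>x. g (f x))"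
proof -
  obtain c where "\<And>x. g x \<le> (sz x + 2) ^ c" using assms unfolding polyb_def by blast
  then show ?thesis
    by (rule polyb_mono[OF polyb_power[OF polyb_add[OF assms(2) polyb_const]]])
qed

subsection \<open>Programs\<close>

text \<open>Calls refer to positions in the program, so a program placed behind another one has to
  be renumbered.\<close>

fun shift :: "nat \<Rightarrow> expr \<Rightarrow> expr" where
  "shift k Arg = Arg"
| "shift k Nil_Expr = Nil_Expr"
| "shift k (Cons_Expr a b) = Cons_Expr (shift k a) (shift k b)"
| "shift k (Hd_Expr a) = Hd_Expr (shift k a)"
| "shift k (Tl_Expr a) = Tl_Expr (shift k a)"
| "shift k (If_Expr c a b) = If_Expr (shift k c) (shift k a) (shift k b)"
| "shift k (Call f a) = Call (k + f) (shift k a)"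

lemma eval_shift:
  assumes "eval p x e y t"
    and "\<And>i. i < length p \<Longrightarrow> k + i < length q \<and> q ! (k + i) = shift k (p ! i)"
  shows "eval q x (shift k e) y t"
  using assms(1)
proof induction
  case (eval_Call x a v s f y t)
  then show ?case using assms(2)[of f] eval.eval_Call[of q x "shift k a" v s "k + f" y t] by simp
qed (simp_all only: shift.simps, (rule eval.intros; assumption)+)

definition eval_le :: "program \<Rightarrow> tree \<Rightarrow> expr \<Rightarrow> tree \<Rightarrow> nat \<Rightarrow> bool" where
  "eval_le p x e y T \<longleftrightarrow> (\<exists>t\<le>T. eval p x e y t)"

lemma eval_le_mono: "eval_le p x e y s \<Longrightarrow> s \<le> t \<Longrightarrow> eval_le p x e y t"
  unfolding eval_le_def by (meson le_trans)

lemma eval_le_shift: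
  assumes "eval_le p x e y t"
    and "\<And>i. i < length p \<Longrightarrow> k + i < length q \<and> q ! (k + i) = shift k (p ! i)"
  shows "eval_le q x (shift k e) y t"
  using assms eval_shift unfolding eval_le_def by metis

lemma eval_append: "eval p x e y t \<Longrightarrow> eval (p @ q) x e y t"
proof (induction rule: eval.induct)
  case (eval_Call x a v s f y t)
  then show ?case using eval.eval_Call[of "p @ q" x a v s f y t] by (simp add: nth_append)
qed (rule eval.intros; assumption)+

lemma eval_le_append: "eval_le p x e y t \<Longrightarrow> eval_le (p @ q) x e y t"
  unfolding eval_le_def using eval_append by blast

lemma eval_le_append2: "eval_le p x e y t \<Longrightarrow> eval_le (q @ map (shift (length q)) p) x (shift (length q) e) y t"
  by (erule eval_le_shift) (auto simp: nth_append)

lemma eval_le_Arg: "eval_le p x Arg x 1"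
  and eval_le_Nil: "eval_le p x Nil_Expr Leaf 1"
  unfolding eval_le_def by (rule exI[of _ 1], rule conjI[OF le_refl], rule eval.intros)+

lemma eval_le_Cons: "eval_le p x a y s \<Longrightarrow> eval_le p x b z t \<Longrightarrow> eval_le p x (Cons_Expr a b) (Node y z) (s + t + 1)"
  unfolding eval_le_def
  by (elim exE conjE, rule exI, rule conjI[rotated], erule (1) eval.eval_Cons, simp)

lemma eval_le_Hd: "eval_le p x a y t \<Longrightarrow> eval_le p x (Hd_Expr a) (left y) (t + 1)"
  unfolding eval_le_def by (elim exE conjE, rule exI, rule conjI[rotated], erule eval.eval_Hd, simp)

lemma eval_le_Tl: "eval_le p x a y t \<Longrightarrow> eval_le p x (Tl_Expr a) (right y) (t + 1)"
  unfolding eval_le_def by (elim exE conjE, rule exI, rule conjI[rotated], erule eval.eval_Tl, simp)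

lemma eval_le_If_True: "eval_le p x c v s \<Longrightarrow> v \<noteq> Leaf \<Longrightarrow> eval_le p x a y t \<Longrightarrow> eval_le p x (If_Expr c a b) y (s + t + 1)"
  unfolding eval_le_def
  by (elim exE conjE, rule exI, rule conjI[rotated], erule (2) eval.eval_If_True, simp)

lemma eval_le_If_False: "eval_le p x c Leaf s \<Longrightarrow> eval_le p x b y t \<Longrightarrow> eval_le p x (If_Expr c a b) y (s + t + 1)"
  unfolding eval_le_def
  by (elim exE conjE, rule exI, rule conjI[rotated], erule (1) eval.eval_If_False, simp)

lemma eval_le_Call: "eval_le p x a v s \<Longrightarrow> f < length p \<Longrightarrow> eval_le p v (p ! f) y t \<Longrightarrow>
    eval_le p x (Call f a) y (s + t + 1)"
  unfolding eval_le_def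
  by (elim exE conjE, rule exI, rule conjI[rotated], erule (2) eval.eval_Call, simp)

text \<open>An expression sees nothing but its argument, so the second stage is turned into a
  function body and called with the result of the first.\<close>

lemma eval_le_compose:
  obtains P E where "\<And>x y z s t. eval_le p x e y s \<Longrightarrow> eval_le q y e' z t \<Longrightarrow> eval_le P x E z (s + t + 1)"
proof -
  let ?n = "length p"
  \<comment> \<open>The body \<open>e'\<close> gets number \<open>?n\<close>, right behind
    \<open>p\<close>; the functions of \<open>q\<close> follow it and are therefore shifted by one
    more.\<close>
  let ?P = "p @ shift ?n (shift 1 e') # map (shift ?n) (map (shift 1) q)"
  have sh: "eval_le ?P x (shift ?n (shift 1 e')) y t" if "eval_le q x e' y t" for x y t
    by (rule eval_le_shift[OF eval_le_shift[OF that, where k=1 and q="shift 1 e' # map (shift 1) q"]])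
      (auto simp: nth_append nth_Cons split: nat.splits)
  have "eval_le ?P x (Call ?n e) z (s + t + 1)" if "eval_le p x e y s" "eval_le q y e' z t" for x y z s t
    by (rule eval_le_Call[OF eval_le_append[OF that(1)]]) (use sh[OF that(2)] in \<open>auto simp: nth_append\<close>)
  then show ?thesis by (rule that)
qed

text \<open>The size of the output has to be bounded separately, since a short computation can build an
  exponentially large tree by sharing.\<close>

definition PT :: "('a::encodable \<Rightarrow> 'b::encodable) \<Rightarrow> bool" where
  "PT f \<longleftrightarrow> polyb (\<lambda>x. sz (f x)) \<and>
     (\<exists>p e T. polyb T \<and> (\<forall>x. eval_le p (repr x) e (repr (f x)) (T x)))"

lemma PT_I: "polyb (\<lambda>x. sz (f x)) \<Longrightarrow> polyb T \<Longrightarrow>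
    (\<And>x. eval_le p (repr x) e (repr (f x)) (T x)) \<Longrightarrow> PT f"
  unfolding PT_def by blast

lemma PT_polyb: "PT f \<Longrightarrow> polyb (\<lambda>x. sz (f x))"
  unfolding PT_def by blast

text \<open>Only encodings matter for \<open>PT\<close>. Cons, \<open>Node\<close> and
  \<open>Suc\<close> build the same tree as a pair, and \<open>fst\<close>, \<open>snd\<close>,
  \<open>tl\<close> and the predecessor are the two projections, so all these types share a handful
  of programs.\<close>

lemma PT_recode: "PT f \<Longrightarrow> (\<And>x. repr (g x) = repr (f x)) \<Longrightarrow> PT g"
  unfolding PT_def by simp

lemma PT_two:
  fixes f :: "'a::encodable \<Rightarrow> 'b::encodable" and g :: "'a \<Rightarrow> 'c::encodable"
  assumes "PT f" "PT g"
  obtains p e e' T T' where "polyb T" "polyb T'"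
    "\<And>x. eval_le p (repr x) e (repr (f x)) (T x)" "\<And>x. eval_le p (repr x) e' (repr (g x)) (T' x)"
proof -
  obtain p e T q e' T' where *: "polyb T" "\<And>x. eval_le p (repr x) e (repr (f x)) (T x)"
     "polyb T'" "\<And>x. eval_le q (repr x) e' (repr (g x)) (T' x)"
    using assms unfolding PT_def by metis
  have "eval_le (p @ map (shift (length p)) q) (repr x) e (repr (f x)) (T x)"
    "eval_le (p @ map (shift (length p)) q) (repr x) (shift (length p) e') (repr (g x)) (T' x)" for x
    using * eval_le_append eval_le_append2 by blast+
  with *(1,3) show ?thesis by (rule that)
qed

named_theorems PT_rules

lemma PT_const [PT_rules]: "PT (\<lambda>x. c)"
proof -
  have "\<exists>e t. \<forall>x. eval_le [] x e y t" for y
  proof (induction y)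
    case Leaf
    then show ?case using eval_le_Nil by blast
  next
    case (Node y1 y2)
    then show ?case using eval_le_Cons by metis
  qed
  then obtain e t where "\<And>x. eval_le [] x e (repr c) t" by metis
  then show ?thesis by (rule PT_I[OF polyb_const polyb_const])
qed

lemma PT_id [PT_rules]: "PT (\<lambda>x. x)"
  by (rule PT_I[OF polyb_sz polyb_const eval_le_Arg])

lemma PT_comp: assumes "PT f" "PT g" shows "PT (\<lambda>x. g (f x))"
proof -
  obtain p e T q e' T' where *: "polyb T" "\<And>x. eval_le p (repr x) e (repr (f x)) (T x)"
     "polyb T'" "\<And>x. eval_le q (repr x) e' (repr (g x)) (T' x)"
    using assms unfolding PT_def by metis
  obtain P E where "\<And>x y z s t. eval_le p x e y s \<Longrightarrow> eval_le q y e' z t \<Longrightarrow> eval_le P x E z (s + t + 1)"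
    by (rule eval_le_compose) (erule that)
  from this[OF *(2) *(4)] have ev: "eval_le P (repr x) E (repr (g (f x))) (T x + T' (f x) + 1)" for x .
  show ?thesis
  proof (rule PT_I[OF _ _ ev])
    show "polyb (\<lambda>x. sz (g (f x)))"
      by (rule polyb_comp[OF PT_polyb[OF assms(2)] PT_polyb[OF assms(1)]])
    show "polyb (\<lambda>x. T x + T' (f x) + 1)"
      by (intro polyb_add polyb_const * polyb_comp[OF *(3) PT_polyb[OF assms(1)]])
  qed
qed

lemma PT_Pair [PT_rules]: assumes "PT f" "PT g" shows "PT (\<lambda>x. (f x, g x))"
proof -
  obtain p e e' T T' where *: "polyb T" "polyb T'"
    "\<And>x. eval_le p (repr x) e (repr (f x)) (T x)" "\<And>x. eval_le p (repr x) e' (repr (g x)) (T' x)"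
    using PT_two[OF assms] by metis
  have "polyb (\<lambda>x. sz (f x) + sz (g x) + 1)"
    using assms[THEN PT_polyb] by (intro polyb_add polyb_const)
  then have pb: "polyb (\<lambda>x. sz (f x, g x))" by simp
  have ev: "eval_le p (repr x) (Cons_Expr e e') (repr (f x, g x)) (T x + T' x + 1)" for x
    using eval_le_Cons[OF *(3,4)] by simp
  show ?thesis
    by (rule PT_I[OF pb _ ev]) (intro polyb_add polyb_const *(1,2))
qed

lemma PT_recode2: "PT f \<Longrightarrow> PT g \<Longrightarrow> (\<And>x. repr (h x) = Node (repr (f x)) (repr (g x))) \<Longrightarrow> PT h"
  using PT_recode[OF PT_Pair] by (metis repr_simps(7))

lemma PT_Cons [PT_rules]: "PT f \<Longrightarrow> PT g \<Longrightarrow> PT (\<lambda>x. f x # g x)"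
  by (rule PT_recode2[of f g]) simp_all

lemma PT_Node [PT_rules]: "PT f \<Longrightarrow> PT g \<Longrightarrow> PT (\<lambda>x. Node (f x) (g x))"
  by (rule PT_recode2[of f g]) simp_all

lemma PT_Suc [PT_rules]: "PT f \<Longrightarrow> PT (\<lambda>x. Suc (f x))"
  by (rule PT_recode2[OF PT_const[of Leaf], of f]) simp_all

lemma size_left: "size (left t) \<le> size t" and size_right: "size (right t) \<le> size t"
  by (cases t; simp)+

lemma PT_Hd_Tl:
  assumes "PT f" shows "PT (\<lambda>x. left (repr (f x)))" "PT (\<lambda>x. right (repr (f x)))"
proof -
  obtain p e T where *: "polyb T" "\<And>x. eval_le p (repr x) e (repr (f x)) (T x)"
    using assms unfolding PT_def by metis
  show "PT (\<lambda>x. left (repr (f x)))"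
  proof (rule PT_I)
    show "eval_le p (repr x) (Hd_Expr e) (repr (left (repr (f x)))) (T x + 1)" for x
      using eval_le_Hd[OF *(2)] by simp
    show "polyb (\<lambda>x. sz (left (repr (f x))))"
      by (rule polyb_mono[OF PT_polyb[OF assms]]) (simp add: size_left)
  qed (intro polyb_add polyb_const *)
  show "PT (\<lambda>x. right (repr (f x)))"
  proof (rule PT_I)
    show "eval_le p (repr x) (Tl_Expr e) (repr (right (repr (f x)))) (T x + 1)" for x
      using eval_le_Tl[OF *(2)] by simp
    show "polyb (\<lambda>x. sz (right (repr (f x))))"
      by (rule polyb_mono[OF PT_polyb[OF assms]]) (simp add: size_right)
  qed (intro polyb_add polyb_const *)
qed

lemma PT_repr [PT_rules]: "PT f \<Longrightarrow> PT (\<lambda>x. repr (f x))"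
  by (rule PT_recode[of f]) simp_all

lemma PT_left [PT_rules]: "PT f \<Longrightarrow> PT (\<lambda>x. left (f x))"
  by (rule PT_recode[OF PT_Hd_Tl(1), of f]) simp_all

lemma PT_right [PT_rules]: "PT f \<Longrightarrow> PT (\<lambda>x. right (f x))"
  by (rule PT_recode[OF PT_Hd_Tl(2), of f]) simp_all

lemma PT_fst [PT_rules]: "PT f \<Longrightarrow> PT (\<lambda>x. fst (f x))"
  by (rule PT_recode[OF PT_Hd_Tl(1), of f]) simp_all

lemma PT_snd [PT_rules]: "PT f \<Longrightarrow> PT (\<lambda>x. snd (f x))"
  by (rule PT_recode[OF PT_Hd_Tl(2), of f]) simp_all

lemma PT_tl [PT_rules]: "PT f \<Longrightarrow> PT (\<lambda>x. tl (f x))"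
proof (rule PT_recode[OF PT_Hd_Tl(2), of f], assumption)
  show "repr (tl (f x)) = repr (right (repr (f x)))" for x
    by (cases "f x") auto
qed

lemma PT_pred [PT_rules]: "PT f \<Longrightarrow> PT (\<lambda>x. f x - Suc 0)"
proof (rule PT_recode[OF PT_Hd_Tl(2), of f], assumption)
  show "repr (f x - Suc 0) = repr (right (repr (f x)))" for x
    by (cases "f x") auto
qed

text \<open>Whichever branch is selected, both are computed: \<open>PT_two\<close> places only two
  expressions in one program, hence the branches form a pair and the test selects a
  component.\<close>

lemma PT_if [PT_rules]: assumes "PT P" "PT f" "PT g" shows "PT (\<lambda>x. if P x then f x else g x)"
proof -
  obtain p e e' T T' where *: "polyb T" "polyb T'"
    "\<And>x. eval_le p (repr x) e (repr (f x, g x)) (T x)" "\<And>x. eval_le p (repr x) e' (repr (P x)) (T' x)"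
    using PT_two[OF PT_Pair[OF assms(2,3)] assms(1)] by metis
  show ?thesis
  proof (rule PT_I)
    show "polyb (\<lambda>x. sz (if P x then f x else g x))"
      by (rule polyb_mono[OF polyb_add[OF PT_polyb[OF assms(2)] PT_polyb[OF assms(3)]]]) simp
    show "eval_le p (repr x) (If_Expr e' (Hd_Expr e) (Tl_Expr e)) (repr (if P x then f x else g x))
       (T' x + (T x + 1) + 1)" for x
    proof (cases "P x")
      case True
      then show ?thesis using eval_le_If_True[OF *(4) _ eval_le_Hd[OF *(3)]] by simp
    next
      case False
      then show ?thesis using eval_le_If_False[OF _ eval_le_Tl[OF *(3)]] *(4)[of x] by simp
    qed
  qed (intro polyb_add polyb_const *)
qed

lemma PT_hd_default [PT_rules]: assumes "PT f" "PT d" shows "PT (\<lambda>x. case f x of [] \<Rightarrow> d x | h # _ \<Rightarrow> h)"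
proof -
  obtain p e e' T T' where *: "polyb T" "polyb T'"
    "\<And>x. eval_le p (repr x) e (repr (f x)) (T x)" "\<And>x. eval_le p (repr x) e' (repr (d x)) (T' x)"
    using PT_two[OF assms] by metis
  show ?thesis
  proof (rule PT_I)
    show "polyb (\<lambda>x. sz (case f x of [] \<Rightarrow> d x | h # _ \<Rightarrow> h))"
      by (rule polyb_mono[OF polyb_add[OF PT_polyb[OF assms(1)] PT_polyb[OF assms(2)]]])
        (simp split: list.split)
    show "eval_le p (repr x) (If_Expr e (Hd_Expr e) e') (repr (case f x of [] \<Rightarrow> d x | h # _ \<Rightarrow> h))
       (T x + (T x + 1 + T' x) + 1)" for x
    proof (cases "f x")
      case Nil
      then have "eval_le p (repr x) (If_Expr e (Hd_Expr e) e') (repr (d x)) (T x + T' x + 1)"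
        using eval_le_If_False[OF _ *(4)] *(3)[of x] by simp
      then show ?thesis using Nil by (auto intro: eval_le_mono)
    next
      case (Cons h t)
      then have "eval_le p (repr x) (If_Expr e (Hd_Expr e) e') (repr h) (T x + (T x + 1) + 1)"
        using eval_le_If_True[OF *(3) _ eval_le_Hd[OF *(3)], of x] by simp
      then show ?thesis using Cons by (auto intro: eval_le_mono)
    qed
  qed (intro polyb_add polyb_const *)
qed

subsection \<open>Iteration\<close>

text \<open>Function 0 is the loop on the state \<open>(x, (l, a))\<close>, function 1 leads into
  the step. Program and exponent are fixed before the bound \<open>M\<close> on the intermediate
  accumulators, so the lemma also serves loops whose accumulators outgrow every polynomial in the
  input.\<close>

lemma foldl_program:
  fixes step :: "'x::encodable \<Rightarrow> 'a::encodable \<Rightarrow> 'h::encodable \<Rightarrow> 'a"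
  assumes "PT (\<lambda>z. step (fst z) (fst (snd z)) (snd (snd z)))"
  obtains p e c where
    "\<And>x l a M. (\<And>ys zs. l = ys @ zs \<Longrightarrow> sz (foldl (step x) a ys) \<le> M) \<Longrightarrow>
      eval_le p (repr (x, (l, a))) e (repr (foldl (step x) a l)) ((length l + 1) * (sz x + sz l + M + 30) ^ c)"
proof -
  let ?f = "\<lambda>z. step (fst z) (fst (snd z)) (snd (snd z))"
  obtain q e T where *: "polyb T" "\<And>z. eval_le q (repr z) e (repr (?f z)) (T z)"
    using assms unfolding PT_def by blast
  obtain c where c: "\<And>z. T z \<le> (sz z + 2) ^ c" using *(1) unfolding polyb_def by blast
  let ?l = "Hd_Expr (Tl_Expr Arg)"
  let ?B = "If_Expr ?l (Call 0 (Cons_Expr (Hd_Expr Arg) (Cons_Expr (Tl_Expr ?l)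
     (Call 1 (Cons_Expr (Hd_Expr Arg) (Cons_Expr (Tl_Expr (Tl_Expr Arg)) (Hd_Expr ?l)))))))
     (Tl_Expr (Tl_Expr Arg))"
  let ?P = "?B # shift 2 e # map (shift 2) q"
  have st: "eval_le ?P (repr z) (shift 2 e) (repr (?f z)) (T z)" for z
    by (rule eval_le_shift[OF *(2)]) (auto simp: nth_Cons split: nat.splits)
  note proj = eval_le_Arg eval_le_Hd eval_le_Tl
  \<comment> \<open>\<open>Q\<close> dominates all sizes and stays fixed while the list shrinks. The
    constant 30 lets one factor \<open>Q\<close> pay for the overhead of 27 steps per round together
    with the time \<open>T\<close> of the step.\<close>
  have main: "eval_le ?P (repr (x, (l, a))) (Call 0 Arg) (repr (foldl (step x) a l))
      ((length l + 1) * Q ^ (c + 1))"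
    if "\<And>ys zs. l = ys @ zs \<Longrightarrow> sz (foldl (step x) a ys) \<le> M" "sz x + sz l + M + 30 \<le> Q"
    for x l a M Q
    using that
  proof (induction l arbitrary: a)
    case Nil
    let ?x = "repr (x, ([]::'h list, a))"
    have l: "eval_le ?P ?x ?l Leaf 3" using eval_le_Hd[OF eval_le_Tl[OF eval_le_Arg, of ?P ?x]] by (simp add: eval_nat_numeral)
    have acc: "eval_le ?P ?x (Tl_Expr (Tl_Expr Arg)) (repr a) 3"
      using eval_le_Tl[OF eval_le_Tl[OF eval_le_Arg, of ?P ?x]] by (simp add: eval_nat_numeral)
    have "eval_le ?P ?x ?B (repr a) (3 + 3 + 1)" by (rule eval_le_If_False[OF l acc])
    then have "eval_le ?P ?x (Call 0 Arg) (repr a) (1 + (3 + 3 + 1) + 1)"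
      by (intro eval_le_Call[OF eval_le_Arg]) simp_all
    moreover have "(9::nat) \<le> Q ^ (c + 1)"
    proof -
      have "9 \<le> Q ^ 1" using Nil(2) by simp
      also have "\<dots> \<le> Q ^ (c + 1)" using Nil(2) by (intro power_increasing) auto
      finally show ?thesis .
    qed
    ultimately show ?case by (simp add: eval_le_mono)
  next
    case (Cons h l)
    let ?x = "repr (x, (h # l, a))"
    let ?a = "step x a h"
    have hd: "eval_le ?P ?x (Hd_Expr Arg) (repr x) 2" using eval_le_Hd[OF eval_le_Arg, of ?P ?x] by (simp add: eval_nat_numeral)
    have l: "eval_le ?P ?x ?l (repr (h # l)) 3" using eval_le_Hd[OF eval_le_Tl[OF eval_le_Arg, of ?P ?x]] by (simp add: eval_nat_numeral)
    have hl: "eval_le ?P ?x (Hd_Expr ?l) (repr h) 4" using eval_le_Hd[OF l] by (simp add: eval_nat_numeral)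
    have tl: "eval_le ?P ?x (Tl_Expr ?l) (repr l) 4" using eval_le_Tl[OF l] by (simp add: eval_nat_numeral)
    have acc: "eval_le ?P ?x (Tl_Expr (Tl_Expr Arg)) (repr a) 3"
      using eval_le_Tl[OF eval_le_Tl[OF eval_le_Arg, of ?P ?x]] by (simp add: eval_nat_numeral)
    have c1: "eval_le ?P ?x (Call 1 (Cons_Expr (Hd_Expr Arg) (Cons_Expr (Tl_Expr (Tl_Expr Arg)) (Hd_Expr ?l))))
      (repr ?a) (2 + (3 + 4 + 1) + 1 + T (x, (a, h)) + 1)"
      by (rule eval_le_Call[OF eval_le_Cons[OF hd eval_le_Cons[OF acc hl]]])
        (use st[of "(x, (a, h))"] in auto)
    have IH: "eval_le ?P (repr (x, (l, ?a))) (Call 0 Arg) (repr (foldl (step x) ?a l)) ((length l + 1) * Q ^ (c + 1))"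
    proof (rule Cons.IH)
      show "sz (foldl (step x) ?a ys) \<le> M" if "l = ys @ zs" for ys zs
        using Cons.prems(1)[of "h # ys" zs] that by simp
      show "sz x + sz l + M + 30 \<le> Q" using Cons.prems(2) by simp
    qed
    \<comment> \<open>The recursive call evaluates the body \<open>?B\<close> in the new state,
      whereas the induction hypothesis speaks of a call; inverting that call exposes the
      body.\<close>
    then have IH': "eval_le ?P (repr (x, (l, ?a))) ?B (repr (foldl (step x) ?a l)) ((length l + 1) * Q ^ (c + 1))"
      unfolding eval_le_def
    proof (elim exE conjE)
      fix t assume "t \<le> (length l + 1) * Q ^ (c + 1)"
        and "eval ?P (repr (x, (l, ?a))) (Call 0 Arg) (repr (foldl (step x) ?a l)) t"
      from this(2,1) show "\<exists>t\<le>(length l + 1) * Q ^ (c + 1). eval ?P (repr (x, (l, ?a))) ?B (repr (foldl (step x) ?a l)) t"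
      proof cases
        case (eval_Call v s t')
        from eval_Call(2) have "v = repr (x, (l, ?a))" by cases auto
        then show ?thesis using eval_Call \<open>t \<le> _\<close> by (intro exI[of _ t']) auto
      qed
    qed
    have c0: "eval_le ?P ?x (Call 0 (Cons_Expr (Hd_Expr Arg) (Cons_Expr (Tl_Expr ?l)
     (Call 1 (Cons_Expr (Hd_Expr Arg) (Cons_Expr (Tl_Expr (Tl_Expr Arg)) (Hd_Expr ?l)))))))
     (repr (foldl (step x) ?a l)) 
     (2 + (4 + (2 + (3 + 4 + 1) + 1 + T (x, (a, h)) + 1) + 1) + 1 + (length l + 1) * Q ^ (c + 1) + 1)"
      by (rule eval_le_Call[OF eval_le_Cons[OF hd eval_le_Cons[OF tl c1]]]) (use IH' in auto)
    have b: "eval_le ?P ?x ?B (repr (foldl (step x) ?a l))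
     (3 + (2 + (4 + (2 + (3 + 4 + 1) + 1 + T (x, (a, h)) + 1) + 1) + 1 + (length l + 1) * Q ^ (c + 1) + 1) + 1)"
      by (rule eval_le_If_True[OF l _ c0]) simp
    have call: "eval_le ?P ?x (Call 0 Arg) (repr (foldl (step x) a (h # l))) 
     (1 + (3 + (2 + (4 + (2 + (3 + 4 + 1) + 1 + T (x, (a, h)) + 1) + 1) + 1 + (length l + 1) * Q ^ (c + 1) + 1) + 1) + 1)"
      by (rule eval_le_Call[OF eval_le_Arg]) (use b in auto)
    show ?case
    proof (rule eval_le_mono[OF call])
      have "sz a \<le> M" using Cons.prems(1)[of "[]"] by simp
      then have "sz (x, (a, h)) + 2 \<le> Q" using Cons.prems(2) by simp
      then have T: "T (x, (a, h)) \<le> Q ^ c" using c[of "(x,(a,h))"] by (meson le_trans power_mono zero_le)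
      have "27 + T (x, (a, h)) \<le> 27 * 1 + Q ^ c" using T by simp
      also have "\<dots> \<le> 27 * Q ^ c + Q ^ c" using Cons.prems(2) by (intro add_mono mult_mono) auto
      also have "\<dots> = 28 * Q ^ c" by simp
      also have "\<dots> \<le> Q ^ (c + 1)" using Cons.prems(2) by simp
      finally show "1 + (3 + (2 + (4 + (2 + (3 + 4 + 1) + 1 + T (x, (a, h)) + 1) + 1) + 1 + (length l + 1) * Q ^ (c + 1) + 1) + 1) + 1
         \<le> (length (h # l) + 1) * Q ^ (c + 1)"
        by simp
    qed
  qed
  show ?thesis
  proof (rule that[of ?P "Call 0 Arg" "c + 1"])
    fix x :: 'x and l :: "'h list" and a :: 'a and M assume "\<And>ys zs. l = ys @ zs \<Longrightarrow> sz (foldl (step x) a ys) \<le> M"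
    then show "eval_le ?P (repr (x, (l, a))) (Call 0 Arg) (repr (foldl (step x) a l))
        ((length l + 1) * (sz x + sz l + M + 30) ^ (c + 1))"
      by (rule main[OF _ le_refl])
  qed
qed

lemma PT_comp2: "PT (\<lambda>z. g (fst z) (snd z)) \<Longrightarrow> PT a \<Longrightarrow> PT b \<Longrightarrow> PT (\<lambda>x. g (a x) (b x))"
  using PT_comp[OF PT_Pair[of a b], of "\<lambda>z. g (fst z) (snd z)"] by simp

text \<open>The bound \<open>b\<close> on the intermediate accumulators cannot be derived from
  \<open>PT\<close> of the step, since iterated polynomial growth may be exponential.\<close>

lemma PT_foldl:
  fixes step :: "'x::encodable \<Rightarrow> 'a::encodable \<Rightarrow> 'h::encodable \<Rightarrow> 'a"
  assumes "PT (\<lambda>z. step (fst z) (fst (snd z)) (snd (snd z)))" "PT l" "PT a" "polyb b"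
    and b: "\<And>x ys zs. l x = ys @ zs \<Longrightarrow> sz (foldl (step x) (a x) ys) \<le> b x"
  shows "PT (\<lambda>x. foldl (step x) (a x) (l x))"
proof -
  obtain q e' c where fold: "\<And>x l a M. (\<And>ys zs. l = ys @ zs \<Longrightarrow> sz (foldl (step x) a ys) \<le> M) \<Longrightarrow>
      eval_le q (repr (x, (l, a))) e' (repr (foldl (step x) a l)) ((length l + 1) * (sz x + sz l + M + 30) ^ c)"
    using foldl_program[OF assms(1)] by blast
  have "PT (\<lambda>x. (x, (l x, a x)))" by (intro PT_Pair PT_id assms)
  then obtain p e T where T: "polyb T" "\<And>x. eval_le p (repr x) e (repr (x, (l x, a x))) (T x)"
    unfolding PT_def by metis
  obtain P E where "\<And>x y z s t. eval_le p x e y s \<Longrightarrow> eval_le q y e' z t \<Longrightarrow> eval_le P x E z (s + t + 1)"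
    by (rule eval_le_compose) (erule that)
  from this[OF T(2) fold[OF b]]
  have ev: "eval_le P (repr x) E (repr (foldl (step x) (a x) (l x)))
      (T x + (length (l x) + 1) * (sz x + sz (l x) + b x + 30) ^ c + 1)" for x .
  show ?thesis
  proof (rule PT_I[OF _ _ ev])
    show "polyb (\<lambda>x. sz (foldl (step x) (a x) (l x)))"
      by (rule polyb_mono[OF assms(4)]) (rule b[of _ _ "[]"], simp)
    have "polyb (\<lambda>x. length (l x))"
      by (rule polyb_mono[OF PT_polyb[OF assms(2)]]) (rule length_le_sz)
    then show "polyb (\<lambda>x. T x + (length (l x) + 1) * (sz x + sz (l x) + b x + 30) ^ c + 1)"
      by (intro polyb_add polyb_mult polyb_power polyb_const polyb_sz T(1) assms PT_polyb[OF assms(2)])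
  qed
qed

section \<open>List operations as folds\<close>

lemma polyb_length: "PT f \<Longrightarrow> polyb (\<lambda>x. length (f x))"
  by (rule polyb_mono[OF PT_polyb]) (auto intro: length_le_sz)

lemma foldl_Cons: "foldl (\<lambda>a h. f h # a) b xs = rev (map f xs) @ b"
  by (induction xs arbitrary: b) auto

lemma PT_rev [PT_rules]: assumes "PT f" shows "PT (\<lambda>x. rev (f x))"
proof -
  have "PT (\<lambda>x. foldl (\<lambda>a h. h # a) [] (f x))"
    by (rule PT_foldl[OF _ _ _ PT_polyb[OF assms]], (intro PT_rules assms)+) (simp add: foldl_Cons[of "\<lambda>x. x"])
  then show ?thesis by (simp add: foldl_Cons[of "\<lambda>x. x"])
qed

lemma PT_append [PT_rules]: assumes "PT f" "PT g" shows "PT (\<lambda>x. f x @ g x)"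
proof -
  have "PT (\<lambda>x. foldl (\<lambda>a h. h # a) (g x) (rev (f x)))"
  proof (rule PT_foldl)
    show "polyb (\<lambda>x. sz (f x) + sz (g x))" by (intro polyb_add PT_polyb assms)
    show "sz (foldl (\<lambda>a h. h # a) (g x) ys) \<le> sz (f x) + sz (g x)" if "rev (f x) = ys @ zs" for x ys zs
    proof -
      have "sz (f x) = sz ys + sz zs" using that by (metis sz_append sz_rev)
      then show ?thesis by (simp add: foldl_Cons[of "\<lambda>x. x"])
    qed
  qed (intro PT_rules assms)+
  then show ?thesis by (simp add: foldl_Cons[of "\<lambda>x. x"])
qed

text \<open>Elements are smaller than the list that contains them, so one polynomial bounds the
  results on all of them.\<close>

lemma PT_elem_bound:
  assumes "PT (\<lambda>z. F (fst z) (snd z))" "PT l"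
  obtains b where "polyb b" "\<And>x h. h \<in> set (l x) \<Longrightarrow> sz (F x h) \<le> b x"
proof -
  from PT_polyb[OF assms(1)] obtain c where c: "\<And>z. sz (F (fst z) (snd z)) \<le> (sz z + 2) ^ c"
    unfolding polyb_def by blast
  show ?thesis
  proof (rule that)
    show "polyb (\<lambda>x. (sz x + sz (l x) + 3) ^ c)"
      by (intro polyb_power polyb_add polyb_sz polyb_const PT_polyb assms)
    show "sz (F x h) \<le> (sz x + sz (l x) + 3) ^ c" if "h \<in> set (l x)" for x h
      using c[of "(x, h)"] sz_mem[OF that] by (auto elim!: le_trans intro!: power_mono)
  qed
qed

lemma PT_map [PT_rules]: assumes "PT (\<lambda>z. F (fst z) (snd z))" "PT l" shows "PT (\<lambda>x. map (F x) (l x))"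
proof -
  obtain b where b: "polyb b" "\<And>x h. h \<in> set (l x) \<Longrightarrow> sz (F x h) \<le> b x"
    using PT_elem_bound[OF assms] by blast
  have "PT (\<lambda>x. foldl (\<lambda>a h. F x h # a) [] (l x))"
  proof (rule PT_foldl)
    have "PT (\<lambda>z. F (fst z) (snd (snd z)))"
      by (rule PT_comp2[of F, OF assms(1)]) (intro PT_rules)+
    then show "PT (\<lambda>z. F (fst z) (snd (snd z)) # fst (snd z))"
      by (intro PT_rules)
    show "polyb (\<lambda>x. length (l x) * (b x + 1))"
      by (intro polyb_mult polyb_add polyb_const b polyb_length assms)
    show "sz (foldl (\<lambda>a h. F x h # a) [] ys) \<le> length (l x) * (b x + 1)" if "l x = ys @ zs" for x ys zs
    proof -
      have "sz (map (F x) ys) \<le> length (map (F x) ys) * (b x + 1)"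
        by (rule sz_list_le) (use b(2)[of _ x] that in auto)
      also have "\<dots> \<le> length (l x) * (b x + 1)" using that by (intro mult_mono) auto
      finally show ?thesis by (simp add: foldl_Cons)
    qed
  qed (intro PT_rules assms)+
  from PT_rev[OF this] show ?thesis by (simp add: foldl_Cons)
qed

lemma sz_filter: "sz (filter P xs) \<le> sz xs"
  by (induction xs) auto

lemma PT_filter [PT_rules]:
  assumes "PT (\<lambda>z. P (fst z) (snd z))" "PT l" shows "PT (\<lambda>x. filter (P x) (l x))"
proof -
  have eq: "foldl (\<lambda>a h. if P x h then h # a else a) b xs = rev (filter (P x) xs) @ b" for x b xs
    by (induction xs arbitrary: b) auto
  have "PT (\<lambda>x. foldl (\<lambda>a h. if P x h then h # a else a) [] (l x))"
  proof (rule PT_foldl)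
    have "PT (\<lambda>z. P (fst z) (snd (snd z)))"
      by (rule PT_comp2[of P, OF assms(1)]) (intro PT_rules)+
    then show "PT (\<lambda>z. if P (fst z) (snd (snd z)) then snd (snd z) # fst (snd z) else fst (snd z))"
      by (intro PT_rules)
    show "sz (foldl (\<lambda>a h. if P x h then h # a else a) [] ys) \<le> sz (l x)" if "l x = ys @ zs" for x ys zs
      using sz_filter[of "P x" ys] that by (simp add: eq)
  qed (intro PT_rules assms PT_polyb)+
  from PT_rev[OF this] show ?thesis by (simp add: eq)
qed

lemma PT_concat [PT_rules]: assumes "PT l" shows "PT (\<lambda>x. concat (l x))"
proof -
  have eq: "foldl (@) b xs = b @ concat xs" for b :: "'b list" and xs
    by (induction xs arbitrary: b) auto
  have sz_concat: "sz (concat xs) \<le> sz xs" for xs :: "'b list list" by (induction xs) auto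
  have "PT (\<lambda>x. foldl (\<lambda>a h. a @ h) [] (l x))"
  proof (rule PT_foldl)
    show "sz (foldl (@) [] ys) \<le> sz (l x)" if "l x = ys @ zs" for x ys zs
      using sz_concat[of ys] that by (simp add: eq)
  qed (intro PT_rules assms PT_polyb)+
  then show ?thesis by (simp add: eq)
qed

lemma PT_not [PT_rules]: assumes "PT P" shows "PT (\<lambda>x. \<not> P x)"
  using PT_if[OF assms PT_const[of False] PT_const[of True]] by (rule PT_recode) simp

lemma PT_conj [PT_rules]: assumes "PT P" "PT Q" shows "PT (\<lambda>x. P x \<and> Q x)"
  using PT_if[OF assms PT_const[of False]] by (rule PT_recode) simp

lemma PT_disj [PT_rules]: assumes "PT P" "PT Q" shows "PT (\<lambda>x. P x \<or> Q x)"
  using PT_if[OF assms(1) PT_const[of True] assms(2)] by (rule PT_recode) simp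

lemma PT_bex [PT_rules]:
  assumes "PT (\<lambda>z. P (fst z) (snd z))" "PT l" shows "PT (\<lambda>x. \<exists>h\<in>set (l x). P x h)"
proof -
  have eq: "foldl (\<lambda>a h. a \<or> P x h) b xs = (b \<or> (\<exists>h\<in>set xs. P x h))" for x b xs
    by (induction xs arbitrary: b) auto
  have "PT (\<lambda>x. foldl (\<lambda>a h. a \<or> P x h) False (l x))"
  proof (rule PT_foldl)
    have "PT (\<lambda>z. P (fst z) (snd (snd z)))"
      by (rule PT_comp2[of P, OF assms(1)]) (intro PT_rules)+
    then show "PT (\<lambda>z. fst (snd z) \<or> P (fst z) (snd (snd z)))" by (intro PT_rules)
    show "polyb (\<lambda>x :: 'a. 1)" by (rule polyb_const)
  qed (intro PT_rules assms sz_bool)+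
  then show ?thesis by (simp add: eq)
qed

lemma PT_ball [PT_rules]:
  assumes "PT (\<lambda>z. P (fst z) (snd z))" "PT l" shows "PT (\<lambda>x. \<forall>h\<in>set (l x). P x h)"
  using PT_not[OF PT_bex[where P="\<lambda>x h. \<not> P x h", OF PT_not[OF assms(1)] assms(2)]] by simp

subsection \<open>Equality\<close>

text \<open>A direct recursion on both trees in parallel: each visited pair of nodes costs a
  constant number of steps, so the time is linear in the first tree. Injectivity of
  \<open>repr\<close> carries the test over to all encoded types.\<close>

lemma PT_eq [PT_rules]: assumes "PT f" "PT g" shows "PT (\<lambda>x. f x = g x)"
proof -
  let ?B = "If_Expr (Hd_Expr Arg) (If_Expr (Tl_Expr Arg)
     (If_Expr (Call 0 (Cons_Expr (Hd_Expr (Hd_Expr Arg)) (Hd_Expr (Tl_Expr Arg))))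
        (Call 0 (Cons_Expr (Tl_Expr (Hd_Expr Arg)) (Tl_Expr (Tl_Expr Arg)))) Nil_Expr) Nil_Expr)
     (If_Expr (Tl_Expr Arg) Nil_Expr (Cons_Expr Nil_Expr Nil_Expr))"
  have hd: "eval_le [?B] (Node a b) (Hd_Expr Arg) a 2"
    and tl: "eval_le [?B] (Node a b) (Tl_Expr Arg) b 2" for a b
    using eval_le_Hd[OF eval_le_Arg, of "[?B]" "Node a b"] eval_le_Tl[OF eval_le_Arg, of "[?B]" "Node a b"]
    by (simp_all add: eval_nat_numeral)
  note n = eval_le_Nil[of "[?B]"]
  have main: "eval_le [?B] (Node a b) ?B (repr (a = b)) (60 * size a + 30)" for a b
  proof (induction a arbitrary: b)
    case Leaf
    have lf: "eval_le [?B] (Node Leaf b) (If_Expr (Tl_Expr Arg) Nil_Expr (Cons_Expr Nil_Expr Nil_Expr)) (repr (Leaf = b)) 6"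
    proof (cases b)
      case b: Leaf
      show ?thesis
        unfolding b by simp (rule eval_le_mono[OF eval_le_If_False[OF tl eval_le_Cons[OF n n]]], simp)
    next
      case (Node c d)
      then have "repr (Leaf = b) = Leaf" by simp
      then show ?thesis
        by (simp only:) (rule eval_le_mono[OF eval_le_If_True[OF tl _ n]]; simp add: Node)
    qed
    show ?case by (rule eval_le_mono[OF eval_le_If_False[OF hd lf]]) simp
  next
    case (Node l r)
    show ?case
    proof (cases b)
      case Leaf
      have "eval_le [?B] (Node (Node l r) b) ?B Leaf (2 + (2 + 1 + 1) + 1)"
        by (rule eval_le_If_True[OF hd _ eval_le_If_False[OF _ n]]) (use tl[of "Node l r" b] Leaf in auto)
      then show ?thesis unfolding Leaf by (simp add: eval_le_mono)
    next
      case b: (Node c d)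
      let ?x = "Node (Node l r) (Node c d)"
      note hh = eval_le_Hd[OF hd[of "Node l r" "Node c d"], simplified]
      note ht = eval_le_Hd[OF tl[of "Node l r" "Node c d"], simplified]
      note th = eval_le_Tl[OF hd[of "Node l r" "Node c d"], simplified]
      note tt = eval_le_Tl[OF tl[of "Node l r" "Node c d"], simplified]
      have c1: "eval_le [?B] ?x (Call 0 (Cons_Expr (Hd_Expr (Hd_Expr Arg)) (Hd_Expr (Tl_Expr Arg)))) (repr (l = c))
         (3 + 3 + 1 + (60 * size l + 30) + 1)"
        by (rule eval_le_Call[OF eval_le_Cons[OF hh ht]]) (use Node.IH(1)[of c] in auto)
      have c2: "eval_le [?B] ?x (Call 0 (Cons_Expr (Tl_Expr (Hd_Expr Arg)) (Tl_Expr (Tl_Expr Arg)))) (repr (r = d))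
         (3 + 3 + 1 + (60 * size r + 30) + 1)"
        by (rule eval_le_Call[OF eval_le_Cons[OF th tt]]) (use Node.IH(2)[of d] in auto)
      have c3: "eval_le [?B] ?x (If_Expr (Call 0 (Cons_Expr (Hd_Expr (Hd_Expr Arg)) (Hd_Expr (Tl_Expr Arg))))
        (Call 0 (Cons_Expr (Tl_Expr (Hd_Expr Arg)) (Tl_Expr (Tl_Expr Arg)))) Nil_Expr) (repr (l = c \<and> r = d))
        (77 + 60 * size l + 60 * size r)"
      proof (cases "l = c")
        case True
        then have eq: "(l = c \<and> r = d) = (r = d)" by simp
        show ?thesis
          unfolding eq by (rule eval_le_mono[OF eval_le_If_True[OF c1 _ c2]]; simp add: True)
      next
        case False
        then have "repr (l = c \<and> r = d) = Leaf" "repr (l = c) = Leaf" by simp_all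
        then show ?thesis
          by (simp only:) (rule eval_le_mono[OF eval_le_If_False[OF c1[unfolded \<open>repr (l = c) = Leaf\<close>] n]], simp)
      qed
      have "eval_le [?B] ?x ?B (repr (l = c \<and> r = d)) (2 + (2 + (77 + 60 * size l + 60 * size r) + 1) + 1)"
        by (rule eval_le_If_True[OF hd _ eval_le_If_True[OF tl _ c3]]) simp_all
      then show ?thesis unfolding b tree.inject by (rule eval_le_mono) simp
    qed
  qed
  have "PT (\<lambda>z :: tree \<times> tree. fst z = snd z)"
  proof (rule PT_I)
    show "eval_le [?B] (repr z) ?B (repr (fst z = snd z)) (60 * sz z + 30)" for z :: "tree \<times> tree"
      by (cases z) (auto intro: eval_le_mono[OF main])
    show "polyb (\<lambda>z :: tree \<times> tree. sz (fst z = snd z))"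
      by (rule polyb_mono[OF polyb_const sz_bool])
    show "polyb (\<lambda>z :: tree \<times> tree. 60 * sz z + 30)"
      by (intro polyb_add polyb_mult polyb_const polyb_sz)
  qed
  from PT_comp2[of "(=)", OF this PT_repr[OF assms(1)] PT_repr[OF assms(2)]]
  show ?thesis by (simp add: repr_inject)
qed

lemma PT_member [PT_rules]: assumes "PT f" "PT l" shows "PT (\<lambda>x. f x \<in> set (l x))"
proof -
  have "PT (\<lambda>x. \<exists>h\<in>set (l x). f x = h)"
    by (intro PT_rules PT_comp[OF PT_fst[OF PT_id] assms(1)] assms)
  then show ?thesis by simp
qed

subsection \<open>Unary arithmetic\<close>

text \<open>A unary number is a list of units, so sums are concatenations, and a loop of
  \<open>n\<close> rounds is a fold over \<open>replicate n ()\<close>.\<close>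

lemma repr_replicate: "repr (replicate n ()) = repr n"
  by (induction n) auto

lemma PT_replicate [PT_rules]: "PT f \<Longrightarrow> PT (\<lambda>x. replicate (f x) ())"
  by (rule PT_recode[of f]) (simp_all add: repr_replicate)

lemma PT_length [PT_rules]: assumes "PT l" shows "PT (\<lambda>x. length (l x))"
proof -
  have eq: "foldl (\<lambda>a h. Suc a) b xs = b + length xs" for b and xs :: "'b list"
    by (induction xs arbitrary: b) auto
  have "PT (\<lambda>x. foldl (\<lambda>a h. Suc a) 0 (l x))"
  proof (rule PT_foldl)
    show "sz (foldl (\<lambda>a h. Suc a) 0 ys) \<le> sz (l x)" if "l x = ys @ zs" for x ys zs
      using length_le_sz[of ys] that by (simp add: eq)
  qed (intro PT_rules assms PT_polyb)+
  then show ?thesis by (simp add: eq)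
qed

lemma split_replicate: "replicate n u = ys @ zs \<Longrightarrow> length ys \<le> n"
  by (metis length_append length_replicate le_add1)

lemma PT_add [PT_rules]: assumes "PT f" "PT g" shows "PT (\<lambda>x. f x + g x :: nat)"
proof -
  have "PT (\<lambda>x. length (replicate (f x) () @ replicate (g x) ()))" by (intro PT_rules assms)
  then show ?thesis by simp
qed

lemma PT_diff [PT_rules]: assumes "PT f" "PT g" shows "PT (\<lambda>x. f x - g x :: nat)"
proof -
  have eq: "foldl (\<lambda>a h. a - Suc 0) b xs = b - length xs" for b and xs :: "unit list"
    by (induction xs arbitrary: b) auto
  have "PT (\<lambda>x. foldl (\<lambda>a h. a - Suc 0) (f x) (replicate (g x) ()))"
    by (rule PT_foldl[OF _ _ _ PT_polyb[OF assms(1)]], (intro PT_rules assms)+) (simp add: eq)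
  then show ?thesis by (simp add: eq)
qed

lemma PT_mult [PT_rules]: assumes "PT f" "PT g" shows "PT (\<lambda>x. f x * g x :: nat)"
proof -
  have "PT (\<lambda>x. length (concat (map (\<lambda>_. replicate (f x) ()) (replicate (g x) ()))))"
    by (intro PT_rules PT_comp[OF PT_fst[OF PT_id] assms(1)] assms)
  then show ?thesis by (simp add: length_concat map_replicate_const sum_list_replicate mult.commute)
qed

lemma PT_le [PT_rules]: assumes "PT f" "PT g" shows "PT (\<lambda>x. f x \<le> (g x :: nat))"
proof -
  have "PT (\<lambda>x. f x - g x = 0)" by (intro PT_rules assms)
  then show ?thesis by simp
qed

lemma PT_min [PT_rules]: assumes "PT f" "PT g" shows "PT (\<lambda>x. min (f x) (g x) :: nat)"
  unfolding min_def by (intro PT_rules assms)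

lemma PT_upt [PT_rules]: assumes "PT f" shows "PT (\<lambda>x. [0..<f x])"
proof -
  have eq: "foldl (\<lambda>a h. a @ [length a]) [] xs = [0..<length xs]" for xs :: "unit list"
    by (induction xs rule: rev_induct) auto
  have "PT (\<lambda>x. foldl (\<lambda>a h. a @ [length a]) [] (replicate (f x) ()))"
  proof (rule PT_foldl)
    show "polyb (\<lambda>x. f x * (f x + 1))"
      using PT_polyb[OF assms] by (intro polyb_mult polyb_add polyb_const) simp_all
    show "sz (foldl (\<lambda>a h. a @ [length a]) [] ys) \<le> f x * (f x + 1)" if "replicate (f x) () = ys @ zs" for x ys zs
    proof -
      have "sz [0..<length ys] \<le> length [0..<length ys] * (f x + 1)"
        by (rule sz_list_le) (use split_replicate[OF that] in auto)
      also have "\<dots> \<le> f x * (f x + 1)" using split_replicate[OF that] by (intro mult_mono) auto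
      finally show ?thesis by (simp add: eq)
    qed
  qed (intro PT_rules assms)+
  then show ?thesis by (simp add: eq)
qed

lemma PT_drop [PT_rules]: assumes "PT f" "PT l" shows "PT (\<lambda>x. drop (f x) (l x))"
proof -
  have eq: "foldl (\<lambda>a h. tl a) b xs = drop (length xs) b" for b :: "'b list" and xs :: "unit list"
    by (induction xs arbitrary: b) (auto simp: drop_Suc)
  have sz_drop: "sz (drop n xs) \<le> sz xs" for n and xs :: "'b list"
    using sz_append[of "take n xs" "drop n xs"] by simp
  have "PT (\<lambda>x. foldl (\<lambda>a h. tl a) (l x) (replicate (f x) ()))"
    by (rule PT_foldl[OF _ _ _ PT_polyb[OF assms(2)]], (intro PT_rules assms)+) (simp add: eq sz_drop)
  then show ?thesis by (simp add: eq)
qed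

lemma PT_product [PT_rules]: assumes "PT f" "PT g" shows "PT (\<lambda>x. List.product (f x) (g x))"
  unfolding product_concat_map by (intro PT_rules PT_comp[OF PT_fst[OF PT_id] assms(2)] assms)

definition nth_or :: "'a \<Rightarrow> 'a list \<Rightarrow> nat \<Rightarrow> 'a" where
  "nth_or d xs i = (case drop i xs of [] \<Rightarrow> d | h # _ \<Rightarrow> h)"

lemma nth_or_eq: "nth_or d xs i = (if i < length xs then xs ! i else d)"
  unfolding nth_or_def by (cases "i < length xs") (auto simp: Cons_nth_drop_Suc[symmetric])

lemma PT_nth_or [PT_rules]: "PT d \<Longrightarrow> PT l \<Longrightarrow> PT i \<Longrightarrow> PT (\<lambda>x. nth_or (d x) (l x) (i x))"
  unfolding nth_or_def by (intro PT_rules)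

text \<open>Every tree encodes exactly one list of trees, hence any input, well-formed or not, can
  be read as a list at no cost.\<close>

fun spine :: "tree \<Rightarrow> tree list" where
  "spine Leaf = []"
| "spine (Node h t) = h # spine t"

lemma repr_spine [simp]: "repr (spine t) = t"
  by (induction t) auto

lemma spine_repr [simp]: "spine (repr (xs :: tree list)) = xs"
  by (induction xs) auto

lemma PT_spine [PT_rules]: "PT f \<Longrightarrow> PT (\<lambda>x. spine (f x))"
  by (rule PT_recode[of f]) simp_all

section \<open>Fixed-parameter tractability by enumerating certificates\<close>

fun height :: "tree \<Rightarrow> nat" where
  "height Leaf = 0"
| "height (Node l r) = Suc (max (height l) (height r))"

definition grow :: "tree list \<Rightarrow> tree list" where
  "grow T = Leaf # concat (map (\<lambda>a. map (Node a) T) T)"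

fun trees_below :: "nat \<Rightarrow> tree list" where
  "trees_below 0 = []"
| "trees_below (Suc h) = grow (trees_below h)"

abbreviation num_trees :: "nat \<Rightarrow> nat" where "num_trees h \<equiv> length (trees_below h)"

lemma set_trees_below: "set (trees_below h) = {t. height t < h}"
proof (induction h)
  case (Suc h)
  have "t \<in> set (trees_below (Suc h)) \<longleftrightarrow> height t < Suc h" for t
    by (cases t) (auto simp: grow_def Suc)
  then show ?case by blast
qed simp

lemma size_less_height: "size t < 2 ^ height t"
proof (induction t)
  case (Node l r)
  have "size l < 2 ^ max (height l) (height r)" "size r < 2 ^ max (height l) (height r)"
    by (rule less_le_trans[OF Node(1)], simp, rule less_le_trans[OF Node(2)], simp)
  then show ?case by simp
qed simp

lemma num_trees_Suc: "num_trees (Suc h) = Suc (num_trees h ^ 2)"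
proof -
  have "length (concat (map (\<lambda>a. map (Node a) T) S)) = length S * length T" for S T :: "tree list"
    by (induction S) auto
  then show ?thesis by (simp add: grow_def power2_eq_square)
qed

lemma num_trees_mono: "h \<le> h' \<Longrightarrow> num_trees h \<le> num_trees h'"
proof (induction rule: inc_induct)
  case (step n)
  have "num_trees n \<le> num_trees n ^ 2" unfolding power2_eq_square by (rule le_square)
  with step show ?case unfolding num_trees_Suc[of n] by linarith
qed simp

lemma le_num_trees: "h \<le> num_trees h"
proof (induction h)
  case (Suc h)
  have "num_trees h \<le> num_trees h ^ 2" unfolding power2_eq_square by (rule le_square)
  with Suc show ?case unfolding num_trees_Suc by linarith
qed simp

text \<open>A tree of height below \<open>h\<close> can be of size exponential in \<open>h\<close>;
  this estimate makes the encoded list of certificates polynomial in its own length. Passing to the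
  next height squares the number \<open>N\<close> of trees and adds one, which outgrows doubling
  because \<open>2 * N \<le> N ^ 2 + 1\<close>.\<close>

lemma two_power_le_num_trees: "2 ^ h \<le> (num_trees h + 1) ^ 2"
proof (induction h)
  case (Suc h)
  let ?n = "num_trees h"
  have "2 * (?n + 1) ^ 2 \<le> (?n ^ 2 + 2) ^ 2"
  proof -
    have "2 * ?n \<le> ?n ^ 2 + 1"
    proof (cases "?n \<le> 1")
      case False
      then have "2 * ?n \<le> ?n * ?n" by (intro mult_right_mono) auto
      then show ?thesis unfolding power2_eq_square by linarith
    qed (auto simp: le_Suc_eq)
    then have "2 * (?n + 1) ^ 2 \<le> 4 * ?n ^ 2 + 4" by (simp add: power2_eq_square algebra_simps)
    also have "\<dots> \<le> (?n ^ 2 + 2) ^ 2" by (simp add: power2_eq_square algebra_simps)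
    finally show ?thesis .
  qed
  with Suc show ?case unfolding num_trees_Suc by simp
qed simp

lemma sz_trees_below: "sz (trees_below h) \<le> num_trees h * ((num_trees h + 1) ^ 2 + 1)"
proof (rule sz_list_le)
  fix t assume "t \<in> set (trees_below h)"
  then have "height t < h" by (simp add: set_trees_below)
  have "size t < 2 ^ height t" by (rule size_less_height)
  also have "(2::nat) ^ height t \<le> 2 ^ h" using \<open>height t < h\<close> by (intro power_increasing) auto
  also have "\<dots> \<le> (num_trees h + 1) ^ 2" by (rule two_power_le_num_trees)
  finally show "sz t \<le> (num_trees h + 1) ^ 2" by simp
qed

definition bits :: "nat \<Rightarrow> nat" where "bits k = length (spine (enc_nat k))"

lemma bits_simps [simp]: "bits 0 = 0" "k > 0 \<Longrightarrow> bits k = Suc (bits (k div 2))"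
  unfolding bits_def by (subst enc_nat.simps, simp)+

lemma less_two_power_bits: "k < 2 ^ bits k"
proof (induction k rule: less_induct)
  case (less k)
  show ?case
  proof (cases "k = 0")
    case False
    then have "k div 2 < 2 ^ bits (k div 2)" by (intro less) simp
    then show ?thesis using False by simp
  qed simp
qed

lemma size_enc_nat: "size (enc_nat k) \<le> 2 * bits k"
proof (induction k rule: less_induct)
  case (less k)
  show ?case
  proof (cases "k = 0")
    case False
    then have "size (enc_nat (k div 2)) \<le> 2 * bits (k div 2)" by (intro less) simp
    then show ?thesis using False by (subst enc_nat.simps) (simp add: enc_bool_def)
  qed (simp add: enc_nat.simps)
qed

text \<open>The height has to be produced in unary from the binary digits of \<open>k\<close>: a
  list of \<open>a\<close> units is doubled once per digit.\<close>

abbreviation depth :: "nat \<Rightarrow> nat \<Rightarrow> nat" where "depth a k \<equiv> a * 2 ^ bits k"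

text \<open>One loop doubles a list of units, the other applies \<open>grow\<close> once per unit.
  \<open>PT_foldl\<close> does not apply, because the results are not polynomial in the size of
  \<open>enc_nat k\<close>; time is measured in the number of trees produced instead.\<close>

lemma certificates_program:
  assumes "a > 0"
  obtains p e and G :: "nat \<Rightarrow> nat" where "polyb G"
    "\<And>k. eval_le p (enc_nat k) e (repr (trees_below (depth a k))) (G (num_trees (depth a k)))"
proof -
  have "PT (\<lambda>z :: unit \<times> unit list \<times> tree. fst (snd z) @ fst (snd z))" by (intro PT_rules)
  then obtain p1 e1 c1 where
    fold1: "\<And>(x :: unit) l (b :: unit list) M. (\<And>ys zs. l = ys @ zs \<Longrightarrow> sz (foldl (\<lambda>b h :: tree. b @ b) b ys) \<le> M) \<Longrightarrow>
      eval_le p1 (repr (x, (l, b))) e1 (repr (foldl (\<lambda>b h. b @ b) b l))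
       ((length l + 1) * (sz x + sz l + M + 30) ^ c1)"
    by (rule foldl_program[of "\<lambda>(x::unit) b (h::tree). b @ b"]) (erule that)
  have "PT (\<lambda>z :: unit \<times> tree list \<times> unit. grow (fst (snd z)))"
    unfolding grow_def by (intro PT_rules)
  then obtain p2 e2 c2 where
    fold2: "\<And>(x :: unit) l b M. (\<And>ys zs. l = ys @ zs \<Longrightarrow> sz (foldl (\<lambda>b h :: unit. grow b) b ys) \<le> M) \<Longrightarrow>
      eval_le p2 (repr (x, (l, b))) e2 (repr (foldl (\<lambda>b h. grow b) b l))
       ((length l + 1) * (sz x + sz l + M + 30) ^ c2)"
    by (rule foldl_program[of "\<lambda>(x::unit) b (h::unit). grow b"]) (erule that)
  have "PT (\<lambda>t :: tree. ((), (spine t, replicate a ())))" by (intro PT_rules)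
  then obtain q1 d1 T1 where pre1: "polyb T1"
      "\<And>t :: tree. eval_le q1 (repr t) d1 (repr ((), (spine t, replicate a ()))) (T1 t)"
    unfolding PT_def by metis
  have "PT (\<lambda>l :: unit list. ((), (l, [] :: tree list)))" by (intro PT_rules)
  then obtain q2 d2 T2 where pre2: "polyb T2"
      "\<And>l :: unit list. eval_le q2 (repr l) d2 (repr ((), (l, [] :: tree list))) (T2 l)"
    unfolding PT_def by metis
  obtain g1 where g1: "\<And>t. T1 t \<le> (sz t + 2) ^ g1" using pre1(1) unfolding polyb_def by blast
  obtain g2 where g2: "\<And>t. T2 t \<le> (sz t + 2) ^ g2" using pre2(1) unfolding polyb_def by blast
  obtain P1 E1 where comp1: "\<And>x y z s t. eval_le q1 x d1 y s \<Longrightarrow> eval_le p1 y e1 z t \<Longrightarrow> eval_le P1 x E1 z (s + t + 1)"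
    by (rule eval_le_compose) (erule that)
  obtain P2 E2 where comp2: "\<And>x y z s t. eval_le q2 x d2 y s \<Longrightarrow> eval_le p2 y e2 z t \<Longrightarrow> eval_le P2 x E2 z (s + t + 1)"
    by (rule eval_le_compose) (erule that)
  obtain P E where comp: "\<And>x y z s t. eval_le P1 x E1 y s \<Longrightarrow> eval_le P2 y E2 z t \<Longrightarrow> eval_le P x E z (s + t + 1)"
    by (rule eval_le_compose) (erule that)
  have double: "foldl (\<lambda>b h. b @ b) (replicate m ()) l = replicate (m * 2 ^ length l) ()" for m and l :: "tree list"
    by (induction l arbitrary: m) (simp_all flip: replicate_add add: mult_2_right algebra_simps)
  have iter: "foldl (\<lambda>b h. grow b) [] l = trees_below (length l)" for l :: "unit list"
    by (induction l rule: rev_induct) auto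
  let ?G = "\<lambda>n::nat. ((2 * n + 2) ^ g1 + (n + 1) * (2 * n + n + 30) ^ c1 + 1)
     + ((n + 2) ^ g2 + (n + 1) * (n + n * ((n + 1) ^ 2 + 1) + 30) ^ c2 + 1) + 1"
  have ev: "eval_le P (enc_nat k) E (repr (trees_below (depth a k))) (?G (num_trees (depth a k)))" for k
  proof -
    let ?h = "depth a k" let ?n = "num_trees ?h"
    have b: "bits k \<le> ?n" "?h \<le> ?n"
    proof -
      have "bits k \<le> 1 * 2 ^ bits k" by (simp add: less_imp_le)
      also have "\<dots> \<le> ?h" using assms by (intro mult_mono) auto
      finally show "bits k \<le> ?n" using le_num_trees order_trans by blast
    qed (rule le_num_trees)
    have size: "size (enc_nat k) \<le> 2 * ?n" using size_enc_nat[of k] b by linarith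
    have sz_unit: "sz () = 0" by simp
    have szr: "sz (replicate m ()) = m" for m by (simp add: repr_replicate)
    have "eval_le p1 (repr ((), (spine (enc_nat k), replicate a ()))) e1
        (repr (foldl (\<lambda>b h. b @ b) (replicate a ()) (spine (enc_nat k))))
        ((length (spine (enc_nat k)) + 1) * (sz () + sz (spine (enc_nat k)) + ?h + 30) ^ c1)"
    proof (rule fold1)
      fix ys zs assume "spine (enc_nat k) = ys @ zs"
      then have "length ys \<le> bits k" unfolding bits_def by simp
      then show "sz (foldl (\<lambda>b h. b @ b) (replicate a ()) ys) \<le> ?h" unfolding double szr by simp
    qed
    then have "eval_le p1 (repr ((), (spine (enc_nat k), replicate a ()))) e1 (repr (replicate ?h ()))
        ((bits k + 1) * (size (enc_nat k) + ?h + 30) ^ c1)"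
      by (simp only: double bits_def[symmetric] sz_unit repr_spine add_0)
    from comp1[OF pre1(2)[of "enc_nat k"] this]
    have "eval_le P1 (enc_nat k) E1 (repr (replicate ?h ()))
       (T1 (enc_nat k) + (bits k + 1) * (size (enc_nat k) + ?h + 30) ^ c1 + 1)" by simp
    moreover have "T1 (enc_nat k) \<le> (2 * ?n + 2) ^ g1"
      by (rule le_trans[OF g1 power_mono]) (use size in simp_all)
    moreover have "(bits k + 1) * (size (enc_nat k) + ?h + 30) ^ c1 \<le> (?n + 1) * (2 * ?n + ?n + 30) ^ c1"
      using size b by (intro mult_mono power_mono add_mono) auto
    ultimately have 1: "eval_le P1 (enc_nat k) E1 (repr (replicate ?h ()))
       ((2 * ?n + 2) ^ g1 + (?n + 1) * (2 * ?n + ?n + 30) ^ c1 + 1)"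
      by (elim eval_le_mono) (intro add_mono le_refl)
    have "eval_le p2 (repr ((), (replicate ?h (), [] :: tree list))) e2 (repr (foldl (\<lambda>b h. grow b) [] (replicate ?h ())))
       ((length (replicate ?h ()) + 1) * (sz () + sz (replicate ?h ()) + ?n * ((?n + 1) ^ 2 + 1) + 30) ^ c2)"
    proof (rule fold2)
      fix ys zs assume "replicate ?h () = ys @ zs"
      then have "length ys \<le> ?h" by (rule split_replicate)
      then have n: "num_trees (length ys) \<le> ?n" by (rule num_trees_mono)
      have "sz (foldl (\<lambda>b h. grow b) [] ys) \<le> num_trees (length ys) * ((num_trees (length ys) + 1) ^ 2 + 1)"
        unfolding iter by (rule sz_trees_below)
      also have "\<dots> \<le> ?n * ((?n + 1) ^ 2 + 1)" using n by (intro mult_mono add_mono power_mono) auto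
      finally show "sz (foldl (\<lambda>b h. grow b) [] ys) \<le> ?n * ((?n + 1) ^ 2 + 1)" .
    qed
    then have "eval_le p2 (repr ((), (replicate ?h (), [] :: tree list))) e2 (repr (trees_below ?h))
       ((?h + 1) * (?h + ?n * ((?n + 1) ^ 2 + 1) + 30) ^ c2)"
      by (simp only: iter szr length_replicate sz_unit add_0)
    from comp2[OF pre2(2)[of "replicate ?h ()"] this]
    have "eval_le P2 (repr (replicate ?h ())) E2 (repr (trees_below ?h))
       (T2 (replicate ?h ()) + (?h + 1) * (?h + ?n * ((?n + 1) ^ 2 + 1) + 30) ^ c2 + 1)" .
    moreover have "T2 (replicate ?h ()) \<le> (?n + 2) ^ g2"
      by (rule le_trans[OF g2 power_mono]) (use b(2) szr[of ?h] in simp_all)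
    moreover have "(?h + 1) * (?h + ?n * ((?n + 1) ^ 2 + 1) + 30) ^ c2 \<le> (?n + 1) * (?n + ?n * ((?n + 1) ^ 2 + 1) + 30) ^ c2"
      using b by (intro mult_mono power_mono add_mono) auto
    ultimately have 2: "eval_le P2 (repr (replicate ?h ())) E2 (repr (trees_below ?h))
       ((?n + 2) ^ g2 + (?n + 1) * (?n + ?n * ((?n + 1) ^ 2 + 1) + 30) ^ c2 + 1)"
      by (elim eval_le_mono) (intro add_mono le_refl)
    show ?thesis by (rule comp[OF 1 2])
  qed
  have "polyb (\<lambda>n::nat. n)" using polyb_sz[where 'a=nat] by simp
  then have "polyb ?G" by (intro polyb_add polyb_mult polyb_power polyb_const)
  then show ?thesis using ev by (rule that)
qed

text \<open>With \<open>m = n div (e + 1)\<close> the threshold gives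
  \<open>(e + 2) ^ e \<le> m\<close>, so \<open>(n + 2) ^ e\<close> is at most
  \<open>(m + 1) ^ (e + 1)\<close>, and \<open>m + 1 \<le> 2 ^ m\<close>. The threshold is explicit
  because it enters the time bound.\<close>

lemma poly_le_exp:
  assumes "(e + 1) * (e + 2) ^ e \<le> n" shows "(n + 2) ^ e \<le> (2::nat) ^ n"
proof -
  let ?m = "n div (e + 1)"
  have "(e + 1) * (e + 2) ^ e div (e + 1) = (e + 2) ^ e" by (rule nonzero_mult_div_cancel_left) simp
  with div_le_mono[OF assms, of "e + 1"] have "(e + 2) ^ e \<le> ?m" by (simp only:)
  have "n < (?m + 1) * (e + 1)" using dividend_less_div_times[of "e + 1" n] by simp
  then have "n + 2 \<le> (?m + 1) * (e + 2)" by simp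
  then have "(n + 2) ^ e \<le> ((?m + 1) * (e + 2)) ^ e" by (rule power_mono) simp
  also have "\<dots> = (?m + 1) ^ e * (e + 2) ^ e" by (rule power_mult_distrib)
  also have "\<dots> \<le> (?m + 1) ^ e * (?m + 1)" using \<open>(e + 2) ^ e \<le> ?m\<close> by (intro mult_mono) auto
  also have "\<dots> = (?m + 1) ^ (e + 1)" by simp
  also have "\<dots> \<le> (2 ^ ?m) ^ (e + 1)" by (intro power_mono) (auto simp: Suc_le_eq)
  also have "\<dots> = 2 ^ (?m * (e + 1))" by (rule power_mult[symmetric])
  also have "\<dots> \<le> 2 ^ n" by (intro power_increasing div_times_less_eq_dividend) simp
  finally show ?thesis .
qed

lemma eval_le_runs: 
  obtains p where "\<And>x y T. eval_le P x E y T \<Longrightarrow> \<exists>t\<le>T + 2. runs p x y t"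
proof (rule that)
  fix x y T assume "eval_le P x E y T"
  then have "eval_le (shift 1 E # map (shift 1) P) x (shift 1 E) y T"
    by (rule eval_le_shift) (auto simp: nth_Cons split: nat.splits)
  then have "eval_le (shift 1 E # map (shift 1) P) x (Call 0 Arg) y (1 + T + 1)"
    by (intro eval_le_Call[OF eval_le_Arg]) simp_all
  then show "\<exists>t\<le>T + 2. runs (shift 1 E # map (shift 1) P) x y t"
    unfolding eval_le_def runs_def by simp
qed

text \<open>A power of two in binary is a row of zeros and a final one. A program thus obtains
  \<open>2 ^ num_trees h\<close> from the list of trees by blanking its entries and appending a
  digit.\<close>

lemma enc_nat_two_power: "enc_nat (2 ^ n) = repr (replicate n Leaf @ [Node Leaf Leaf])"
proof (induction n)
  case 0
  have "enc_nat 1 = Node (Node Leaf Leaf) (enc_nat 0)" by (subst enc_nat.simps) (simp add: enc_bool_def)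
  also have "enc_nat 0 = Leaf" by (subst enc_nat.simps) simp
  finally show ?case by simp
next
  case (Suc n)
  then show ?case by (subst enc_nat.simps) (simp add: enc_bool_def)
qed

lemma computable_two_power_num_trees:
  assumes "a > 0" shows "computable (\<lambda>k. 2 ^ num_trees (depth a k))"
proof -
  obtain p e and G :: "nat \<Rightarrow> nat" where "polyb G" and
    ev: "\<And>k. eval_le p (enc_nat k) e (repr (trees_below (depth a k))) (G (num_trees (depth a k)))"
    using certificates_program[OF assms] by metis
  have "PT (\<lambda>T :: tree list. map (\<lambda>_. Leaf) T @ [Node Leaf Leaf])" by (intro PT_rules)
  then obtain q d T where q: "\<And>U :: tree list. eval_le q (repr U) d (repr (map (\<lambda>_. Leaf) U @ [Node Leaf Leaf])) (T U)"
    unfolding PT_def by metis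
  obtain P E where comp: "\<And>x y z s t. eval_le p x e y s \<Longrightarrow> eval_le q y d z t \<Longrightarrow> eval_le P x E z (s + t + 1)"
    by (rule eval_le_compose) (erule that)
  obtain r where r: "\<And>x y T. eval_le P x E y T \<Longrightarrow> \<exists>t\<le>T + 2. runs r x y t" 
    by (rule eval_le_runs) (erule that)
  have "\<exists>t. runs r (enc_nat k) (enc_nat (2 ^ num_trees (depth a k))) t" for k
    using r[OF comp[OF ev q]] by (fastforce simp: enc_nat_two_power map_replicate_const)
  then show ?thesis unfolding computable_def by blast
qed

text \<open>Any certificate whose height is linear in the parameter may be searched for, since
  \<^term>\<open>depth a k\<close> exceeds \<open>a * k\<close>.\<close>

theorem fixed_parameter_tractableI:
  fixes D :: "tree \<times> tree list \<Rightarrow> bool"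
  assumes D: "PT D" and a: "a > 0"
    and L: "\<And>x k. (x, k) \<in> L \<longleftrightarrow> D (Node x (enc_nat k), trees_below (depth a k))"
  shows "fixed_parameter_tractable L"
proof -
  obtain p e and G :: "nat \<Rightarrow> nat" where G: "polyb G" and
    ev: "\<And>k. eval_le p (enc_nat k) e (repr (trees_below (depth a k))) (G (num_trees (depth a k)))"
    using certificates_program[OF a] by metis
  obtain q d T where T: "polyb T" and q: "\<And>z. eval_le q (repr z) d (repr (D z)) (T z)"
    using D unfolding PT_def by metis
  obtain c where c: "\<And>z. T z \<le> (sz z + 2) ^ c" using T unfolding polyb_def by blast
  obtain P1 E1 where comp1: "\<And>x y z s t. eval_le [] x (Tl_Expr Arg) y s \<Longrightarrow> eval_le p y e z t \<Longrightarrow> eval_le P1 x E1 z (s + t + 1)"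
    by (rule eval_le_compose) (erule that)
  obtain P E where comp: "\<And>x y z s t. eval_le P1 x (Cons_Expr Arg E1) y s \<Longrightarrow> eval_le q y d z t \<Longrightarrow> eval_le P x E z (s + t + 1)"
    by (rule eval_le_compose) (erule that)
  obtain r where r: "\<And>x y T. eval_le P x E y T \<Longrightarrow> \<exists>t\<le>T + 2. runs r x y t" 
    by (rule eval_le_runs) (erule that)
  \<comment> \<open>\<open>?H\<close> collects the part of the time that depends on the parameter,
    as a function of the number of trees; 10 covers the glue between the stages. The remaining
    factor is \<open>?s ^ c\<close>.\<close>
  let ?H = "\<lambda>n. G n + 10 + (n * ((n + 1) ^ 2 + 1) + 4) ^ c"
  have "polyb (\<lambda>n::nat. n)" using polyb_sz[where 'a=nat] by simp
  then have "polyb ?H" using G by (intro polyb_add polyb_mult polyb_power polyb_const)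
  then obtain b where b: "\<And>n. ?H n \<le> (n + 2) ^ b" unfolding polyb_def by auto
  \<comment> \<open>The program enumerates with \<open>a\<close>; the larger \<open>?a\<close>
    occurs in the bound only. Its depth is at least \<open>?a\<close> for every parameter, so the
    number of trees reaches the threshold of \<open>poly_le_exp\<close>.\<close>
  let ?a = "max a ((b + 1) * (b + 2) ^ b)"
  let ?f = "\<lambda>k. 2 ^ num_trees (depth ?a k)"
  have "\<exists>t. runs r (Node x (enc_nat k)) (enc_bool ((x, k) \<in> L)) t \<and> t \<le> ?f k * size (Node x (enc_nat k)) ^ c" for x k
  proof -
    let ?x = "Node x (enc_nat k)" let ?U = "trees_below (depth a k)" let ?n = "num_trees (depth a k)"
    let ?n' = "num_trees (depth ?a k)" let ?s = "size ?x"
    have "eval_le [] ?x (Tl_Expr Arg) (enc_nat k) (1 + 1)" using eval_le_Tl[OF eval_le_Arg, of "[]" ?x] by simp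
    from eval_le_Cons[OF eval_le_Arg comp1[OF this ev]]
    have "eval_le P1 ?x (Cons_Expr Arg E1) (repr (?x, ?U)) (1 + (1 + 1 + G ?n + 1) + 1)" by simp
    from comp[OF this q] obtain t where t: "runs r ?x (repr (D (?x, ?U))) t"
      "t \<le> 1 + (1 + 1 + G ?n + 1) + 1 + T (?x, ?U) + 1 + 2" using r by blast
    have s: "?s \<ge> 1" by simp
    have U: "sz ?U \<le> ?n * ((?n + 1) ^ 2 + 1)" by (rule sz_trees_below)
    have "T (?x, ?U) \<le> (?s * (?n * ((?n + 1) ^ 2 + 1) + 4)) ^ c"
    proof (rule le_trans[OF c power_mono])
      have "sz (?x, ?U) + 2 \<le> ?s * 1 + (?n * ((?n + 1) ^ 2 + 1) + 3)" using U by simp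
      also have "\<dots> \<le> ?s * 1 + ?s * (?n * ((?n + 1) ^ 2 + 1) + 3)" using s by (intro add_mono) auto
      finally show "sz (?x, ?U) + 2 \<le> ?s * (?n * ((?n + 1) ^ 2 + 1) + 4)" by (simp add: algebra_simps)
    qed simp
    then have "t \<le> (G ?n + 10) * 1 + (?n * ((?n + 1) ^ 2 + 1) + 4) ^ c * ?s ^ c"
      using t(2) unfolding power_mult_distrib by (simp add: mult.commute)
    also have "\<dots> \<le> (G ?n + 10) * ?s ^ c + (?n * ((?n + 1) ^ 2 + 1) + 4) ^ c * ?s ^ c"
      using s by (intro add_mono mult_mono) auto
    also have "\<dots> = ?H ?n * ?s ^ c" by (simp add: algebra_simps)
    also have "\<dots> \<le> ?f k * ?s ^ c"
    proof (rule mult_right_mono)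
      have "?n \<le> ?n'" by (rule num_trees_mono) (simp add: mult_right_mono)
      have "(b + 1) * (b + 2) ^ b \<le> ?a * 1" by simp
      also have "\<dots> \<le> depth ?a k" by (intro mult_le_mono2) simp
      also have "\<dots> \<le> ?n'" by (rule le_num_trees)
      finally have "(?n' + 2) ^ b \<le> 2 ^ ?n'" by (rule poly_le_exp)
      moreover have "(?n + 2) ^ b \<le> (?n' + 2) ^ b" using \<open>?n \<le> ?n'\<close> by (intro power_mono) auto
      ultimately show "?H ?n \<le> ?f k" using b[of ?n] by linarith
    qed simp
    finally show ?thesis using t(1) L[of x k] by (auto simp: repr_bool_def)
  qed
  moreover have "computable ?f" by (rule computable_two_power_num_trees) (use a in auto)
  ultimately show ?thesis unfolding fixed_parameter_tractable_def by blast
qed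

lemma PT_comp3: "PT (\<lambda>z. g (fst z) (fst (snd z)) (snd (snd z))) \<Longrightarrow> PT a \<Longrightarrow> PT b \<Longrightarrow> PT c \<Longrightarrow>
    PT (\<lambda>x. g (a x) (b x) (c x))"
  using PT_comp2[of "\<lambda>u v. g u (fst v) (snd v)" a "\<lambda>x. (b x, c x)"] by (simp add: PT_Pair)

lemma PT_comp4: "PT (\<lambda>z. g (fst z) (fst (snd z)) (fst (snd (snd z))) (snd (snd (snd z)))) \<Longrightarrow>
    PT a \<Longrightarrow> PT b \<Longrightarrow> PT c \<Longrightarrow> PT d \<Longrightarrow> PT (\<lambda>x. g (a x) (b x) (c x) (d x))"
  using PT_comp3[of "\<lambda>u v w. g u v (fst w) (snd w)" a b "\<lambda>x. (c x, d x)"] by (simp add: PT_Pair)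

lemma PT_comp5: "PT (\<lambda>z. g (fst z) (fst (snd z)) (fst (snd (snd z))) (fst (snd (snd (snd z)))) (snd (snd (snd (snd z))))) \<Longrightarrow>
    PT a \<Longrightarrow> PT b \<Longrightarrow> PT c \<Longrightarrow> PT d \<Longrightarrow> PT e \<Longrightarrow> PT (\<lambda>x. g (a x) (b x) (c x) (d x) (e x))"
  using PT_comp4[of "\<lambda>u v w y. g u v w (fst y) (snd y)" a b c "\<lambda>x. (d x, e x)"] by (simp add: PT_Pair)

lemma PT_comp6: "PT (\<lambda>z. g (fst z) (fst (snd z)) (fst (snd (snd z))) (fst (snd (snd (snd z))))
      (fst (snd (snd (snd (snd z))))) (snd (snd (snd (snd (snd z)))))) \<Longrightarrow>
    PT a \<Longrightarrow> PT b \<Longrightarrow> PT c \<Longrightarrow> PT d \<Longrightarrow> PT e \<Longrightarrow> PT f \<Longrightarrow> PT (\<lambda>x. g (a x) (b x) (c x) (d x) (e x) (f x))"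
  using PT_comp5[of "\<lambda>u v w y z. g u v w y (fst z) (snd z)" a b c d "\<lambda>x. (e x, f x)"] by (simp add: PT_Pair)

lemma PT_comp8: "PT (\<lambda>z. g (fst z) (fst (snd z)) (fst (snd (snd z))) (fst (snd (snd (snd z))))
      (fst (snd (snd (snd (snd z))))) (fst (snd (snd (snd (snd (snd z))))))
      (fst (snd (snd (snd (snd (snd (snd z))))))) (snd (snd (snd (snd (snd (snd (snd z)))))))) \<Longrightarrow>
    PT a \<Longrightarrow> PT b \<Longrightarrow> PT c \<Longrightarrow> PT d \<Longrightarrow> PT e \<Longrightarrow> PT f \<Longrightarrow> PT h \<Longrightarrow> PT i \<Longrightarrow>
    PT (\<lambda>x. g (a x) (b x) (c x) (d x) (e x) (f x) (h x) (i x))"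
  using PT_comp6[of "\<lambda>u v w y z r. g u v w y z (fst r) (fst (snd r)) (snd (snd r))" a b c d e "\<lambda>x. (f x, h x, i x)"]
  by (simp add: PT_Pair)

section \<open>The algorithms\<close>

subsection \<open>Decoding instances\<close>

abbreviation at :: "nat list \<Rightarrow> nat \<Rightarrow> nat" where "at \<equiv> nth_or 0"

definition vertex_pairs :: "nat \<Rightarrow> (nat \<times> nat) list" where
  "vertex_pairs n = List.product [0..<n] [0..<n]"

lemma PT_vertex_pairs [PT_rules]: "PT f \<Longrightarrow> PT (\<lambda>x. vertex_pairs (f x))"
  by (rule PT_comp[of f]) (simp_all add: vertex_pairs_def PT_rules)

text \<open>Each edge comes out as two ordered pairs. Missing entries count as absent edges;
  \<open>valid_graph\<close> rejects such trees.\<close>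

definition decode_edges :: "tree \<Rightarrow> (nat \<times> nat) list" where
  "decode_edges g = filter (\<lambda>p. nth_or Leaf (spine (nth_or Leaf (spine g) (fst p))) (snd p) \<noteq> Leaf)
     (vertex_pairs (length (spine g)))"

lemma PT_decode_edges [PT_rules]: "PT f \<Longrightarrow> PT (\<lambda>x. decode_edges (f x))"
  by (rule PT_comp[of f], assumption, unfold decode_edges_def, intro PT_rules)

definition adjacency :: "nat \<Rightarrow> (nat \<times> nat) list \<Rightarrow> bool list list" where
  "adjacency n R = map (\<lambda>i. map (\<lambda>j. (i, j) \<in> set R) [0..<n]) [0..<n]"

lemma PT_adjacency [PT_rules]: "PT f \<Longrightarrow> PT g \<Longrightarrow> PT (\<lambda>x. adjacency (f x) (g x))"
  by (rule PT_comp2[of adjacency], unfold adjacency_def, intro PT_rules)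

text \<open>Re-encoding what was decoded and comparing it with the input detects every tree that is
  not a square boolean matrix.\<close>

definition valid_graph :: "tree \<Rightarrow> bool" where
  "valid_graph g \<longleftrightarrow> repr (adjacency (length (spine g)) (decode_edges g)) = g \<and>
     (\<forall>p\<in>set (decode_edges g). fst p \<noteq> snd p \<and> (snd p, fst p) \<in> set (decode_edges g))"

lemma PT_valid_graph [PT_rules]: "PT f \<Longrightarrow> PT (\<lambda>x. valid_graph (f x))"
  by (rule PT_comp[of f], assumption, unfold valid_graph_def, intro PT_rules)

definition induced_paths :: "(nat \<times> nat) list \<Rightarrow> ((nat \<times> nat) \<times> (nat \<times> nat)) list" where
  "induced_paths R = filter (\<lambda>q. snd (fst q) = fst (snd q) \<and> fst (fst q) \<noteq> snd (snd q) \<and>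
      (fst (fst q), snd (snd q)) \<notin> set R) (List.product R R)"

lemma PT_induced_paths [PT_rules]: "PT f \<Longrightarrow> PT (\<lambda>x. induced_paths (f x))"
  by (rule PT_comp[of f], assumption, unfold induced_paths_def, intro PT_rules)

text \<open>The digits must be proper booleans and the most significant one must be set. The default
  \<open>Node Leaf Leaf\<close> lets the empty list pass, which encodes zero.\<close>

definition valid_num :: "tree \<Rightarrow> bool" where
  "valid_num m \<longleftrightarrow> repr (map (\<lambda>t. t \<noteq> Leaf) (spine m)) = m \<and>
     nth_or (Node Leaf Leaf) (spine m) (length (spine m) - Suc 0) \<noteq> Leaf"

lemma PT_valid_num [PT_rules]: "PT f \<Longrightarrow> PT (\<lambda>x. valid_num (f x))"
  by (rule PT_comp[of f], assumption, unfold valid_num_def, intro PT_rules)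

text \<open>Horner's scheme from the most significant digit, capped in every round, since the unary
  value of a binary number can be exponentially long.\<close>

definition capped_num :: "nat \<Rightarrow> tree \<Rightarrow> nat" where
  "capped_num c m = foldl (\<lambda>a t. min c (2 * a + (if t = Leaf then 0 else 1))) 0 (rev (spine m))"

lemma PT_capped_num [PT_rules]: "PT f \<Longrightarrow> PT g \<Longrightarrow> PT (\<lambda>x. capped_num (f x) (g x))"
proof (rule PT_comp2[of capped_num])
  show "PT (\<lambda>z. capped_num (fst z) (snd z))"
    unfolding capped_num_def
  proof (rule PT_foldl)
    show "polyb (\<lambda>z :: nat \<times> tree. sz (fst z))" by (intro PT_polyb PT_rules)
    fix x :: "nat \<times> tree" and ys :: "tree list"
    show "sz (foldl (\<lambda>a t. min (fst x) (2 * a + (if t = Leaf then 0 else 1))) 0 ys) \<le> sz (fst x)"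
      by (cases ys rule: rev_cases) auto
  qed (intro PT_rules)+
qed

text \<open>As \<open>left\<close> and \<open>right\<close> are total, the first equation is what
  forces the input to consist of nested pairs. \<open>alg\<close> receives the number from the
  instance before the parameter.\<close>

definition decide :: "(nat \<Rightarrow> (nat \<times> nat) list \<Rightarrow> (nat \<times> nat) list \<Rightarrow> nat \<Rightarrow> nat \<Rightarrow> tree list \<Rightarrow> bool) \<Rightarrow>
    tree \<times> tree list \<Rightarrow> bool" where
  "decide alg z \<longleftrightarrow> 
     left (fst z) = Node (left (left (fst z))) (Node (left (right (left (fst z)))) (right (right (left (fst z))))) \<and>
     valid_graph (left (left (fst z))) \<and>
     valid_graph (left (right (left (fst z)))) \<and>
     induced_paths (decode_edges (left (right (left (fst z))))) = [] \<and>
     length (spine (left (left (fst z)))) = length (spine (left (right (left (fst z))))) \<and>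
     valid_num (right (right (left (fst z)))) \<and>
     alg (length (spine (left (left (fst z))))) (decode_edges (left (left (fst z))))
       (decode_edges (left (right (left (fst z)))))
       (capped_num (length (spine (left (left (fst z)))) * length (spine (left (left (fst z)))))
         (right (right (left (fst z)))))
       (capped_num (length (spine (left (left (fst z)))) * length (spine (left (left (fst z))))) (right (fst z)))
       (snd z)"

lemma PT_decide:
  assumes "\<And>n A B m k U. PT n \<Longrightarrow> PT A \<Longrightarrow> PT B \<Longrightarrow> PT m \<Longrightarrow> PT k \<Longrightarrow> PT U \<Longrightarrow>
     PT (\<lambda>z :: tree \<times> tree list. alg (n z) (A z) (B z) (m z) (k z) (U z))"
  shows "PT (decide alg)"
proof -
  have "PT (\<lambda>z. decide alg z)" unfolding decide_def by (intro PT_rules assms)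
  then show ?thesis .
qed

subsection \<open>Knapsack\<close>

definition vadd :: "nat \<times> nat \<times> nat \<Rightarrow> nat \<times> nat \<times> nat \<Rightarrow> nat \<times> nat \<times> nat" where
  "vadd u v = (fst u + fst v, fst (snd u) + fst (snd v), snd (snd u) + snd (snd v))"

definition grid :: "nat \<Rightarrow> (nat \<times> nat \<times> nat) list" where
  "grid N = List.product [0..<Suc N] (List.product [0..<Suc N] [0..<Suc N])"

text \<open>The table after each step is a sublist of the grid and thus of polynomial size.\<close>

definition knapsack :: "nat \<Rightarrow> (nat \<times> nat \<times> nat) list list \<Rightarrow> (nat \<times> nat \<times> nat) list" where
  "knapsack N os = foldl (\<lambda>S opts. filter (\<lambda>p. \<exists>s\<in>set S. \<exists>v\<in>set opts. p = vadd s v) (grid N)) [(0, 0, 0)] os"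

lemma PT_grid [PT_rules]: "PT f \<Longrightarrow> PT (\<lambda>x. grid (f x))"
  by (rule PT_comp[of f], assumption, unfold grid_def, intro PT_rules)

lemma PT_knapsack [PT_rules]: "PT f \<Longrightarrow> PT g \<Longrightarrow> PT (\<lambda>x. knapsack (f x) (g x))"
proof (rule PT_comp2[of knapsack])
  show "PT (\<lambda>z. knapsack (fst z) (snd z))"
    unfolding knapsack_def vadd_def
  proof (rule PT_foldl)
    \<comment> \<open>3 is the size of the initial table \<open>[(0, 0, 0)]\<close>.\<close>
    show "polyb (\<lambda>z :: nat \<times> (nat \<times> nat \<times> nat) list list. sz (grid (fst z)) + 3)"
      by (intro polyb_add polyb_const PT_polyb PT_rules)
    fix x :: "nat \<times> (nat \<times> nat \<times> nat) list list" and ys :: "(nat \<times> nat \<times> nat) list list"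
    show "sz (foldl (\<lambda>S opts. filter (\<lambda>p. \<exists>s\<in>set S. \<exists>v\<in>set opts.
        p = (fst s + fst v, fst (snd s) + fst (snd v), snd (snd s) + snd (snd v))) (grid (fst x))) [(0, 0, 0)] ys)
        \<le> sz (grid (fst x)) + 3"
      by (cases ys rule: rev_cases) (auto intro: sz_filter le_trans)
  qed (intro PT_rules)+
qed

subsection \<open>Refining blocks by certificates\<close>

text \<open>The vertices are partitioned into blocks \<open>bs\<close>, these into groups \<open>gs\<close>. A certificate labels
  the groups of one block, and vertices of equal block and label form a cluster.\<close>

definition group_rank :: "nat \<Rightarrow> nat list \<Rightarrow> nat list \<Rightarrow> nat \<Rightarrow> nat" where
  "group_rank n bs gs v = length (filter (\<lambda>g. \<exists>u\<in>set [0..<n]. at bs u = at bs v \<and> at gs u = g) [0..<at gs v])"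

text \<open>Indexing by rank within the block lets the length of a certificate depend on the number
  of groups in the block instead of \<open>n\<close>. By the default, the certificate
  \<open>Leaf\<close> leaves the whole block together.\<close>

definition cert_label :: "nat \<Rightarrow> nat list \<Rightarrow> nat list \<Rightarrow> tree \<Rightarrow> nat \<Rightarrow> tree" where
  "cert_label n bs gs w v = nth_or Leaf (spine w) (group_rank n bs gs v)"

definition block_cost :: "nat \<Rightarrow> (nat \<times> nat) list \<Rightarrow> nat list \<Rightarrow> nat list \<Rightarrow> tree \<Rightarrow> nat \<Rightarrow> nat" where
  "block_cost n R bs gs w b = length (filter (\<lambda>p. fst p \<noteq> snd p \<and> at bs (fst p) = b \<and> at bs (snd p) = b \<and>
     (cert_label n bs gs w (fst p) = cert_label n bs gs w (snd p)) \<noteq> (p \<in> set R)) (vertex_pairs n))"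

text \<open>Pairs in different blocks are never joined, so their cost does not depend on the
  certificates.\<close>

definition cross_cost :: "nat \<Rightarrow> (nat \<times> nat) list \<Rightarrow> nat list \<Rightarrow> nat" where
  "cross_cost n R bs = length (filter (\<lambda>p. at bs (fst p) \<noteq> at bs (snd p) \<and> p \<in> set R) (vertex_pairs n))"

text \<open>Blocks are numbered up to \<open>n\<close> inclusive: in the completion problem the
  entangled block takes number 0 and the clusters are moved up by one.\<close>

definition refinable :: "nat \<Rightarrow> (nat \<times> nat) list \<Rightarrow> (nat \<times> nat) list \<Rightarrow> nat list \<Rightarrow> nat list \<Rightarrow> tree list \<Rightarrow> nat \<Rightarrow> nat \<Rightarrow> bool" where
  "refinable n A B bs gs U ka kb \<longleftrightarrow>
     (\<exists>v\<in>set (knapsack (n * n) (map (\<lambda>b. map (\<lambda>w. (block_cost n A bs gs w b, block_cost n B bs gs w b, 0)) U) [0..<Suc n])).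
        cross_cost n A bs + fst v \<le> ka \<and> cross_cost n B bs + fst (snd v) \<le> kb)"

lemma PT_group_rank [PT_rules]: "PT a \<Longrightarrow> PT b \<Longrightarrow> PT c \<Longrightarrow> PT d \<Longrightarrow> PT (\<lambda>x. group_rank (a x) (b x) (c x) (d x))"
  by (rule PT_comp4[of group_rank], unfold group_rank_def, intro PT_rules)

lemma PT_cert_label [PT_rules]: "PT a \<Longrightarrow> PT b \<Longrightarrow> PT c \<Longrightarrow> PT d \<Longrightarrow> PT e \<Longrightarrow> PT (\<lambda>x. cert_label (a x) (b x) (c x) (d x) (e x))"
  by (rule PT_comp5[of cert_label], unfold cert_label_def, intro PT_rules)

lemma PT_block_cost [PT_rules]: "PT a \<Longrightarrow> PT b \<Longrightarrow> PT c \<Longrightarrow> PT d \<Longrightarrow> PT e \<Longrightarrow> PT f \<Longrightarrow>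
    PT (\<lambda>x. block_cost (a x) (b x) (c x) (d x) (e x) (f x))"
  by (rule PT_comp6[of block_cost], unfold block_cost_def, intro PT_rules)

lemma PT_cross_cost [PT_rules]: "PT a \<Longrightarrow> PT b \<Longrightarrow> PT c \<Longrightarrow> PT (\<lambda>x. cross_cost (a x) (b x) (c x))"
  by (rule PT_comp3[of cross_cost], unfold cross_cost_def, intro PT_rules)

lemma PT_refinable [PT_rules]: "PT a \<Longrightarrow> PT b \<Longrightarrow> PT c \<Longrightarrow> PT d \<Longrightarrow> PT e \<Longrightarrow> PT f \<Longrightarrow> PT h \<Longrightarrow> PT i \<Longrightarrow>
    PT (\<lambda>x. refinable (a x) (b x) (c x) (d x) (e x) (f x) (h x) (i x))"
  by (rule PT_comp8[of refinable], unfold refinable_def, intro PT_rules)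

subsection \<open>Deletion\<close>

definition remove_edge :: "nat \<times> nat \<Rightarrow> (nat \<times> nat) list \<Rightarrow> (nat \<times> nat) list" where
  "remove_edge p G = filter (\<lambda>q. q \<noteq> p \<and> q \<noteq> (snd p, fst p)) G"

text \<open>A surplus bit changes nothing once no induced path is left, so certificates of any
  length are admissible. The default paths are dummies for the excluded empty list.\<close>

definition branch_step :: "(nat \<times> nat) list \<Rightarrow> tree \<Rightarrow> (nat \<times> nat) list" where
  "branch_step G t = (if induced_paths G = [] then G
     else remove_edge (if t = Leaf then fst (case induced_paths G of [] \<Rightarrow> ((0, 0), (0, 0)) | q # _ \<Rightarrow> q)
       else snd (case induced_paths G of [] \<Rightarrow> ((0, 0), (0, 0)) | q # _ \<Rightarrow> q)) G)"

definition branch :: "(nat \<times> nat) list \<Rightarrow> tree \<Rightarrow> (nat \<times> nat) list" where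
  "branch G w = foldl branch_step G (spine w)"

definition cluster_rep :: "nat \<Rightarrow> (nat \<times> nat) list \<Rightarrow> nat \<Rightarrow> nat" where
  "cluster_rep n G v = (case filter (\<lambda>u. u = v \<or> (u, v) \<in> set G) [0..<n] of [] \<Rightarrow> 0 | u # _ \<Rightarrow> u)"

definition cluster_reps :: "nat \<Rightarrow> (nat \<times> nat) list \<Rightarrow> nat list" where
  "cluster_reps n G = map (cluster_rep n G) [0..<n]"

text \<open>Groups are single vertices here. One list of certificates serves both the branching and
  the splitting of cliques.\<close>

definition deletion_alg :: "nat \<Rightarrow> (nat \<times> nat) list \<Rightarrow> (nat \<times> nat) list \<Rightarrow> nat \<Rightarrow> nat \<Rightarrow> tree list \<Rightarrow> bool" where
  "deletion_alg n A B d k U \<longleftrightarrow> (\<exists>w\<in>set U. induced_paths (branch A w) = [] \<and>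
      refinable n A B (cluster_reps n (branch A w)) [0..<n] U (2 * k) (2 * d))"

lemma PT_remove_edge [PT_rules]: "PT a \<Longrightarrow> PT b \<Longrightarrow> PT (\<lambda>x. remove_edge (a x) (b x))"
  by (rule PT_comp2[of remove_edge], unfold remove_edge_def, intro PT_rules)

lemma branch_step_subset: "set (branch_step G t) \<subseteq> set G"
  unfolding branch_step_def remove_edge_def by auto

lemma sz_branch_step: "sz (branch_step G t) \<le> sz G"
  unfolding branch_step_def remove_edge_def by (auto intro: sz_filter)

lemma PT_branch [PT_rules]: "PT a \<Longrightarrow> PT b \<Longrightarrow> PT (\<lambda>x. branch (a x) (b x))"
proof (rule PT_comp2[of branch])
  have le: "sz (foldl branch_step G ys) \<le> sz G" for G ys
  proof (induction ys rule: rev_induct)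
    case (snoc y ys)
    then show ?case using sz_branch_step[of "foldl branch_step G ys" y] by simp
  qed simp
  show "PT (\<lambda>z. branch (fst z) (snd z))"
    unfolding branch_def
  proof (rule PT_foldl)
    show "polyb (\<lambda>z :: (nat \<times> nat) list \<times> tree. sz (fst z))" by (intro PT_polyb PT_rules)
  qed (use le in \<open>(unfold branch_step_def)?, (intro PT_rules | simp)\<close>)+
qed

lemma PT_cluster_rep [PT_rules]: "PT a \<Longrightarrow> PT b \<Longrightarrow> PT c \<Longrightarrow> PT (\<lambda>x. cluster_rep (a x) (b x) (c x))"
  by (rule PT_comp3[of cluster_rep], unfold cluster_rep_def, intro PT_rules)

lemma PT_cluster_reps [PT_rules]: "PT a \<Longrightarrow> PT b \<Longrightarrow> PT (\<lambda>x. cluster_reps (a x) (b x))"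
  by (rule PT_comp2[of cluster_reps], unfold cluster_reps_def, intro PT_rules)

lemma PT_deletion_alg: "PT n \<Longrightarrow> PT A \<Longrightarrow> PT B \<Longrightarrow> PT d \<Longrightarrow> PT k \<Longrightarrow> PT U \<Longrightarrow>
    PT (\<lambda>x. deletion_alg (n x) (A x) (B x) (d x) (k x) (U x))"
  by (rule PT_comp6[of deletion_alg], unfold deletion_alg_def, intro PT_rules)

subsection \<open>Completion\<close>

definition merge :: "nat list \<Rightarrow> nat \<times> nat \<Rightarrow> nat list" where
  "merge L p = map (\<lambda>l. if l = at L (snd p) then at L (fst p) else l) L"

definition component_labels :: "nat \<Rightarrow> (nat \<times> nat) list \<Rightarrow> nat list" where
  "component_labels n A = foldl merge [0..<n] A"

text \<open>A component (a class of \<open>L\<close>) is impure if it meets several clusters of \<open>G\<^sub>c\<close> (classes of \<open>C\<close>), and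
  entangled if it meets a cluster met by an impure component. A completion at edge distance at
  most \<open>d\<close> leaves at most \<open>2 * d\<close> entangled components, which form block \<open>0\<close>; each other block is
  one cluster of \<open>G\<^sub>c\<close>, a disjoint union of components.\<close>

definition impure :: "nat \<Rightarrow> nat list \<Rightarrow> nat list \<Rightarrow> nat \<Rightarrow> bool" where
  "impure n L C v \<longleftrightarrow> (\<exists>u\<in>set [0..<n]. at L u = at L v \<and> at C u \<noteq> at C v)"

definition entangled :: "nat \<Rightarrow> nat list \<Rightarrow> nat list \<Rightarrow> nat \<Rightarrow> bool" where
  "entangled n L C v \<longleftrightarrow> (\<exists>v'\<in>set [0..<n]. at L v' = at L v \<and> (\<exists>u\<in>set [0..<n]. at C u = at C v' \<and> impure n L C u))"

definition entangled_blocks :: "nat \<Rightarrow> nat list \<Rightarrow> nat list \<Rightarrow> nat list" where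
  "entangled_blocks n L C = map (\<lambda>v. if entangled n L C v then 0 else Suc (at C v)) [0..<n]"

definition completion_edge_alg :: "nat \<Rightarrow> (nat \<times> nat) list \<Rightarrow> (nat \<times> nat) list \<Rightarrow> nat \<Rightarrow> nat \<Rightarrow> tree list \<Rightarrow> bool" where
  "completion_edge_alg n A B k d U \<longleftrightarrow> 
     refinable n A B (entangled_blocks n (component_labels n A) (cluster_reps n B)) (component_labels n A) U (2 * k) (2 * d)"

text \<open>Keeps the accumulator of the fold polynomial: labels are only copied. An endpoint out of
  range reads the default 0, which is still below \<open>n\<close> as soon as there is a label at
  all.\<close>

lemma component_labels_bound:
  "length (foldl merge [0..<n] A) = n" "l \<in> set (foldl merge [0..<n] A) \<Longrightarrow> l < n"
proof -
  have "length (foldl merge [0..<n] A) = n \<and> (\<forall>l\<in>set (foldl merge [0..<n] A). l < n)"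
  proof (induction A rule: rev_induct)
    case (snoc p A)
    define M where "M = foldl merge [0..<n] A"
    have M: "length M = n" "\<And>l. l \<in> set M \<Longrightarrow> l < n" using snoc unfolding M_def by auto
    have "l < n" if "l \<in> set (merge M p)" for l
    proof -
      have "n > 0" using that M(1) by (cases n) (auto simp: merge_def)
      then have "at M i < n" for i using M by (auto simp: nth_or_eq)
      then show ?thesis using that M(2) by (auto simp: merge_def split: if_splits)
    qed
    then show ?case using M(1) by (simp add: M_def[symmetric]) (simp add: merge_def)
  qed auto
  then show "length (foldl merge [0..<n] A) = n" "l \<in> set (foldl merge [0..<n] A) \<Longrightarrow> l < n" by blast+
qed

lemma PT_component_labels [PT_rules]: "PT a \<Longrightarrow> PT b \<Longrightarrow> PT (\<lambda>x. component_labels (a x) (b x))"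
proof (rule PT_comp2[of component_labels])
  show "PT (\<lambda>z. component_labels (fst z) (snd z))"
    unfolding component_labels_def
  proof (rule PT_foldl)
    have "polyb (\<lambda>z :: nat \<times> (nat \<times> nat) list. sz (fst z))" by (intro PT_polyb PT_rules)
    then show "polyb (\<lambda>z :: nat \<times> (nat \<times> nat) list. fst z * (fst z + 1))"
      by (intro polyb_mult polyb_add polyb_const) simp_all
    show "sz (foldl merge [0..<fst x] ys) \<le> fst x * (fst x + 1)" for x :: "nat \<times> (nat \<times> nat) list" and ys
      using sz_list_le[of "foldl merge [0..<fst x] ys" "fst x"] component_labels_bound(2)[of _ "fst x" ys]
      by (simp add: component_labels_bound(1) less_imp_le)
  qed (unfold merge_def, (intro PT_rules)+)
qed

lemma PT_impure [PT_rules]: "PT a \<Longrightarrow> PT b \<Longrightarrow> PT c \<Longrightarrow> PT d \<Longrightarrow> PT (\<lambda>x. impure (a x) (b x) (c x) (d x))"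
  by (rule PT_comp4[of impure], unfold impure_def, intro PT_rules)

lemma PT_entangled [PT_rules]: "PT a \<Longrightarrow> PT b \<Longrightarrow> PT c \<Longrightarrow> PT d \<Longrightarrow> PT (\<lambda>x. entangled (a x) (b x) (c x) (d x))"
  by (rule PT_comp4[of entangled], unfold entangled_def, intro PT_rules)

lemma PT_entangled_blocks [PT_rules]: "PT a \<Longrightarrow> PT b \<Longrightarrow> PT c \<Longrightarrow> PT (\<lambda>x. entangled_blocks (a x) (b x) (c x))"
  by (rule PT_comp3[of entangled_blocks], unfold entangled_blocks_def, intro PT_rules)

lemma PT_completion_edge_alg: "PT n \<Longrightarrow> PT A \<Longrightarrow> PT B \<Longrightarrow> PT k \<Longrightarrow> PT d \<Longrightarrow> PT U \<Longrightarrow>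
    PT (\<lambda>x. completion_edge_alg (n x) (A x) (B x) (k x) (d x) (U x))"
  by (rule PT_comp6[of completion_edge_alg], unfold completion_edge_alg_def, intro PT_rules)

section \<open>Completion with the matching distance\<close>

definition members :: "nat \<Rightarrow> nat list \<Rightarrow> nat \<Rightarrow> nat list" where
  "members n L g = filter (\<lambda>v. at L v = g) [0..<n]"

text \<open>Certificate entries are meant for impure components only. A pure component may read the
  entry of another one, which is harmless, since all its vertices lie in one cluster of
  \<open>G\<^sub>c\<close>.\<close>

definition impure_rank :: "nat \<Rightarrow> nat list \<Rightarrow> nat list \<Rightarrow> nat \<Rightarrow> nat" where
  "impure_rank n L C g = length (filter (\<lambda>g'. \<exists>v\<in>set (members n L g'). impure n L C v) [0..<g])"

text \<open>The cluster of \<open>G\<^sub>c\<close> in which component \<open>g\<close> takes part is given by one of its vertices;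
  for the impure components the certificate \<open>w\<close> lists the positions of these vertices.\<close>

definition representative :: "nat \<Rightarrow> nat list \<Rightarrow> nat list \<Rightarrow> tree \<Rightarrow> nat \<Rightarrow> nat" where
  "representative n L C w g = nth_or (nth_or 0 (members n L g) 0) (members n L g)
     (length (spine (nth_or Leaf (spine w) (impure_rank n L C g))))"

text \<open>A component either joins the cluster of its representative or stays on its own. The entries
  are the size of the joint cluster, the number of vertices outside the matching, and the number
  of ordered pairs in the clusters left on their own.\<close>

definition component_choices :: "nat \<Rightarrow> nat list \<Rightarrow> nat list \<Rightarrow> tree \<Rightarrow> nat \<Rightarrow> (nat \<times> nat \<times> nat) list" where
  "component_choices n L C w g =
     [(length (members n L g),
       length (filter (\<lambda>v. at C v \<noteq> at C (representative n L C w g)) (members n L g)), 0),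
      (0, length (members n L g), length (members n L g) * length (members n L g))]"

text \<open>The number of pairs is quadratic in the size of the joint cluster, so it cannot be
  summed over components: the inner knapsack tracks the size, which is squared once per cluster
  before the outer knapsack.\<close>

definition cluster_choices :: "nat \<Rightarrow> nat list \<Rightarrow> nat list \<Rightarrow> tree \<Rightarrow> nat \<Rightarrow> (nat \<times> nat \<times> nat) list" where
  "cluster_choices n L C w c = map (\<lambda>v. (fst (snd v), fst v * fst v + snd (snd v), 0))
     (knapsack (n * n) (map (component_choices n L C w)
        (filter (\<lambda>g. at C (representative n L C w g) = c) [0..<n])))"

text \<open>The second entry counts all ordered pairs inside clusters, diagonal included:
  \<open>n\<close> on the diagonal, \<open>length A\<close> from \<open>G\<close>, and two for each
  of the \<open>k\<close> admissible additions.\<close>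

definition completion_matching_alg :: "nat \<Rightarrow> (nat \<times> nat) list \<Rightarrow> (nat \<times> nat) list \<Rightarrow> nat \<Rightarrow> nat \<Rightarrow> tree list \<Rightarrow> bool" where
  "completion_matching_alg n A B k d U \<longleftrightarrow> (\<exists>w\<in>set U.
     \<exists>v\<in>set (knapsack (n * n) (map (cluster_choices n (component_labels n A) (cluster_reps n B) w) [0..<n])).
       fst v \<le> d \<and> fst (snd v) \<le> 2 * k + length A + n)"

lemma PT_members [PT_rules]: "PT a \<Longrightarrow> PT b \<Longrightarrow> PT c \<Longrightarrow> PT (\<lambda>x. members (a x) (b x) (c x))"
  by (rule PT_comp3[of members], unfold members_def, intro PT_rules)

lemma PT_impure_rank [PT_rules]: "PT a \<Longrightarrow> PT b \<Longrightarrow> PT c \<Longrightarrow> PT d \<Longrightarrow> PT (\<lambda>x. impure_rank (a x) (b x) (c x) (d x))"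
  by (rule PT_comp4[of impure_rank], unfold impure_rank_def, intro PT_rules)

lemma PT_representative [PT_rules]: "PT a \<Longrightarrow> PT b \<Longrightarrow> PT c \<Longrightarrow> PT d \<Longrightarrow> PT e \<Longrightarrow>
    PT (\<lambda>x. representative (a x) (b x) (c x) (d x) (e x))"
  by (rule PT_comp5[of representative], unfold representative_def, intro PT_rules)

lemma PT_component_choices [PT_rules]: "PT a \<Longrightarrow> PT b \<Longrightarrow> PT c \<Longrightarrow> PT d \<Longrightarrow> PT e \<Longrightarrow>
    PT (\<lambda>x. component_choices (a x) (b x) (c x) (d x) (e x))"
  by (rule PT_comp5[of component_choices], unfold component_choices_def, intro PT_rules)

lemma PT_cluster_choices [PT_rules]: "PT a \<Longrightarrow> PT b \<Longrightarrow> PT c \<Longrightarrow> PT d \<Longrightarrow> PT e \<Longrightarrow>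
    PT (\<lambda>x. cluster_choices (a x) (b x) (c x) (d x) (e x))"
  by (rule PT_comp5[of cluster_choices], unfold cluster_choices_def, intro PT_rules)

lemma PT_completion_matching_alg: "PT n \<Longrightarrow> PT A \<Longrightarrow> PT B \<Longrightarrow> PT k \<Longrightarrow> PT d \<Longrightarrow> PT U \<Longrightarrow>
    PT (\<lambda>x. completion_matching_alg (n x) (A x) (B x) (k x) (d x) (U x))"
  by (rule PT_comp6[of completion_matching_alg], unfold completion_matching_alg_def, intro PT_rules)

section \<open>Cluster graphs as vertex labellings\<close>

definition arcs :: "'a set set \<Rightarrow> ('a \<times> 'a) set" where
  "arcs E = {(u, v). {u, v} \<in> E}"

text \<open>Labels may have any type: numbers, closed neighbourhoods and pairs of a block and a
  certificate label all occur below.\<close>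

definition same_label :: "nat \<Rightarrow> (nat \<Rightarrow> 'b) \<Rightarrow> (nat \<times> nat) set" where
  "same_label n l = {(u, v). u < n \<and> v < n \<and> u \<noteq> v \<and> l u = l v}"

definition label_graph :: "nat \<Rightarrow> (nat \<Rightarrow> 'b) \<Rightarrow> nat set set" where
  "label_graph n l = (\<lambda>p. {fst p, snd p}) ` same_label n l"

lemma arcs_sym: "(u, v) \<in> arcs E \<longleftrightarrow> (v, u) \<in> arcs E"
  by (simp add: arcs_def insert_commute)

lemma arcs_simple:
  fixes n :: nat
  assumes "simple_graph {..<n} E" "(u, v) \<in> arcs E" shows "u < n" "v < n" "u \<noteq> v"
  using assms by (auto simp: arcs_def simple_graph_def)

lemma finite_arcs: "simple_graph {..<n::nat} E \<Longrightarrow> finite (arcs E)"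
  by (rule finite_subset[of _ "{..<n} \<times> {..<n}"]) (auto dest: arcs_simple)

lemma simple_graph_edge:
  assumes "simple_graph V E" "e \<in> E" obtains u v where "e = {u, v}" "u \<noteq> v"
  using assms unfolding simple_graph_def card_2_iff by meson

lemma arcs_mono_iff: "simple_graph V E \<Longrightarrow> E \<subseteq> F \<longleftrightarrow> arcs E \<subseteq> arcs F"
  by (auto simp: arcs_def elim: simple_graph_edge)

lemma simple_graph_eqI:
  assumes "simple_graph V E" "simple_graph V F" "arcs E = arcs F" shows "E = F"
  using arcs_mono_iff[OF assms(1), of F] arcs_mono_iff[OF assms(2), of E] assms(3) by blast

lemma arcs_sym_diff: "arcs (sym_diff E F) = sym_diff (arcs E) (arcs F)"
  by (auto simp: arcs_def)

lemma simple_graph_sym_diff: "simple_graph V E \<Longrightarrow> simple_graph V F \<Longrightarrow> simple_graph V (sym_diff E F)"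
  unfolding simple_graph_def by blast

lemma card_arcs:
  assumes "simple_graph V E" shows "card (arcs E) = 2 * card E"
proof -
  have "E \<subseteq> Pow V" "finite V" using assms unfolding simple_graph_def by auto
  then have fin: "finite E" by (meson finite_Pow_iff finite_subset)
  have two: "card {(u, v). {u, v} = e} = 2" if e: "e \<in> E" for e
  proof -
    obtain u v where "e = {u, v}" "u \<noteq> v" using simple_graph_edge[OF assms e] .
    then have "{(a, b). {a, b} = e} = {(u, v), (v, u)}" by (auto simp: doubleton_eq_iff)
    then show ?thesis using \<open>u \<noteq> v\<close> by simp
  qed
  have "arcs E = (\<Union>e\<in>E. {(u, v). {u, v} = e})" by (auto simp: arcs_def)
  also have "card \<dots> = (\<Sum>e\<in>E. card {(u, v). {u, v} = e})"
  proof (rule card_UN_disjoint[OF fin])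
    show "\<forall>e\<in>E. finite {(u, v). {u, v} = e}" using two by (metis card.infinite zero_neq_numeral)
  qed auto
  also have "\<dots> = (\<Sum>e\<in>E. 2)" using two by (intro sum.cong) auto
  finally show ?thesis by simp
qed

lemma card_sym_diff_arcs:
  assumes "simple_graph V E" "simple_graph V F"
  shows "card (sym_diff E F) \<le> k \<longleftrightarrow> card (sym_diff (arcs E) (arcs F)) \<le> 2 * k"
  using card_arcs[OF simple_graph_sym_diff[OF assms]] unfolding arcs_sym_diff by simp

lemma arcs_label_graph: "arcs (label_graph n l) = same_label n l"
  by (auto simp: arcs_def label_graph_def same_label_def doubleton_eq_iff image_iff)

definition label_classes :: "nat \<Rightarrow> (nat \<Rightarrow> 'b) \<Rightarrow> nat set set" where
  "label_classes n l = (\<lambda>v. {u. u < n \<and> l u = l v}) ` {..<n}"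

lemma partition_label_classes: "partition_on {..<n} (label_classes n l)"
  unfolding partition_on_def disjoint_def label_classes_def by auto

lemma clique_edges_label_classes: "clique_edges (label_classes n l) = label_graph n l"
proof -
  have "arcs (clique_edges (label_classes n l)) = same_label n l"
    unfolding arcs_def clique_edges_def label_classes_def same_label_def
    by (auto simp: doubleton_eq_iff)
  moreover have "simple_graph {..<n} (clique_edges (label_classes n l))"
  proof (rule cluster_graph_imp_simple_graph)
    show "cluster_graph {..<n} (clique_edges (label_classes n l))"
      using partition_label_classes[of n l] unfolding cluster_graph_def by blast
  qed
  moreover have "simple_graph {..<n} (label_graph n l)"
    by (auto simp: simple_graph_def label_graph_def same_label_def)
  ultimately show ?thesis
    by (intro simple_graph_eqI[of "{..<n}"]) (simp_all only: arcs_label_graph)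
qed

lemma cluster_graph_label_graph: "cluster_graph {..<n} (label_graph n l)"
proof -
  have "partition_on {..<n} (label_classes n l) \<and> label_graph n l = clique_edges (label_classes n l)"
    by (simp add: partition_label_classes clique_edges_label_classes)
  then show ?thesis unfolding cluster_graph_def by blast
qed

lemma simple_label_graph: "simple_graph {..<n} (label_graph n l)"
  by (rule cluster_graph_imp_simple_graph[OF cluster_graph_label_graph])

lemma clusters_label_graph: "clusters {..<n} (label_graph n l) = label_classes n l"
  unfolding clique_edges_label_classes[symmetric] by (rule clusters_clique_edges[OF partition_label_classes])

lemma cluster_graph_obtain_label:
  assumes "cluster_graph {..<n} E" obtains l :: "nat \<Rightarrow> nat" where "E = label_graph n l"
proof -
  obtain P where P: "partition_on {..<n} P" "E = clique_edges P"
    using assms unfolding cluster_graph_def by blast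
  \<comment> \<open>Each vertex is labelled by the least vertex of its clique.\<close>
  define l where "l v = (LEAST u. \<exists>C\<in>P. u \<in> C \<and> v \<in> C)" for v
  have uniq: "D = C" if "C \<in> P" "D \<in> P" "w \<in> C" "w \<in> D" for C D w
    using partition_onD2[OF P(1)] that unfolding disjoint_def by (metis disjoint_iff)
  have "(\<exists>D\<in>P. w \<in> D \<and> v \<in> D) \<longleftrightarrow> w \<in> C" if "C \<in> P" "v \<in> C" for v w C
    using uniq[of C _ v] that by metis
  then have l: "l u = l v" if "C \<in> P" "u \<in> C" "v \<in> C" for u v C
    using that unfolding l_def by simp
  have ex: "\<exists>C\<in>P. l v \<in> C \<and> v \<in> C" if "v < n" for v
  proof -
    have "v \<in> \<Union>P" using that unfolding partition_onD1[OF P(1), symmetric] by simp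
    then obtain C where "C \<in> P" "v \<in> C" by (rule UnionE)
    then have "\<exists>u. \<exists>C\<in>P. u \<in> C \<and> v \<in> C" by (intro exI[of _ v] bexI[of _ C] conjI)
    then show ?thesis unfolding l_def by (rule LeastI_ex)
  qed
  have "arcs E = same_label n l"
  proof -
    have "(u, v) \<in> arcs E \<longleftrightarrow> (u, v) \<in> same_label n l" for u v
    proof
      assume "(u, v) \<in> arcs E"
      then obtain C where C: "C \<in> P" "u \<in> C" "v \<in> C" "u \<noteq> v"
        unfolding arcs_def P(2) clique_edges_def by (auto simp: doubleton_eq_iff)
      moreover have "u < n" "v < n" using C partition_onD1[OF P(1)] by blast+
      ultimately show "(u, v) \<in> same_label n l" using l[OF C(1-3)] C(4) by (simp add: same_label_def)
    next
      assume *: "(u, v) \<in> same_label n l"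
      then have uv: "u < n" "v < n" "u \<noteq> v" "l u = l v" by (simp_all add: same_label_def)
      obtain C where C: "C \<in> P" "l u \<in> C" "u \<in> C" using ex[OF uv(1)] by blast
      obtain D where D: "D \<in> P" "l u \<in> D" "v \<in> D" using ex[OF uv(2)] unfolding uv(4) by blast
      have "D = C" by (rule uniq[OF C(1) D(1) C(2) D(2)])
      then show "(u, v) \<in> arcs E"
        using C D uv(3) unfolding arcs_def P(2) clique_edges_def by blast
    qed
    then show ?thesis by auto
  qed
  then have "E = label_graph n l"
    by (intro simple_graph_eqI[OF cluster_graph_imp_simple_graph[OF assms] simple_label_graph])
      (simp only: arcs_label_graph)
  then show ?thesis by (rule that)
qed

lemma cluster_rep_eq:
  assumes "set G = same_label n l" "u < n" "v < n"
  shows "cluster_rep n G u = cluster_rep n G v \<longleftrightarrow> l u = l v" "cluster_rep n G v < n"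
proof -
  have f: "filter (\<lambda>u. u = v \<or> (u, v) \<in> set G) [0..<n] = filter (\<lambda>u. l u = l v) [0..<n]" if "v < n" for v
    using that by (intro filter_cong) (auto simp: assms(1) same_label_def)
  have rep: "cluster_rep n G v < n \<and> l (cluster_rep n G v) = l v" if "v < n" for v
  proof (cases "filter (\<lambda>u. l u = l v) [0..<n]")
    case Nil
    then show ?thesis using that by (auto simp: filter_empty_conv)
  next
    case (Cons x xs)
    have "x \<in> set (filter (\<lambda>u. l u = l v) [0..<n])" unfolding Cons by simp
    then have "x < n" "l x = l v" by simp_all
    then show ?thesis using Cons f[OF that] by (simp add: cluster_rep_def)
  qed
  show "cluster_rep n G v < n" using rep assms by blast
  show "cluster_rep n G u = cluster_rep n G v \<longleftrightarrow> l u = l v"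
  proof
    assume "l u = l v"
    then show "cluster_rep n G u = cluster_rep n G v" 
      using f[OF assms(2)] f[OF assms(3)] by (simp add: cluster_rep_def)
  qed (use rep assms in metis)
qed

lemma induced_paths_Nil_iff:
  "induced_paths R = [] \<longleftrightarrow> (\<forall>u v w. (u, v) \<in> set R \<longrightarrow> (v, w) \<in> set R \<longrightarrow> u \<noteq> w \<longrightarrow> (u, w) \<in> set R)"
  unfolding induced_paths_def filter_empty_conv set_product by fastforce

text \<open>Without induced paths, being adjacent or equal is an equivalence relation, and the
  closed neighbourhood of a vertex is its class.\<close>

lemma same_label_rep:
  assumes R: "\<And>u v. (u, v) \<in> set R \<Longrightarrow> u < n \<and> v < n \<and> u \<noteq> v \<and> (v, u) \<in> set R"
    and "induced_paths R = []"
  shows "set R = same_label n (\<lambda>v. {u. u = v \<or> (u, v) \<in> set R})"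
proof -
  have tr: "(u, w) \<in> set R" if "(u, v) \<in> set R" "(v, w) \<in> set R" "u \<noteq> w" for u v w
    using assms(2) that unfolding induced_paths_Nil_iff by blast
  have "{u. u = v \<or> (u, v) \<in> set R} = {u. u = w \<or> (u, w) \<in> set R}" if "(v, w) \<in> set R" for v w
    using R tr that by blast
  then show ?thesis using R unfolding same_label_def by blast
qed

section \<open>Correctness of the decoding\<close>

lemma spine_enc_list [simp]: "spine (enc_list xs) = xs"
  by (induction xs) auto

lemma repr_adjacency:
  "repr (adjacency n R) = enc_list (map (\<lambda>i. enc_list (map (\<lambda>j. enc_bool ((i, j) \<in> set R)) [0..<n])) [0..<n])"
  by (simp add: adjacency_def repr_list_def repr_bool_def o_def)

lemma length_spine_enc_graph [simp]: "length (spine (enc_graph n E)) = n"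
  by (simp add: enc_graph_def)

lemma set_vertex_pairs [simp]: "set (vertex_pairs n) = {..<n} \<times> {..<n}"
  by (auto simp: vertex_pairs_def)

lemma distinct_vertex_pairs: "distinct (vertex_pairs n)"
  by (simp add: vertex_pairs_def distinct_product)

lemma decode_enc_graph:
  assumes "simple_graph {..<n} E"
  shows "set (decode_edges (enc_graph n E)) = arcs E"
proof -
  have "nth_or Leaf (spine (nth_or Leaf (spine (enc_graph n E)) i)) j \<noteq> Leaf \<longleftrightarrow> {i, j} \<in> E"
    if "i < n" "j < n" for i j
    using that by (simp add: enc_graph_def nth_or_eq enc_bool_def)
  then have "(i, j) \<in> set (decode_edges (enc_graph n E)) \<longleftrightarrow> (i, j) \<in> arcs E" for i j
    using arcs_simple(1,2)[OF assms, of i j]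
    by (cases "i < n \<and> j < n") (auto simp: decode_edges_def arcs_def)
  then show ?thesis by auto
qed

lemma distinct_decode_edges: "distinct (decode_edges g)"
  by (simp add: decode_edges_def distinct_vertex_pairs)

lemma valid_enc_graph:
  assumes "simple_graph {..<n} E" shows "valid_graph (enc_graph n E)"
  unfolding valid_graph_def repr_adjacency decode_enc_graph[OF assms] length_spine_enc_graph
  using arcs_simple(3)[OF assms] arcs_sym[of _ _ E] by (auto simp: enc_graph_def arcs_def insert_commute)

lemma valid_graph_obtain:
  assumes "valid_graph g"
  obtains E where "simple_graph {..<length (spine g)} E" "g = enc_graph (length (spine g)) E"
proof -
  let ?n = "length (spine g)" let ?R = "set (decode_edges g)"
  let ?E = "(\<lambda>p. {fst p, snd p}) ` ?R"
  have R: "(u, v) \<in> ?R \<Longrightarrow> u < ?n \<and> v < ?n" for u v by (auto simp: decode_edges_def)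
  have sym: "(u, v) \<in> ?R \<Longrightarrow> u \<noteq> v \<and> (v, u) \<in> ?R" for u v
    using assms unfolding valid_graph_def by (metis fst_conv snd_conv)
  have E: "{i, j} \<in> ?E \<longleftrightarrow> (i, j) \<in> ?R" for i j
    using sym by (force simp: doubleton_eq_iff image_iff)
  have "simple_graph {..<?n} ?E"
    unfolding simple_graph_def using R sym by fastforce
  moreover have "g = enc_graph ?n ?E"
    using assms unfolding valid_graph_def repr_adjacency enc_graph_def E by simp
  ultimately show ?thesis by (rule that)
qed

lemma induced_paths_cluster_iff:
  assumes "simple_graph {..<n} E" "set R = arcs E"
  shows "induced_paths R = [] \<longleftrightarrow> cluster_graph {..<n} E"
proof
  assume "induced_paths R = []"
  then have eq: "arcs E = same_label n (\<lambda>v. {u. u = v \<or> (u, v) \<in> set R})"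
    using same_label_rep[of R n] arcs_simple[OF assms(1)] arcs_sym assms(2) by metis
  then have "E = label_graph n (\<lambda>v. {u. u = v \<or> (u, v) \<in> set R})"
    by (intro simple_graph_eqI[OF assms(1) simple_label_graph]) (simp only: arcs_label_graph)
  then show "cluster_graph {..<n} E" by (simp only: cluster_graph_label_graph)
next
  assume "cluster_graph {..<n} E"
  then obtain l :: "nat \<Rightarrow> nat" where "E = label_graph n l" by (rule cluster_graph_obtain_label)
  then show "induced_paths R = []"
    by (auto simp: induced_paths_Nil_iff assms(2) arcs_label_graph same_label_def)
qed

section \<open>Binary numbers\<close>

lemma enc_nat_pos: "k > 0 \<Longrightarrow> enc_nat k = Node (enc_bool (odd k)) (enc_nat (k div 2))"
  by (simp add: enc_nat.simps[of k])

lemma enc_nat_0: "enc_nat 0 = Leaf"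
  by (simp add: enc_nat.simps[of 0])

text \<open>No round of Horner's scheme lowers the value, so a value that has reached the cap stays
  there, and capping every round equals capping once.\<close>

lemma capped_enc_nat: "capped_num c (enc_nat k) = min c k"
proof (induction k rule: less_induct)
  case (less k)
  show ?case
  proof (cases "k = 0")
    case False
    have "capped_num c (enc_nat k) = min c (2 * capped_num c (enc_nat (k div 2)) + (if odd k then 1 else 0))"
      using False by (simp add: capped_num_def enc_nat_pos enc_bool_def)
    also have "\<dots> = min c (2 * min c (k div 2) + (if odd k then 1 else 0))" using less False by simp
    also have "\<dots> = min c k"
    proof (cases "c \<le> k div 2")
      case False
      have "2 * (k div 2) + (if odd k then 1 else 0) = k"
        using mult_div_mod_eq[of 2 k] by (simp add: mod2_eq_if)
      then show ?thesis using False by (simp add: min_absorb2)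
    next
      case True
      then have "c \<le> k" by linarith
      with True show ?thesis by (simp add: min_absorb1)
    qed
    finally show ?thesis .
  qed (simp add: capped_num_def enc_nat_0)
qed

lemma valid_num_Node:
  "valid_num (Node h t) \<longleftrightarrow> h = repr (h \<noteq> Leaf) \<and> (if t = Leaf then h \<noteq> Leaf else valid_num t)"
  by (cases t) (auto simp: valid_num_def nth_or_def)

lemma valid_enc_nat: "valid_num (enc_nat k)"
proof (induction k rule: less_induct)
  case (less k)
  show ?case
  proof (cases "k = 0")
    case False
    then have "valid_num (enc_nat (k div 2))" by (intro less) simp
    moreover have "odd k" if "enc_nat (k div 2) = Leaf"
      using that False enc_nat_pos[of "k div 2"] by (cases "k = 1") auto
    ultimately show ?thesis using False by (auto simp: enc_nat_pos valid_num_Node enc_bool_def)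
  qed (simp add: valid_num_def enc_nat_0 nth_or_def)
qed

lemma valid_num_obtain: "valid_num m \<Longrightarrow> \<exists>k. m = enc_nat k"
proof (induction m)
  case Leaf
  then show ?case using enc_nat_0 by metis
next
  case (Node h t)
  show ?case
  proof (cases "t = Leaf")
    case True
    then have "h = Node Leaf Leaf" using Node.prems unfolding valid_num_Node by (metis repr_simps(2))
    then have "Node h t = enc_nat 1" using True by (simp add: enc_nat_pos enc_nat_0 enc_bool_def)
    then show ?thesis ..
  next
    case False
    then obtain k where k: "t = enc_nat k" using Node unfolding valid_num_Node by auto
    then have "k > 0" using False enc_nat_0 by (cases k) auto
    have "h = enc_bool (h \<noteq> Leaf)" using Node.prems unfolding valid_num_Node repr_bool_def by blast
    then have "Node h t = enc_nat (2 * k + (if h \<noteq> Leaf then 1 else 0))"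
      using \<open>k > 0\<close> k by (auto simp: enc_nat_pos)
    then show ?thesis ..
  qed
qed

text \<open>Separates the format check from the problem: an algorithm only has to be right on
  decoded graphs with capped numbers. \<open>distinct A\<close> lets \<open>length A\<close> stand
  for the number of arcs.\<close>

lemma decide_iff:
  assumes alg: "\<And>n E Ec A B m. simple_graph {..<n} E \<Longrightarrow> cluster_graph {..<n} Ec \<Longrightarrow> set A = arcs E \<Longrightarrow>
     distinct A \<Longrightarrow> set B = arcs Ec \<Longrightarrow> alg n A B (min (n * n) m) (min (n * n) k) U \<longleftrightarrow> P n E Ec m"
  shows "decide alg (Node x (enc_nat k), U) \<longleftrightarrow>
     (\<exists>n E Ec m. x = enc_instance n E Ec m \<and> simple_graph {..<n} E \<and> cluster_graph {..<n} Ec \<and> P n E Ec m)"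
proof
  assume D: "decide alg (Node x (enc_nat k), U)"
  define g gc t n where "g = left x" and "gc = left (right x)" and "t = right (right x)" and "n = length (spine g)"
  have D: "x = Node g (Node gc t)" "valid_graph g" "valid_graph gc" "induced_paths (decode_edges gc) = []"
     "n = length (spine gc)" "valid_num t"
     "alg n (decode_edges g) (decode_edges gc) (capped_num (n * n) t) (capped_num (n * n) (enc_nat k)) U"
    using D unfolding decide_def fst_conv snd_conv left.simps right.simps g_def[symmetric]
      gc_def[symmetric] t_def[symmetric] n_def[symmetric] by blast+
  obtain E where E: "simple_graph {..<n} E" "g = enc_graph n E"
    using valid_graph_obtain[OF D(2)] unfolding n_def .
  obtain Ec where Ec: "simple_graph {..<n} Ec" "gc = enc_graph n Ec"
    using valid_graph_obtain[OF D(3)] unfolding D(5)[symmetric] .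
  obtain m where m: "t = enc_nat m" using valid_num_obtain[OF D(6)] by blast
  have dec: "set (decode_edges g) = arcs E" "set (decode_edges gc) = arcs Ec"
    using decode_enc_graph E Ec by simp_all
  have cl: "cluster_graph {..<n} Ec" using induced_paths_cluster_iff[OF Ec(1) dec(2)] D(4) by simp
  have "P n E Ec m"
    using alg[OF E(1) cl dec(1) distinct_decode_edges dec(2)] D(7) unfolding m capped_enc_nat by blast
  moreover have "x = enc_instance n E Ec m" using D(1) E Ec m by (simp add: enc_instance_def)
  ultimately show "\<exists>n E Ec m. x = enc_instance n E Ec m \<and> simple_graph {..<n} E \<and> cluster_graph {..<n} Ec \<and> P n E Ec m"
    using E(1) cl by blast
next
  assume "\<exists>n E Ec m. x = enc_instance n E Ec m \<and> simple_graph {..<n} E \<and> cluster_graph {..<n} Ec \<and> P n E Ec m"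
  then obtain n E Ec m where x: "x = enc_instance n E Ec m" and E: "simple_graph {..<n} E"
    and cl: "cluster_graph {..<n} Ec" and P: "P n E Ec m" by blast
  note Ec = cluster_graph_imp_simple_graph[OF cl]
  note dec = decode_enc_graph[OF E] decode_enc_graph[OF Ec]
  have "induced_paths (decode_edges (enc_graph n Ec)) = []" using induced_paths_cluster_iff[OF Ec dec(2)] cl by simp
  moreover have "alg n (decode_edges (enc_graph n E)) (decode_edges (enc_graph n Ec)) (min (n * n) m) (min (n * n) k) U"
    using alg[OF E cl dec(1) distinct_decode_edges dec(2)] P by blast
  ultimately show "decide alg (Node x (enc_nat k), U)"
    unfolding decide_def x enc_instance_def
    by (simp add: valid_enc_graph[OF E] valid_enc_graph[OF Ec] valid_enc_nat capped_enc_nat)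
qed

section \<open>Correctness of the algorithms\<close>

subsection \<open>Knapsack\<close>

definition vsum :: "('i \<Rightarrow> nat \<times> nat \<times> nat) \<Rightarrow> 'i set \<Rightarrow> nat \<times> nat \<times> nat" where
  "vsum ch I = (\<Sum>i\<in>I. fst (ch i), \<Sum>i\<in>I. fst (snd (ch i)), \<Sum>i\<in>I. snd (snd (ch i)))"

lemma set_grid: "set (grid N) = {v. fst v \<le> N \<and> fst (snd v) \<le> N \<and> snd (snd v) \<le> N}"
  unfolding grid_def set_product set_upt by auto

lemma knapsack_snoc:
  "knapsack N (os @ [opts]) = filter (\<lambda>p. \<exists>s\<in>set (knapsack N os). \<exists>v\<in>set opts. p = vadd s v) (grid N)"
  by (simp add: knapsack_def)

lemma vsum_insert: "finite I \<Longrightarrow> i \<notin> I \<Longrightarrow> vsum ch (insert i I) = vadd (vsum ch I) (ch i)"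
  by (simp add: vsum_def vadd_def add.commute)

lemma vsum_cong: "(\<And>i. i \<in> I \<Longrightarrow> ch i = ch' i) \<Longrightarrow> vsum ch I = vsum ch' I"
  by (simp add: vsum_def)

text \<open>Entries are nonnegative, so the partial sums of a total inside the grid lie inside the
  grid too, and truncating the intermediate tables loses nothing.\<close>

lemma set_knapsack:
  assumes "distinct is"
  shows "v \<in> set (knapsack N (map F is)) \<longleftrightarrow>
    v \<in> set (grid N) \<and> (\<exists>ch. (\<forall>i\<in>set is. ch i \<in> set (F i)) \<and> v = vsum ch (set is))"
  using assms
proof (induction "is" arbitrary: v rule: rev_induct)
  case Nil
  then show ?case by (auto simp: knapsack_def vsum_def set_grid)
next
  case (snoc i "is")
  have IH: "s \<in> set (knapsack N (map F is)) \<longleftrightarrow>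
    s \<in> set (grid N) \<and> (\<exists>ch. (\<forall>i\<in>set is. ch i \<in> set (F i)) \<and> s = vsum ch (set is))" for s
    using snoc by simp
  have i: "i \<notin> set is" using snoc.prems by simp
  show ?case
  proof
    assume "v \<in> set (knapsack N (map F (is @ [i])))"
    then have "v \<in> set (grid N) \<and> (\<exists>s\<in>set (knapsack N (map F is)). \<exists>c\<in>set (F i). v = vadd s c)"
      unfolding map_append list.map knapsack_snoc by simp
    then obtain s c where s: "v \<in> set (grid N)" "s \<in> set (knapsack N (map F is))" "c \<in> set (F i)" "v = vadd s c"
      by (elim conjE bexE)
    obtain ch where ch: "\<forall>i\<in>set is. ch i \<in> set (F i)" "s = vsum ch (set is)"
      using s(2) unfolding IH by (elim conjE exE)
    note * = s(1) ch(1) s(3) s(4)[unfolded ch(2)]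
    have "vsum (ch(i := c)) (set is) = vsum ch (set is)" using i by (intro vsum_cong) auto
    then have "v = vsum (ch(i := c)) (set (is @ [i]))" using *(4) i by (simp add: vsum_insert)
    moreover have "\<forall>j\<in>set (is @ [i]). (ch(i := c)) j \<in> set (F j)" using * i by auto
    ultimately show "v \<in> set (grid N) \<and> (\<exists>ch. (\<forall>i\<in>set (is @ [i]). ch i \<in> set (F i)) \<and> v = vsum ch (set (is @ [i])))"
      using *(1) by blast
  next
    assume "v \<in> set (grid N) \<and> (\<exists>ch. (\<forall>i\<in>set (is @ [i]). ch i \<in> set (F i)) \<and> v = vsum ch (set (is @ [i])))"
    then obtain ch where *: "v \<in> set (grid N)" "\<forall>i\<in>set (is @ [i]). ch i \<in> set (F i)" "v = vsum ch (set (is @ [i]))"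
      by blast
    have v: "v = vadd (vsum ch (set is)) (ch i)" using *(3) i by (simp add: vsum_insert)
    then have "vsum ch (set is) \<in> set (grid N)" using *(1) unfolding set_grid vadd_def by auto
    then have "vsum ch (set is) \<in> set (knapsack N (map F is))" unfolding IH using *(2) by auto
    moreover have "ch i \<in> set (F i)" using *(2) by simp
    ultimately show "v \<in> set (knapsack N (map F (is @ [i])))"
      unfolding map_append list.map knapsack_snoc set_filter using *(1) v by blast
  qed
qed

subsection \<open>Refinements of blocks\<close>

text \<open>The block number in front keeps blocks apart even if their certificates use the same
  labels.\<close>

definition refined_label :: "nat \<Rightarrow> nat list \<Rightarrow> nat list \<Rightarrow> (nat \<Rightarrow> tree) \<Rightarrow> nat \<Rightarrow> nat \<times> tree" where
  "refined_label n bs gs W v = (at bs v, cert_label n bs gs (W (at bs v)) v)"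

lemma length_filter_vertex_pairs: "length (filter P (vertex_pairs n)) = card {p. fst p < n \<and> snd p < n \<and> P p}"
proof -
  have "length (filter P (vertex_pairs n)) = card (set (filter P (vertex_pairs n)))"
    using distinct_card[OF distinct_filter[OF distinct_vertex_pairs]] by metis
  also have "set (filter P (vertex_pairs n)) = {p. fst p < n \<and> snd p < n \<and> P p}" by auto
  finally show ?thesis .
qed

lemma finite_pairs: "finite {p :: nat \<times> nat. fst p < n \<and> snd p < n \<and> P p}"
  by (rule finite_subset[of _ "{..<n} \<times> {..<n}"]) auto

text \<open>A pair on which \<open>R\<close> and the refinement differ either runs between two
  blocks, where it must belong to \<open>R\<close>, or lies in a single block and is counted in the
  cost of that block.\<close>

lemma card_refined_sym_diff:
  assumes R: "\<And>u v. (u, v) \<in> set R \<Longrightarrow> u < n \<and> v < n \<and> u \<noteq> v" and bs: "\<And>v. v < n \<Longrightarrow> at bs v \<le> n"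
  shows "card (sym_diff (set R) (same_label n (refined_label n bs gs W))) =
    cross_cost n R bs + (\<Sum>b\<in>{0..<Suc n}. block_cost n R bs gs (W b) b)"
    (is "card ?D = _")
proof -
  let ?X = "{p. fst p < n \<and> snd p < n \<and> at bs (fst p) \<noteq> at bs (snd p) \<and> p \<in> set R}"
  let ?Y = "\<lambda>b. {p. fst p < n \<and> snd p < n \<and> fst p \<noteq> snd p \<and> at bs (fst p) = b \<and> at bs (snd p) = b \<and>
     (cert_label n bs gs (W b) (fst p) = cert_label n bs gs (W b) (snd p)) \<noteq> (p \<in> set R)}"
  have D: "(u, v) \<in> ?D \<longleftrightarrow> (u, v) \<in> ?X \<union> (\<Union>b\<in>{0..<Suc n}. ?Y b)" for u v
  proof (cases "u < n \<and> v < n \<and> u \<noteq> v")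
    case True
    then show ?thesis using bs[of u] by (cases "at bs u = at bs v") (auto simp: same_label_def refined_label_def)
  qed (use R in \<open>auto simp: same_label_def\<close>)
  then have D_eq: "?D = ?X \<union> (\<Union>b\<in>{0..<Suc n}. ?Y b)"
    by (intro set_eqI) (simp only: split_paired_all)
  have un: "card (?X \<union> (\<Union>b\<in>{0..<Suc n}. ?Y b)) = card ?X + card (\<Union>b\<in>{0..<Suc n}. ?Y b)"
  proof (rule card_Un_disjoint)
    show "finite ?X" by (rule finite_pairs)
    show "finite (\<Union>b\<in>{0..<Suc n}. ?Y b)" by (intro finite_UN_I finite_atLeastLessThan finite_pairs)
  qed auto
  have un2: "card (\<Union>b\<in>{0..<Suc n}. ?Y b) = (\<Sum>b\<in>{0..<Suc n}. card (?Y b))"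
  proof (rule card_UN_disjoint)
    show "\<forall>b\<in>{0..<Suc n}. finite (?Y b)" by (intro ballI finite_pairs)
    show "\<forall>b\<in>{0..<Suc n}. \<forall>c\<in>{0..<Suc n}. b \<noteq> c \<longrightarrow> ?Y b \<inter> ?Y c = {}"
    proof (intro ballI impI equals0I)
      fix b c p assume "b \<noteq> c" "p \<in> ?Y b \<inter> ?Y c"
      then have "at bs (fst p) = b" "at bs (fst p) = c" unfolding Int_iff mem_Collect_eq by blast+
      with \<open>b \<noteq> c\<close> show False by simp
    qed
  qed simp
  show ?thesis unfolding cross_cost_def block_cost_def length_filter_vertex_pairs D_eq un un2 ..
qed

text \<open>Choosing one option per block in the knapsack is choosing a certificate per block. The
  grid up to \<open>n * n\<close> suffices, as both differences are sets of ordered pairs of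
  vertices.\<close>

lemma refinable_iff:
  assumes A: "\<And>u v. (u, v) \<in> set A \<Longrightarrow> u < n \<and> v < n \<and> u \<noteq> v"
    and B: "\<And>u v. (u, v) \<in> set B \<Longrightarrow> u < n \<and> v < n \<and> u \<noteq> v"
    and bs: "\<And>v. v < n \<Longrightarrow> at bs v \<le> n"
  shows "refinable n A B bs gs U ka kb \<longleftrightarrow> (\<exists>W. (\<forall>b\<le>n. W b \<in> set U) \<and>
    card (sym_diff (set A) (same_label n (refined_label n bs gs W))) \<le> ka \<and>
    card (sym_diff (set B) (same_label n (refined_label n bs gs W))) \<le> kb)"
proof
  let ?c = "\<lambda>b w. (block_cost n A bs gs w b, block_cost n B bs gs w b, 0::nat)"
  let ?F = "\<lambda>b. map (?c b) U"
  have cards: "card (sym_diff (set A) (same_label n (refined_label n bs gs W))) =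
    cross_cost n A bs + (\<Sum>b\<in>{0..<Suc n}. block_cost n A bs gs (W b) b)"
    "card (sym_diff (set B) (same_label n (refined_label n bs gs W))) =
    cross_cost n B bs + (\<Sum>b\<in>{0..<Suc n}. block_cost n B bs gs (W b) b)" for W
    by (rule card_refined_sym_diff; use A B bs in blast)+
  {
    assume "refinable n A B bs gs U ka kb"
    then obtain v where v: "v \<in> set (knapsack (n * n) (map ?F [0..<Suc n]))" "cross_cost n A bs + fst v \<le> ka"
      "cross_cost n B bs + fst (snd v) \<le> kb"
      unfolding refinable_def by blast
    then obtain ch where ch: "\<forall>b\<in>set [0..<Suc n]. ch b \<in> set (?F b)" "v = vsum ch (set [0..<Suc n])"
      using set_knapsack[of "[0..<Suc n]" v "n * n" ?F] by (simp only: distinct_upt) blast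
    have "\<forall>b\<in>{0..<Suc n}. \<exists>w\<in>set U. ch b = ?c b w" using ch(1) by fastforce
    then obtain W where W: "\<And>b. b \<in> {0..<Suc n} \<Longrightarrow> W b \<in> set U \<and> ch b = ?c b (W b)" by metis
    have "fst v = (\<Sum>b\<in>{0..<Suc n}. block_cost n A bs gs (W b) b)"
      "fst (snd v) = (\<Sum>b\<in>{0..<Suc n}. block_cost n B bs gs (W b) b)"
      unfolding ch(2) vsum_def set_upt fst_conv snd_conv using W by (auto intro!: sum.cong simp del: sum.op_ivl_Suc)
    then have "card (sym_diff (set A) (same_label n (refined_label n bs gs W))) \<le> ka \<and>
      card (sym_diff (set B) (same_label n (refined_label n bs gs W))) \<le> kb"
      unfolding cards using v(2,3) by simp
    moreover have "\<forall>b\<le>n. W b \<in> set U" using W by (simp add: less_Suc_eq_le)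
    ultimately show "\<exists>W. (\<forall>b\<le>n. W b \<in> set U) \<and>
      card (sym_diff (set A) (same_label n (refined_label n bs gs W))) \<le> ka \<and>
      card (sym_diff (set B) (same_label n (refined_label n bs gs W))) \<le> kb" by blast
  next
    assume "\<exists>W. (\<forall>b\<le>n. W b \<in> set U) \<and>
      card (sym_diff (set A) (same_label n (refined_label n bs gs W))) \<le> ka \<and>
      card (sym_diff (set B) (same_label n (refined_label n bs gs W))) \<le> kb"
    then obtain W where W: "\<And>b. b \<le> n \<Longrightarrow> W b \<in> set U"
      "card (sym_diff (set A) (same_label n (refined_label n bs gs W))) \<le> ka"
      "card (sym_diff (set B) (same_label n (refined_label n bs gs W))) \<le> kb" by blast
    let ?v = "vsum (\<lambda>b. ?c b (W b)) (set [0..<Suc n])"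
    have v: "fst ?v = (\<Sum>b\<in>{0..<Suc n}. block_cost n A bs gs (W b) b)"
      "fst (snd ?v) = (\<Sum>b\<in>{0..<Suc n}. block_cost n B bs gs (W b) b)" "snd (snd ?v) = 0"
      unfolding vsum_def by (simp_all del: sum.op_ivl_Suc upt_Suc)
    have le: "card (sym_diff (set R) (same_label n l)) \<le> n * n"
      if "\<And>u v. (u, v) \<in> set R \<Longrightarrow> u < n \<and> v < n \<and> u \<noteq> v" for R and l :: "nat \<Rightarrow> nat \<times> tree"
    proof -
      have "card (sym_diff (set R) (same_label n l)) \<le> card ({..<n} \<times> {..<n})"
        using that by (intro card_mono) (auto simp: same_label_def)
      then show ?thesis by simp
    qed
    have "?v \<in> set (grid (n * n))"
      using le[of A "refined_label n bs gs W", OF A] le[of B "refined_label n bs gs W", OF B]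
      unfolding set_grid cards by (simp only: v mem_Collect_eq) simp
    then have "?v \<in> set (knapsack (n * n) (map ?F [0..<Suc n]))"
      unfolding set_knapsack[OF distinct_upt]
      by (intro conjI exI[of _ "\<lambda>b. ?c b (W b)"] ballI refl) (use W(1) in auto)
    moreover have "cross_cost n A bs + fst ?v \<le> ka" "cross_cost n B bs + fst (snd ?v) \<le> kb"
      using W(2,3) unfolding cards v .
    ultimately show "refinable n A B bs gs U ka kb" unfolding refinable_def by blast
  }
qed

section \<open>Heights of certificates and ranks of groups\<close>

lemma spine_repr_list: "spine (repr (xs :: 'a::encodable list)) = map repr xs"
  by (induction xs) auto

lemma height_repr_nat: "height (repr (k::nat)) = k"
  by (induction k) auto

lemma height_repr_list:
  "(\<And>x. x \<in> set xs \<Longrightarrow> height (repr x) \<le> b) \<Longrightarrow> height (repr (xs :: 'a::encodable list)) \<le> length xs + b"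
proof (induction xs)
  case (Cons x xs)
  then have "height (repr x) \<le> b" "height (repr xs) \<le> length xs + b" by simp_all
  then show ?case by simp
qed simp

lemma group_rank_card:
  "group_rank n bs gs v = card {g. g < at gs v \<and> (\<exists>u<n. at bs u = at bs v \<and> at gs u = g)}"
proof -
  have "group_rank n bs gs v = card (set (filter (\<lambda>g. \<exists>u\<in>set [0..<n]. at bs u = at bs v \<and> at gs u = g) [0..<at gs v]))"
    unfolding group_rank_def by (rule distinct_card[symmetric]) simp
  also have "set (filter (\<lambda>g. \<exists>u\<in>set [0..<n]. at bs u = at bs v \<and> at gs u = g) [0..<at gs v]) =
     {g. g < at gs v \<and> (\<exists>u<n. at bs u = at bs v \<and> at gs u = g)}" by auto
  finally show ?thesis .
qed

lemma group_rank_less: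
  assumes "v < n" shows "group_rank n bs gs v < card (at gs ` {u. u < n \<and> at bs u = at bs v})"
  unfolding group_rank_card by (rule psubset_card_mono) (use assms in auto)

lemma group_rank_inject:
  assumes "u < n" "v < n" "at bs u = at bs v" "group_rank n bs gs u = group_rank n bs gs v"
  shows "at gs u = at gs v"
proof -
  have less: "group_rank n bs gs u < group_rank n bs gs v"
    if "at gs u < at gs v" "u < n" "at bs u = at bs v" for u v
    unfolding group_rank_card
  proof (rule psubset_card_mono)
    show "{g. g < at gs u \<and> (\<exists>w<n. at bs w = at bs u \<and> at gs w = g)} \<subset>
      {g. g < at gs v \<and> (\<exists>w<n. at bs w = at bs v \<and> at gs w = g)}"
      using that by (intro psubsetI) auto
  qed simp
  show ?thesis using less[of u v] less[of v u] assms by (cases "at gs u" "at gs v" rule: linorder_cases) auto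
qed

text \<open>A class of \<open>l\<close> is named, in unary, by the least rank of its groups. There
  are \<open>m\<close> positions and no entry exceeds \<open>m\<close>, hence the height
  \<open>2 * m\<close>.\<close>

lemma block_certificate_exists:
  fixes l :: "nat \<Rightarrow> nat"
  assumes respect: "\<And>u v. u < n \<Longrightarrow> v < n \<Longrightarrow> at bs u = b \<Longrightarrow> at bs v = b \<Longrightarrow> at gs u = at gs v \<Longrightarrow> l u = l v"
    and small: "card (at gs ` {u. u < n \<and> at bs u = b}) \<le> m"
  shows "\<exists>w. height w \<le> 2 * m \<and> (\<forall>u v. u < n \<longrightarrow> v < n \<longrightarrow> at bs u = b \<longrightarrow> at bs v = b \<longrightarrow>
     (cert_label n bs gs w u = cert_label n bs gs w v \<longleftrightarrow> l u = l v))"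
proof -
  let ?rk = "group_rank n bs gs"
  define c where "c v = (LEAST r. \<exists>u<n. at bs u = b \<and> ?rk u = r \<and> l u = l v)" for v
  define x where "x r = (if \<exists>v<n. at bs v = b \<and> ?rk v = r then c (SOME v. v < n \<and> at bs v = b \<and> ?rk v = r) else 0)" for r
  have rk: "?rk v < m" if "v < n" "at bs v = b" for v
    using group_rank_less[OF that(1), of bs gs] small that(2) by simp
  have c_ex: "\<exists>u<n. at bs u = b \<and> ?rk u = c v \<and> l u = l v" if "v < n" "at bs v = b" for v
    unfolding c_def by (rule LeastI_ex) (use that in blast)
  have x: "x (?rk v) = c v" if v: "v < n" "at bs v = b" for v
  proof -
    let ?u = "SOME u. u < n \<and> at bs u = b \<and> ?rk u = ?rk v"
    have "?u < n \<and> at bs ?u = b \<and> ?rk ?u = ?rk v" by (rule someI[of _ v]) (use v in simp)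
    then have "l ?u = l v" using respect group_rank_inject[of ?u n v bs gs] v by metis
    then have "c ?u = c v" by (simp add: c_def)
    moreover have "\<exists>u<n. at bs u = b \<and> ?rk u = ?rk v" using v by blast
    ultimately show ?thesis by (simp add: x_def)
  qed
  have x_less: "x r \<le> m" for r
  proof (cases "\<exists>v<n. at bs v = b \<and> ?rk v = r")
    case True
    then obtain v where v: "v < n" "at bs v = b" "?rk v = r" by blast
    obtain u where "u < n" "at bs u = b" "?rk u = c v" using c_ex[OF v(1,2)] by blast
    then have "c v < m" using rk by metis
    then show ?thesis using x[OF v(1,2)] v(3) by simp
  next
    case False
    then show ?thesis unfolding x_def by (simp only: if_False)
  qed
  let ?w = "repr (map x [0..<m])"
  have label: "cert_label n bs gs ?w v = repr (c v)" if "v < n" "at bs v = b" for v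
    using rk[OF that] x[OF that] by (simp add: cert_label_def spine_repr_list nth_or_eq)
  have "height ?w \<le> length (map x [0..<m]) + m"
    by (rule height_repr_list) (use x_less in \<open>auto simp: height_repr_nat\<close>)
  then have "height ?w \<le> 2 * m" by simp
  moreover have "cert_label n bs gs ?w u = cert_label n bs gs ?w v \<longleftrightarrow> l u = l v"
    if u: "u < n" "at bs u = b" and v: "v < n" "at bs v = b" for u v
  proof
    assume "cert_label n bs gs ?w u = cert_label n bs gs ?w v"
    then have "c u = c v" unfolding label[OF u] label[OF v] repr_inject .
    obtain u' where u': "u' < n" "at bs u' = b" "?rk u' = c u" "l u' = l u" using c_ex[OF u] by blast
    obtain v' where v': "v' < n" "at bs v' = b" "?rk v' = c v" "l v' = l v" using c_ex[OF v] by blast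
    have "l u' = l v'"
      by (rule respect[OF u'(1) v'(1) u'(2) v'(2) group_rank_inject[OF u'(1) v'(1), of bs]])
        (use u' v' \<open>c u = c v\<close> in simp_all)
    then show "l u = l v" using u' v' by simp
  qed (simp add: label[OF u] label[OF v] c_def)
  ultimately show ?thesis by blast
qed

text \<open>Only a block that \<open>l\<close> splits has to be small; on the others the certificate
  \<open>Leaf\<close> works whatever their size. Pairs joined by \<open>l\<close> across blocks are
  separated, and each application has to show that this does no damage.\<close>

lemma refined_label_exists:
  fixes l :: "nat \<Rightarrow> nat"
  assumes respect: "\<And>u v. u < n \<Longrightarrow> v < n \<Longrightarrow> at bs u = at bs v \<Longrightarrow> at gs u = at gs v \<Longrightarrow> l u = l v"
    and small: "\<And>u v. u < n \<Longrightarrow> v < n \<Longrightarrow> at bs u = at bs v \<Longrightarrow> l u \<noteq> l v \<Longrightarrow>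
       card (at gs ` {w. w < n \<and> at bs w = at bs v}) \<le> m"
    and U: "\<And>t. height t \<le> 2 * m \<Longrightarrow> t \<in> set U"
  obtains W where "\<And>b. W b \<in> set U"
    "same_label n (refined_label n bs gs W) = {(u, v). (u, v) \<in> same_label n l \<and> at bs u = at bs v}"
proof -
  have "\<exists>w. w \<in> set U \<and> (\<forall>u v. u < n \<longrightarrow> v < n \<longrightarrow> at bs u = b \<longrightarrow> at bs v = b \<longrightarrow>
     (cert_label n bs gs w u = cert_label n bs gs w v \<longleftrightarrow> l u = l v))" for b
  proof (cases "\<exists>u v. u < n \<and> v < n \<and> at bs u = b \<and> at bs v = b \<and> l u \<noteq> l v")
    case True
    then have "card (at gs ` {u. u < n \<and> at bs u = b}) \<le> m" using small by metis
    from block_certificate_exists[OF _ this, of l] respect U show ?thesis by metis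
  next
    case False
    have leaf: "cert_label n bs gs Leaf v = Leaf" for v by (simp add: cert_label_def nth_or_eq)
    have "Leaf \<in> set U" by (rule U) simp
    then show ?thesis
      by (intro exI[of _ Leaf] conjI allI impI) (use False in \<open>simp_all only: leaf, blast\<close>)
  qed
  then have "\<exists>W. \<forall>b. W b \<in> set U \<and> (\<forall>u v. u < n \<longrightarrow> v < n \<longrightarrow> at bs u = b \<longrightarrow> at bs v = b \<longrightarrow>
     (cert_label n bs gs (W b) u = cert_label n bs gs (W b) v \<longleftrightarrow> l u = l v))"
    by (intro choice) blast
  then obtain W where W: "\<And>b. W b \<in> set U" "\<And>b u v. u < n \<Longrightarrow> v < n \<Longrightarrow> at bs u = b \<Longrightarrow> at bs v = b \<Longrightarrow>
     (cert_label n bs gs (W b) u = cert_label n bs gs (W b) v \<longleftrightarrow> l u = l v)" by blast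
  show ?thesis
  proof (rule that[OF W(1)])
    show "same_label n (refined_label n bs gs W) = {(u, v). (u, v) \<in> same_label n l \<and> at bs u = at bs v}"
      using W(2) by (auto simp: same_label_def refined_label_def)
  qed
qed

lemma label_graph_subset_iff: "label_graph n l \<subseteq> F \<longleftrightarrow> same_label n l \<subseteq> arcs F"
  using arcs_mono_iff[OF simple_label_graph[of n l], of F] unfolding arcs_label_graph .

lemma le_capped: "x \<le> c \<Longrightarrow> x \<le> 2 * min c k \<longleftrightarrow> x \<le> 2 * (k::nat)"
  by auto

lemma card_sym_diff_le:
  assumes "X \<subseteq> {..<n} \<times> {..<n}" "Y \<subseteq> {..<n} \<times> {..<n}" shows "card (sym_diff X Y) \<le> n * (n::nat)"
proof -
  have "card (sym_diff X Y) \<le> card ({..<n} \<times> {..<n})" using assms by (intro card_mono) auto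
  then show ?thesis by simp
qed

lemma arcs_subset: "simple_graph {..<n::nat} E \<Longrightarrow> arcs E \<subseteq> {..<n} \<times> {..<n}"
  using arcs_simple by fastforce

lemma same_label_subset: "same_label n l \<subseteq> {..<n} \<times> {..<n}"
  by (auto simp: same_label_def)

lemma card_sym_diff_mono:
  assumes "simple_graph V E" "simple_graph V F" "simple_graph V F'"
    and "sym_diff (arcs E) (arcs F) \<subseteq> sym_diff (arcs E) (arcs F')"
  shows "card (sym_diff E F) \<le> card (sym_diff E F')"
proof (rule card_mono)
  have "sym_diff E F' \<subseteq> Pow V" "finite V" using assms(1,3) unfolding simple_graph_def by auto
  then show "finite (sym_diff E F')" by (meson finite_Pow_iff finite_subset)
  show "sym_diff E F \<subseteq> sym_diff E F'"
    using arcs_mono_iff[OF simple_graph_sym_diff[OF assms(1,2)], of "sym_diff E F'"] assms(4)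
    unfolding arcs_sym_diff by blast
qed

lemma refinable_arcs_iff:
  assumes E: "simple_graph {..<n} E" and Ec: "simple_graph {..<n} Ec"
    and A: "set A = arcs E" and B: "set B = arcs Ec" and bs: "\<And>v. v < n \<Longrightarrow> at bs v \<le> n"
  shows "refinable n A B bs gs U (2 * min (n * n) k) (2 * min (n * n) d) \<longleftrightarrow>
    (\<exists>W. (\<forall>b\<le>n. W b \<in> set U) \<and>
      card (sym_diff E (label_graph n (refined_label n bs gs W))) \<le> k \<and>
      edge_dist {..<n} (label_graph n (refined_label n bs gs W)) Ec \<le> d)"
proof -
  have capped: "card (sym_diff F (label_graph n l)) \<le> j \<longleftrightarrow>
      card (sym_diff (set R) (same_label n l)) \<le> 2 * min (n * n) j"
    if "simple_graph {..<n} F" "set R = arcs F" for R F j and l :: "nat \<Rightarrow> nat \<times> tree"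
    unfolding card_sym_diff_arcs[OF that(1) simple_label_graph] arcs_label_graph that(2)
    by (rule le_capped[symmetric]) (intro card_sym_diff_le arcs_subset same_label_subset that(1))
  have dist: "edge_dist {..<n} E' Ec = card (sym_diff Ec E')" for E'
    by (simp add: edge_dist_def Un_commute)
  show ?thesis
    unfolding dist capped[OF E A] capped[OF Ec B]
  proof (rule refinable_iff)
    show "(u, v) \<in> set A \<Longrightarrow> u < n \<and> v < n \<and> u \<noteq> v" for u v using arcs_simple[OF E] A by blast
    show "(u, v) \<in> set B \<Longrightarrow> u < n \<and> v < n \<and> u \<noteq> v" for u v using arcs_simple[OF Ec] B by blast
  qed (rule bs)
qed

text \<open>Charging: the pairs in \<open>D\<close>, sent to the class of their first entry, cover
  all classes of \<open>S\<close>. The sets \<open>D\<close> that occur are symmetric, so first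
  entries account for both endpoints.\<close>

lemma card_le_touching:
  assumes "finite D" "card D \<le> k" "\<And>w. w \<in> S \<Longrightarrow> \<exists>w' x. (w', x) \<in> D \<and> f w' = f w"
  shows "card (f ` S) \<le> k"
proof -
  have "f ` S \<subseteq> (\<lambda>p. f (fst p)) ` D"
  proof
    fix y assume "y \<in> f ` S"
    then obtain w where "w \<in> S" "y = f w" by blast
    then obtain w' x where "(w', x) \<in> D" "y = f w'" using assms(3)[of w] by auto
    then show "y \<in> (\<lambda>p. f (fst p)) ` D" by (intro image_eqI[of _ _ "(w', x)"]) simp_all
  qed
  then have "card (f ` S) \<le> card D" using surj_card_le[OF assms(1)] by blast
  then show ?thesis using assms(2) by simp
qed

subsection \<open>Deletion\<close>

definition symmetric_arcs :: "nat \<Rightarrow> (nat \<times> nat) list \<Rightarrow> bool" where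
  "symmetric_arcs n G \<longleftrightarrow> (\<forall>u v. (u, v) \<in> set G \<longrightarrow> u < n \<and> v < n \<and> u \<noteq> v \<and> (v, u) \<in> set G)"

lemma symmetric_arcs_remove_edge: "symmetric_arcs n G \<Longrightarrow> symmetric_arcs n (remove_edge p G)"
  unfolding symmetric_arcs_def remove_edge_def by (cases p) auto

lemma symmetric_arcs_branch_step: "symmetric_arcs n G \<Longrightarrow> symmetric_arcs n (branch_step G t)"
  unfolding branch_step_def by (simp add: symmetric_arcs_remove_edge)

lemma symmetric_arcs_foldl: "symmetric_arcs n G \<Longrightarrow> symmetric_arcs n (foldl branch_step G ts)"
  by (induction ts arbitrary: G) (simp_all add: symmetric_arcs_branch_step)

lemma foldl_branch_subset: "set (foldl branch_step G ts) \<subseteq> set G"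
proof (induction ts arbitrary: G)
  case (Cons t ts)
  show ?case using Cons[of "branch_step G t"] branch_step_subset[of G t] by simp
qed simp

text \<open>A cluster graph inside \<open>G\<close> misses one of the two edges of an induced path,
  because its adjacency is transitive and the ends of the path are not adjacent in \<open>G\<close>.
  Deleting such an edge keeps the target inside the graph and lowers the excess by two arcs.\<close>

lemma branch_exists:
  assumes "symmetric_arcs n G" "same_label n l \<subseteq> set G" "card (set G - same_label n l) \<le> 2 * k"
  shows "\<exists>ts. length ts \<le> k \<and> set ts \<subseteq> {Leaf, Node Leaf Leaf} \<and> induced_paths (foldl branch_step G ts) = [] \<and>
     same_label n l \<subseteq> set (foldl branch_step G ts)"
  using assms
proof (induction k arbitrary: G)
  case (0 G)
  then have "set G = same_label n l" by auto
  then have "induced_paths G = []" by (auto simp: induced_paths_Nil_iff same_label_def)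
  then show ?case using 0 by (intro exI[of _ "[]"]) simp
next
  case (Suc k G)
  show ?case
  proof (cases "induced_paths G")
    case Nil
    then show ?thesis using Suc by (intro exI[of _ "[]"]) simp
  next
    case (Cons q qs)
    obtain u v v' w where q: "q = ((u, v), (v', w))" by (metis surj_pair)
    have "q \<in> set (induced_paths G)" using Cons by simp
    then have uvw: "(u, v) \<in> set G" "(v, w) \<in> set G" "v' = v" "u \<noteq> w" "(u, w) \<notin> set G"
      unfolding q induced_paths_def by auto
    define t where "t = (if (u, v) \<notin> same_label n l then Leaf else Node Leaf Leaf)"
    define p where "p = (if (u, v) \<notin> same_label n l then (u, v) else (v, w))"
    have p: "p \<in> set G" "p \<notin> same_label n l"
      using uvw Suc.prems(2) unfolding p_def same_label_def by auto
    have G': "branch_step G t = remove_edge p G"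
      unfolding branch_step_def t_def p_def Cons q uvw(3) by simp
    obtain a b where ab: "p = (a, b)" by (cases p)
    have ba: "(b, a) \<in> set G" "a \<noteq> b" "(b, a) \<notin> same_label n l"
      using p Suc.prems(1) unfolding ab symmetric_arcs_def by (auto simp: same_label_def)
    have set: "set (remove_edge p G) = set G - {(a, b), (b, a)}"
      unfolding remove_edge_def ab by auto
    have "card (set G - same_label n l - {(a, b), (b, a)}) = card (set G - same_label n l) - card {(a, b), (b, a)}"
      by (rule card_Diff_subset) (use p ba ab in auto)
    moreover have "set (remove_edge p G) - same_label n l = set G - same_label n l - {(a, b), (b, a)}"
      unfolding set by blast
    ultimately have "card (set (branch_step G t) - same_label n l) \<le> 2 * k"
      using Suc.prems(3) ba(2) unfolding G' by simp
    moreover have "same_label n l \<subseteq> set (branch_step G t)"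
      unfolding G' set using Suc.prems(2) p(2) ba(3) ab by blast
    ultimately obtain ts where "length ts \<le> k" "set ts \<subseteq> {Leaf, Node Leaf Leaf}"
      "induced_paths (foldl branch_step (branch_step G t) ts) = []"
      "same_label n l \<subseteq> set (foldl branch_step (branch_step G t) ts)"
      using Suc.IH[of "branch_step G t"] symmetric_arcs_branch_step[OF Suc.prems(1)] by blast
    then show ?thesis by (intro exI[of _ "t # ts"]) (simp add: t_def)
  qed
qed

lemma at_cluster_reps: "v < n \<Longrightarrow> at (cluster_reps n G) v = cluster_rep n G v"
  by (simp add: cluster_reps_def nth_or_eq)

lemma cluster_reps_eq:
  assumes "set G = same_label n l" "u < n" "v < n"
  shows "at (cluster_reps n G) u = at (cluster_reps n G) v \<longleftrightarrow> l u = l v" "at (cluster_reps n G) v < n"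
  using cluster_rep_eq[OF assms] assms(2,3) by (simp_all add: at_cluster_reps)

text \<open>The height \<open>4 * k + 1\<close> covers both kinds of certificates: \<open>k\<close>
  bits form a list of height at most \<open>k + 1\<close>, and labellings of at most
  \<open>2 * k\<close> vertices have height at most \<open>4 * k\<close>.\<close>

lemma deletion_alg_iff:
  assumes E: "simple_graph {..<n} E" and Ec: "cluster_graph {..<n} Ec"
    and A: "set A = arcs E" and B: "set B = arcs Ec"
    and U: "\<And>t. height t \<le> 4 * k + 1 \<Longrightarrow> t \<in> set U"
  shows "deletion_alg n A B (min (n * n) d) (min (n * n) k) U \<longleftrightarrow> dc_deletion edge_dist {..<n} E Ec k d"
proof -
  note Ec' = cluster_graph_imp_simple_graph[OF Ec]
  have Aw: "(u, v) \<in> set A \<Longrightarrow> u < n \<and> v < n \<and> u \<noteq> v" for u v using arcs_simple[OF E] A by blast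
  have symA: "symmetric_arcs n A"
    unfolding symmetric_arcs_def
  proof (intro allI impI conjI)
    fix u v assume uv: "(u, v) \<in> set A"
    show "u < n" "v < n" "u \<noteq> v" using Aw[OF uv] by blast+
    show "(v, u) \<in> set A" using uv unfolding A arcs_sym[of v u E] .
  qed
  have G: "\<exists>r :: nat \<Rightarrow> nat set. set (branch A w) = same_label n r" if "induced_paths (branch A w) = []" for w
  proof -
    have "symmetric_arcs n (branch A w)" unfolding branch_def by (rule symmetric_arcs_foldl[OF symA])
    then have "set (branch A w) = same_label n (\<lambda>v. {u. u = v \<or> (u, v) \<in> set (branch A w)})"
      by (intro same_label_rep that) (simp add: symmetric_arcs_def)
    then show ?thesis by (rule exI[where P="\<lambda>r. set (branch A w) = same_label n r"])
  qed
  have ref: "refinable n A B (cluster_reps n (branch A w)) [0..<n] U (2 * min (n * n) k) (2 * min (n * n) d) \<longleftrightarrow>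
    (\<exists>W. (\<forall>b\<le>n. W b \<in> set U) \<and>
      card (sym_diff E (label_graph n (refined_label n (cluster_reps n (branch A w)) [0..<n] W))) \<le> k \<and>
      edge_dist {..<n} (label_graph n (refined_label n (cluster_reps n (branch A w)) [0..<n] W)) Ec \<le> d)"
    if w: "induced_paths (branch A w) = []" for w
  proof (rule refinable_arcs_iff[OF E Ec' A B])
    obtain r :: "nat \<Rightarrow> nat set" where r: "set (branch A w) = same_label n r" using G[OF w] by blast
    show "at (cluster_reps n (branch A w)) v \<le> n" if "v < n" for v
      using cluster_reps_eq(2)[OF r that that] by simp
  qed
  show ?thesis
  proof
    assume "deletion_alg n A B (min (n * n) d) (min (n * n) k) U"
    then obtain w where w: "induced_paths (branch A w) = []"
       "refinable n A B (cluster_reps n (branch A w)) [0..<n] U (2 * min (n * n) k) (2 * min (n * n) d)"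
      unfolding deletion_alg_def by blast
    let ?bs = "cluster_reps n (branch A w)"
    obtain r :: "nat \<Rightarrow> nat set" where r: "set (branch A w) = same_label n r" using G[OF w(1)] by blast
    obtain W where W: "card (sym_diff E (label_graph n (refined_label n ?bs [0..<n] W))) \<le> k"
       "edge_dist {..<n} (label_graph n (refined_label n ?bs [0..<n] W)) Ec \<le> d"
      using w(2) unfolding ref[OF w(1)] by blast
    have "same_label n (refined_label n ?bs [0..<n] W) \<subseteq> set (branch A w)"
    proof
      fix p assume p: "p \<in> same_label n (refined_label n ?bs [0..<n] W)"
      obtain u v where uv: "p = (u, v)" by (cases p)
      have "u < n" "v < n" "u \<noteq> v" "at ?bs u = at ?bs v"
        using p unfolding uv same_label_def refined_label_def by auto
      then show "p \<in> set (branch A w)" using cluster_reps_eq(1)[OF r, of u v] unfolding r uv same_label_def by simp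
    qed
    also have "\<dots> \<subseteq> arcs E" using foldl_branch_subset[of A "spine w"] unfolding branch_def A .
    finally have "label_graph n (refined_label n ?bs [0..<n] W) \<subseteq> E" unfolding label_graph_subset_iff .
    then show "dc_deletion edge_dist {..<n} E Ec k d"
      unfolding dc_deletion_def using W cluster_graph_label_graph by blast
  next
    assume "dc_deletion edge_dist {..<n} E Ec k d"
    then obtain E' where E': "cluster_graph {..<n} E'" "E' \<subseteq> E" "card (sym_diff E E') \<le> k" "edge_dist {..<n} E' Ec \<le> d"
      unfolding dc_deletion_def by blast
    obtain l :: "nat \<Rightarrow> nat" where l: "E' = label_graph n l" using cluster_graph_obtain_label[OF E'(1)] .
    have sub: "same_label n l \<subseteq> set A"
      using E'(2) unfolding l A label_graph_subset_iff .
    have del: "card (sym_diff (arcs E) (same_label n l)) \<le> 2 * k"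
      using E'(3) unfolding l card_sym_diff_arcs[OF E simple_label_graph] arcs_label_graph .
    have "card (set A - same_label n l) \<le> 2 * k"
      using del sub unfolding A by (simp add: Diff_eq_empty_iff[THEN iffD2])
    then obtain ts where ts: "length ts \<le> k" "set ts \<subseteq> {Leaf, Node Leaf Leaf}"
       "induced_paths (foldl branch_step A ts) = []" "same_label n l \<subseteq> set (foldl branch_step A ts)"
      using branch_exists[OF symA sub] by blast
    let ?w = "repr ts"
    have br: "branch A ?w = foldl branch_step A ts" by (simp add: branch_def)
    have w: "induced_paths (branch A ?w) = []" using ts(3) br by simp
    have "height ?w \<le> length ts + 1" by (rule height_repr_list) (use ts(2) in auto)
    then have "?w \<in> set U" using ts(1) by (intro U) simp
    let ?bs = "cluster_reps n (branch A ?w)"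
    obtain r :: "nat \<Rightarrow> nat set" where r: "set (branch A ?w) = same_label n r" using G[OF w] by blast
    have bs: "at ?bs u = at ?bs v \<longleftrightarrow> (u, v) \<in> set (branch A ?w)" if "u < n" "v < n" "u \<noteq> v" for u v
      using cluster_reps_eq(1)[OF r that(1,2)] that unfolding r same_label_def by simp
    have subA: "set (branch A ?w) \<subseteq> arcs E" using foldl_branch_subset[of A ts] unfolding br A .
    obtain W where W: "\<And>b. W b \<in> set U"
       "same_label n (refined_label n ?bs [0..<n] W) = {(u, v). (u, v) \<in> same_label n l \<and> at ?bs u = at ?bs v}"
    proof (rule refined_label_exists[of n ?bs "[0..<n]" l "2 * k" U])
      show "l u = l v" if "u < n" "v < n" "at ?bs u = at ?bs v" "at [0..<n] u = at [0..<n] v" for u v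
        using that by (simp add: nth_or_eq)
      show "card (at [0..<n] ` {w. w < n \<and> at ?bs w = at ?bs v}) \<le> 2 * k"
        if uv: "u < n" "v < n" "at ?bs u = at ?bs v" "l u \<noteq> l v" for u v
      proof (rule card_le_touching[OF _ del])
        show "finite (sym_diff (arcs E) (same_label n l))"
          using finite_arcs[OF E] finite_arcs[OF simple_label_graph, of n l] by (simp add: arcs_label_graph)
        fix w assume w: "w \<in> {w. w < n \<and> at ?bs w = at ?bs v}"
        then obtain x where x: "x < n" "at ?bs x = at ?bs w" "l w \<noteq> l x" using uv by (cases "l w = l v") auto
        then have "(w, x) \<in> arcs E" using bs[of w x] subA w by auto
        moreover have "(w, x) \<notin> same_label n l" using x by (simp add: same_label_def)
        ultimately show "\<exists>w' x. (w', x) \<in> sym_diff (arcs E) (same_label n l) \<and> at [0..<n] w' = at [0..<n] w" by blast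
      qed
      show "t \<in> set U" if "height t \<le> 2 * (2 * k)" for t using that by (intro U) simp
    qed (rule that)
    \<comment> \<open>The branching chosen here keeps every edge of the target, so the clusters of
      the target lie inside blocks and restricting it to blocks changes nothing.\<close>
    have "at ?bs u = at ?bs v" if "(u, v) \<in> same_label n l" for u v
      using that ts(4) bs[of u v] unfolding br same_label_def by auto
    then have "same_label n (refined_label n ?bs [0..<n] W) = same_label n l" unfolding W(2) by auto
    then have "label_graph n (refined_label n ?bs [0..<n] W) = E'" unfolding l label_graph_def by simp
    then have "refinable n A B ?bs [0..<n] U (2 * min (n * n) k) (2 * min (n * n) d)"
      unfolding ref[OF w] using W(1) E'(3,4) by (intro exI[of _ W]) simp
    then show "deletion_alg n A B (min (n * n) d) (min (n * n) k) U"
      unfolding deletion_alg_def using w \<open>?w \<in> set U\<close> by blast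
  qed
qed

subsection \<open>Completion with the edge distance\<close>

lemma at_merge: "u < length M \<Longrightarrow> at (merge M p) u = (if at M u = at M (snd p) then at M (fst p) else at M u)"
  by (simp add: merge_def nth_or_eq)

lemma component_labels_edge:
  assumes "\<And>u v. (u, v) \<in> set A \<Longrightarrow> u < n \<and> v < n" "(u, v) \<in> set A"
  shows "at (component_labels n A) u = at (component_labels n A) v"
  using assms
proof (induction A rule: rev_induct)
  case (snoc p A)
  let ?M = "component_labels n A"
  have M: "component_labels n (A @ [p]) = merge ?M p" by (simp add: component_labels_def)
  have len: "length ?M = n" unfolding component_labels_def by (rule component_labels_bound)
  have uv: "u < n" "v < n" using snoc.prems by blast+
  show ?case
  proof (cases "(u, v) = p")
    case True
    then have "fst p = u" "snd p = v" by auto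
    then show ?thesis unfolding M using uv by (simp add: at_merge len)
  next
    case False
    then have "at ?M u = at ?M v" using snoc.prems by (intro snoc.IH) auto
    then show ?thesis using uv unfolding M by (simp add: at_merge len)
  qed
qed simp

text \<open>\<open>l\<close> stands for an arbitrary cluster graph containing the arcs; as it is
  constant on the computed classes, these are no coarser than the connected components.\<close>

lemma component_labels_finest:
  assumes "\<And>u v. (u, v) \<in> set A \<Longrightarrow> u < n \<and> v < n \<and> l u = l v"
    and "u < n" "v < n" "at (component_labels n A) u = at (component_labels n A) v"
  shows "l u = l v"
  using assms
proof (induction A arbitrary: u v rule: rev_induct)
  case Nil
  then show ?case by (simp add: component_labels_def nth_or_eq)
next
  case (snoc p A)
  let ?M = "component_labels n A"
  have M: "component_labels n (A @ [p]) = merge ?M p" by (simp add: component_labels_def)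
  have len: "length ?M = n" unfolding component_labels_def by (rule component_labels_bound)
  have IH: "l x = l y" if "x < n" "y < n" "at ?M x = at ?M y" for x y
    using snoc.IH[of x y] snoc.prems(1) that by auto
  obtain a b where p: "p = (a, b)" by (cases p)
  have ab: "a < n" "b < n" "l a = l b" using snoc.prems(1)[of a b] unfolding p by simp_all
  have eq: "(if at ?M u = at ?M b then at ?M a else at ?M u) = (if at ?M v = at ?M b then at ?M a else at ?M v)"
    using snoc.prems(2-4) unfolding M by (simp only: at_merge len p fst_conv snd_conv cong: if_cong)
  show ?case
    using eq IH[of u b] IH[of v b] IH[of u a] IH[of v a] IH[of u v] ab snoc.prems(2,3)
    by (cases "at ?M u = at ?M b"; cases "at ?M v = at ?M b") simp_all
qed

lemma bex_upt: "(\<exists>u\<in>set [0..<n]. P u) \<longleftrightarrow> (\<exists>u<n. P u)"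
  by auto

text \<open>Blocks are unions of components (\<open>bs_L\<close>) and also of clusters of
  \<open>G\<^sub>c\<close> (\<open>bs_C\<close>). Separating the blocks in a solution therefore
  loses no edge of \<open>G\<close> and no pair of \<open>G\<^sub>c\<close>, so neither cost grows,
  and some solution respects the blocks whenever there is one at all.\<close>

lemma completion_edge_alg_iff:
  assumes E: "simple_graph {..<n} E" and Ec: "cluster_graph {..<n} Ec"
    and A: "set A = arcs E" and B: "set B = arcs Ec"
    and U: "\<And>t. height t \<le> 4 * d \<Longrightarrow> t \<in> set U"
  shows "completion_edge_alg n A B (min (n * n) k) (min (n * n) d) U \<longleftrightarrow> dc_completion edge_dist {..<n} E Ec k d"
proof -
  note Ec' = cluster_graph_imp_simple_graph[OF Ec]
  have Aw: "(u, v) \<in> set A \<Longrightarrow> u < n \<and> v < n \<and> u \<noteq> v" for u v using arcs_simple[OF E] A by blast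
  obtain lc :: "nat \<Rightarrow> nat" where lc: "Ec = label_graph n lc" using cluster_graph_obtain_label[OF Ec] .
  have Blc: "set B = same_label n lc" unfolding B lc by (rule arcs_label_graph)
  let ?L = "component_labels n A" let ?C = "cluster_reps n B" let ?bs = "entangled_blocks n ?L ?C"
  have C: "at ?C u = at ?C v \<longleftrightarrow> lc u = lc v" if "u < n" "v < n" for u v
    using cluster_reps_eq(1)[OF Blc that] .
  have C_less: "at ?C v < n" if "v < n" for v using cluster_reps_eq(2)[OF Blc that that] .
  have bs: "at ?bs v = (if entangled n ?L ?C v then 0 else Suc (at ?C v))" if "v < n" for v
    using that by (simp add: entangled_blocks_def nth_or_eq)
  have imp: "impure n ?L ?C v \<longleftrightarrow> (\<exists>u<n. at ?L u = at ?L v \<and> at ?C u \<noteq> at ?C v)" for v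
    unfolding impure_def bex_upt ..
  have ent: "entangled n ?L ?C v \<longleftrightarrow> (\<exists>v'<n. at ?L v' = at ?L v \<and> (\<exists>u<n. at ?C u = at ?C v' \<and> impure n ?L ?C u))" for v
    unfolding entangled_def bex_upt ..
  have bs_L: "at ?bs u = at ?bs v" if uv: "u < n" "v < n" "at ?L u = at ?L v" for u v
  proof -
    have "entangled n ?L ?C u \<longleftrightarrow> entangled n ?L ?C v" unfolding ent uv(3) ..
    moreover have "at ?C u = at ?C v" if "\<not> entangled n ?L ?C v"
    proof (rule ccontr)
      assume "at ?C u \<noteq> at ?C v"
      then have "impure n ?L ?C v" unfolding imp using uv by blast
      then have "entangled n ?L ?C v" unfolding ent using uv(2) by blast
      with that show False by simp
    qed
    ultimately show ?thesis using bs uv by simp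
  qed
  have bs_C: "at ?bs u = at ?bs v" if uv: "u < n" "v < n" "at ?C u = at ?C v" for u v
  proof -
    have "entangled n ?L ?C u" if "entangled n ?L ?C v" "u < n" "v < n" "at ?C u = at ?C v" for u v
    proof (cases "impure n ?L ?C v")
      case True
      have "at ?C v = at ?C u" using that(4) by simp
      with True that(2,3) show ?thesis unfolding ent[of u] by blast
    next
      case False
      obtain v' x where x: "v' < n" "at ?L v' = at ?L v" "x < n" "at ?C x = at ?C v'" "impure n ?L ?C x"
        using \<open>entangled n ?L ?C v\<close> unfolding ent by blast
      then have "at ?C v' = at ?C v" using False unfolding imp by blast
      then have "at ?C x = at ?C u" using x that(4) by simp
      with x that(2) show ?thesis unfolding ent[of u] by blast
    qed
    from this[of u v] this[of v u] show ?thesis using bs uv by (cases "entangled n ?L ?C u") auto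
  qed
  have bs_le: "at ?bs v \<le> n" if "v < n" for v using bs[OF that] C_less[OF that] by simp
  have ref: "completion_edge_alg n A B (min (n * n) k) (min (n * n) d) U \<longleftrightarrow>
    (\<exists>W. (\<forall>b\<le>n. W b \<in> set U) \<and> card (sym_diff E (label_graph n (refined_label n ?bs ?L W))) \<le> k \<and>
      edge_dist {..<n} (label_graph n (refined_label n ?bs ?L W)) Ec \<le> d)"
    unfolding completion_edge_alg_def by (rule refinable_arcs_iff[OF E Ec' A B bs_le])
  show ?thesis
  proof
    assume "completion_edge_alg n A B (min (n * n) k) (min (n * n) d) U"
    then obtain W where W: "card (sym_diff E (label_graph n (refined_label n ?bs ?L W))) \<le> k"
       "edge_dist {..<n} (label_graph n (refined_label n ?bs ?L W)) Ec \<le> d"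
      unfolding ref by blast
    have "arcs E \<subseteq> same_label n (refined_label n ?bs ?L W)"
    proof
      fix p assume p: "p \<in> arcs E"
      obtain u v where uv: "p = (u, v)" by (cases p)
      have "(u, v) \<in> set A" using p uv A by simp
      then have n: "u < n" "v < n" "u \<noteq> v" and L: "at ?L u = at ?L v"
        using Aw component_labels_edge[of A n u v] by blast+
      have "at ?bs u = at ?bs v" by (rule bs_L[OF n(1,2) L])
      then have "refined_label n ?bs ?L W u = refined_label n ?bs ?L W v"
        unfolding refined_label_def cert_label_def group_rank_def L by simp
      then show "p \<in> same_label n (refined_label n ?bs ?L W)" unfolding uv same_label_def using n by simp
    qed
    then have "E \<subseteq> label_graph n (refined_label n ?bs ?L W)"
      using arcs_mono_iff[OF E] by (simp add: arcs_label_graph)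
    then show "dc_completion edge_dist {..<n} E Ec k d"
      unfolding dc_completion_def using W cluster_graph_label_graph by blast
  next
    assume "dc_completion edge_dist {..<n} E Ec k d"
    then obtain E' where E': "cluster_graph {..<n} E'" "E \<subseteq> E'" "card (sym_diff E E') \<le> k" "edge_dist {..<n} E' Ec \<le> d"
      unfolding dc_completion_def by blast
    obtain l :: "nat \<Rightarrow> nat" where l: "E' = label_graph n l" using cluster_graph_obtain_label[OF E'(1)] .
    have sub: "arcs E \<subseteq> same_label n l"
      using E'(2) arcs_mono_iff[OF E] unfolding l by (simp add: arcs_label_graph)
    have del: "card (sym_diff (arcs Ec) (same_label n l)) \<le> 2 * d"
      using E'(4) card_sym_diff_arcs[OF Ec' simple_label_graph, of l d]
      unfolding l edge_dist_def arcs_label_graph by (simp add: Un_commute)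
    have fin: "finite (sym_diff (arcs Ec) (same_label n l))"
      using finite_arcs[OF Ec'] finite_arcs[OF simple_label_graph, of n l] by (simp add: arcs_label_graph)
    have L: "l u = l v" if "u < n" "v < n" "at ?L u = at ?L v" for u v
      by (rule component_labels_finest[OF _ that]) (use sub A in \<open>auto simp: same_label_def\<close>)
    have arcsEc: "(u, v) \<in> arcs Ec \<longleftrightarrow> u < n \<and> v < n \<and> u \<noteq> v \<and> at ?C u = at ?C v" for u v
      using C[of u v] Blc B unfolding same_label_def by auto
    have touch: "(u, v) \<in> sym_diff (arcs Ec) (same_label n l)"
      if "u < n" "v < n" "(at ?C u = at ?C v) \<noteq> (l u = l v)" for u v
      using that arcsEc[of u v] unfolding same_label_def by auto
    obtain W where W: "\<And>b. W b \<in> set U"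
       "same_label n (refined_label n ?bs ?L W) = {(u, v). (u, v) \<in> same_label n l \<and> at ?bs u = at ?bs v}"
    proof (rule refined_label_exists[of n ?bs ?L l "2 * d" U])
      show "l u = l v" if "u < n" "v < n" "at ?bs u = at ?bs v" "at ?L u = at ?L v" for u v
        using L that by blast
      show "card (at ?L ` {w. w < n \<and> at ?bs w = at ?bs v}) \<le> 2 * d"
        if uv: "u < n" "v < n" "at ?bs u = at ?bs v" "l u \<noteq> l v" for u v
      proof (rule card_le_touching[OF fin del])
        fix w assume "w \<in> {w. w < n \<and> at ?bs w = at ?bs v}"
        then have w: "w < n" "at ?bs w = at ?bs v" by simp_all
        show "\<exists>w' x. (w', x) \<in> sym_diff (arcs Ec) (same_label n l) \<and> at ?L w' = at ?L w"
        proof (cases "entangled n ?L ?C w")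
          case False
          \<comment> \<open>Here the block is a single cluster of \<open>G\<^sub>c\<close>, so a
            vertex of it with another label is joined to \<open>w\<close> in
            \<open>G\<^sub>c\<close> but not in the solution.\<close>
          obtain x where x: "x < n" "at ?bs x = at ?bs w" "l w \<noteq> l x" using uv w by (cases "l w = l v") auto
          have "at ?C x = at ?C w" using x(2) bs[OF x(1)] bs[OF w(1)] False by (simp split: if_splits)
          then have "(w, x) \<in> sym_diff (arcs Ec) (same_label n l)" using touch[OF w(1) x(1)] x(3) by simp
          then show ?thesis by blast
        next
          case True
          then obtain v' x where x: "v' < n" "at ?L v' = at ?L w" "x < n" "at ?C x = at ?C v'" "impure n ?L ?C x"
            unfolding ent by blast
          then obtain y where y: "y < n" "at ?L y = at ?L x" "at ?C y \<noteq> at ?C x" unfolding imp by blast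
          have lxy: "l y = l x" using L[OF y(1) x(3) y(2)] .
          \<comment> \<open>The solution has \<open>x\<close> and \<open>y\<close> in one cluster,
            so it joins \<open>v'\<close> to both or to neither; \<open>G\<^sub>c\<close> puts
            \<open>v'\<close> into the cluster of \<open>x\<close> but not into that of
            \<open>y\<close>. The two graphs thus differ at one of these pairs.\<close>
          have "\<exists>z. (v', z) \<in> sym_diff (arcs Ec) (same_label n l)"
          proof (cases "l v' = l x")
            case True
            have "(v', y) \<in> sym_diff (arcs Ec) (same_label n l)"
              by (rule touch[OF x(1) y(1)]) (use True lxy y(3) x(4) in simp)
            then show ?thesis by blast
          next
            case False
            have "(v', x) \<in> sym_diff (arcs Ec) (same_label n l)"
              by (rule touch[OF x(1,3)]) (use False x(4) in simp)
            then show ?thesis by blast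
          qed
          then show ?thesis using x(2) by blast
        qed
      qed
      show "t \<in> set U" if "height t \<le> 2 * (2 * d)" for t using that by (intro U) simp
    qed (rule that)
    let ?R = "refined_label n ?bs ?L W" let ?S = "same_label n ?R"
    have sub1: "?S \<subseteq> same_label n l" unfolding W(2) by auto
    have sub2: "arcs E \<subseteq> ?S"
    proof
      fix p assume p: "p \<in> arcs E"
      obtain u v where uv: "p = (u, v)" by (cases p)
      have "(u, v) \<in> set A" using p uv A by simp
      then have "u < n" "v < n" "at ?L u = at ?L v" using Aw component_labels_edge[of A n u v] by blast+
      then have "at ?bs u = at ?bs v" by (rule bs_L)
      then show "p \<in> ?S" using p sub unfolding W(2) uv by blast
    qed
    have sub3: "arcs Ec - ?S \<subseteq> arcs Ec - same_label n l"
    proof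
      fix p assume p: "p \<in> arcs Ec - ?S"
      obtain u v where uv: "p = (u, v)" by (cases p)
      have "at ?bs u = at ?bs v" using p unfolding uv using arcsEc bs_C by blast
      then show "p \<in> arcs Ec - same_label n l" using p unfolding W(2) uv by blast
    qed
    have "card (sym_diff E (label_graph n ?R)) \<le> card (sym_diff E E')"
      by (rule card_sym_diff_mono[OF E simple_label_graph]) (use sub1 sub2 in \<open>simp_all add: l arcs_label_graph simple_label_graph, blast\<close>)
    moreover have "card (sym_diff Ec (label_graph n ?R)) \<le> card (sym_diff Ec E')"
      by (rule card_sym_diff_mono[OF Ec' simple_label_graph]) (use sub1 sub3 in \<open>simp_all add: l arcs_label_graph simple_label_graph, blast\<close>)
    ultimately show "completion_edge_alg n A B (min (n * n) k) (min (n * n) d) U"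
      unfolding ref using W(1) E'(3,4) by (intro exI[of _ W]) (simp add: edge_dist_def Un_commute)
  qed
qed

subsection \<open>Completion with the matching distance\<close>

lemma label_class_eq: "X \<in> label_classes n l \<Longrightarrow> u \<in> X \<Longrightarrow> X = {w. w < n \<and> l w = l u}"
  unfolding label_classes_def by auto

text \<open>The vertices counted by a matching are a set on which both graphs coincide, and vice versa.\<close>

lemma matching_dist_le_iff:
  "matching_dist {..<n} (label_graph n l) (label_graph n c) \<le> d \<longleftrightarrow>
    (\<exists>S. S \<subseteq> {..<n} \<and> card ({..<n} - S) \<le> d \<and> (\<forall>u\<in>S. \<forall>v\<in>S. l u = l v \<longleftrightarrow> c u = c v))"
proof -
  let ?P = "label_classes n l" let ?Q = "label_classes n c"
  let ?X = "{overlap_weight M |M. bip_matching ?P ?Q M}"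
  have "?X \<subseteq> {..n}"
    using overlap_weight_le[OF _ partition_label_classes partition_label_classes, of n l c] by auto
  then have fin: "finite ?X" by (rule finite_subset) simp
  have "bip_matching ?P ?Q {}" by (simp add: bip_matching_def)
  then have ne: "?X \<noteq> {}" by blast
  have dist: "matching_dist {..<n} (label_graph n l) (label_graph n c) \<le> d \<longleftrightarrow> n \<le> Max ?X + d"
    unfolding matching_dist_def clusters_label_graph by (simp add: le_diff_conv add.commute)
  have finM: "finite M" if "bip_matching ?P ?Q M" for M
  proof (rule finite_subset)
    show "M \<subseteq> ?P \<times> ?Q" using that by (simp add: bip_matching_def)
    show "finite (?P \<times> ?Q)" by (simp add: label_classes_def)
  qed
  show ?thesis
    unfolding dist
  proof
    assume le: "n \<le> Max ?X + d"
    have "Max ?X \<in> ?X" by (rule Max_in[OF fin ne])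
    then obtain M where M: "bip_matching ?P ?Q M" "Max ?X = overlap_weight M" by blast
    have PQ: "fst p \<in> ?P" "snd p \<in> ?Q" if "p \<in> M" for p using M(1) that unfolding bip_matching_def by auto
    have inj: "inj_on fst M" "inj_on snd M" using M(1) unfolding bip_matching_def by simp_all
    let ?S = "\<Union>p\<in>M. fst p \<inter> snd p"
    \<comment> \<open>A matching is injective on both sides, so two counted vertices share a cluster
      in either graph exactly if they are counted by the same pair.\<close>
    have agree: "(l u = l v \<longleftrightarrow> p = q) \<and> (c u = c v \<longleftrightarrow> p = q)"
      if "p \<in> M" "q \<in> M" "u \<in> fst p \<inter> snd p" "v \<in> fst q \<inter> snd q" for p q u v
    proof -
      have 1: "fst p = {w. w < n \<and> l w = l u}" "fst q = {w. w < n \<and> l w = l v}"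
        "snd p = {w. w < n \<and> c w = c u}" "snd q = {w. w < n \<and> c w = c v}"
        using label_class_eq PQ that by blast+
      have "p = q" if "l u = l v"
        by (rule inj_onD[OF inj(1) _ \<open>p \<in> M\<close> \<open>q \<in> M\<close>]) (simp only: 1 that)
      moreover have "p = q" if "c u = c v"
        by (rule inj_onD[OF inj(2) _ \<open>p \<in> M\<close> \<open>q \<in> M\<close>]) (simp only: 1 that)
      moreover have "l u = l v" "c u = c v" if "p = q"
        using \<open>u \<in> fst p \<inter> snd p\<close> unfolding that 1 by auto
      ultimately show ?thesis by blast
    qed
    have sub: "fst p \<subseteq> {..<n}" if "p \<in> M" for p using PQ(1)[OF that] by (auto simp: label_classes_def)
    have "card ?S = (\<Sum>p\<in>M. card (fst p \<inter> snd p))"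
    proof (rule card_UN_disjoint[OF finM[OF M(1)]])
      show "\<forall>p\<in>M. finite (fst p \<inter> snd p)"
        using finite_subset[OF sub] finite_lessThan by blast
      show "\<forall>p\<in>M. \<forall>q\<in>M. p \<noteq> q \<longrightarrow> fst p \<inter> snd p \<inter> (fst q \<inter> snd q) = {}"
      proof (intro ballI impI equals0I)
        fix p q u assume "p \<in> M" "q \<in> M" "p \<noteq> q" "u \<in> fst p \<inter> snd p \<inter> (fst q \<inter> snd q)"
        then show False using agree[of p q u u] by blast
      qed
    qed
    then have "card ?S = overlap_weight M" unfolding overlap_weight_def case_prod_beta .
    then have card: "card ?S = Max ?X" using M(2) by (rule trans[OF _ sym])
    have "?S \<subseteq> {..<n}" using sub by blast
    then have "card ({..<n} - ?S) = n - card ?S" using card_Diff_subset[of ?S "{..<n}"] finite_subset[of ?S "{..<n}"] by simp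
    then have "card ({..<n} - ?S) \<le> d" using le card by simp
    moreover have "\<forall>u\<in>?S. \<forall>v\<in>?S. l u = l v \<longleftrightarrow> c u = c v"
    proof (intro ballI)
      fix u v assume "u \<in> ?S" "v \<in> ?S"
      then obtain p q where "p \<in> M" "q \<in> M" "u \<in> fst p \<inter> snd p" "v \<in> fst q \<inter> snd q" by blast
      from agree[OF this] show "l u = l v \<longleftrightarrow> c u = c v" by blast
    qed
    ultimately show "\<exists>S. S \<subseteq> {..<n} \<and> card ({..<n} - S) \<le> d \<and> (\<forall>u\<in>S. \<forall>v\<in>S. l u = l v \<longleftrightarrow> c u = c v)"
      using \<open>?S \<subseteq> {..<n}\<close> by (intro exI[of _ ?S] conjI)
  next
    assume "\<exists>S. S \<subseteq> {..<n} \<and> card ({..<n} - S) \<le> d \<and> (\<forall>u\<in>S. \<forall>v\<in>S. l u = l v \<longleftrightarrow> c u = c v)"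
    then obtain S where S: "S \<subseteq> {..<n}" "card ({..<n} - S) \<le> d" "\<And>u v. u \<in> S \<Longrightarrow> v \<in> S \<Longrightarrow> l u = l v \<longleftrightarrow> c u = c v"
      by blast
    \<comment> \<open>Every vertex of \<open>S\<close> contributes the pair of its clusters in the
      two graphs; agreement on \<open>S\<close> makes these pairs a matching.\<close>
    let ?m = "\<lambda>u. ({w. w < n \<and> l w = l u}, {w. w < n \<and> c w = c u})"
    let ?M = "?m ` S"
    have ul: "{w. w < n \<and> l w = l u} = {w. w < n \<and> l w = l v} \<Longrightarrow> l u = l v" if "u \<in> S" for u v
      using that S(1) by blast
    have uc: "{w. w < n \<and> c w = c u} = {w. w < n \<and> c w = c v} \<Longrightarrow> c u = c v" if "u \<in> S" for u v
      using that S(1) by blast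
    have M: "bip_matching ?P ?Q ?M"
      unfolding bip_matching_def
    proof (intro conjI inj_onI)
      show "?M \<subseteq> ?P \<times> ?Q" using S(1) by (auto simp: label_classes_def)
      fix p q assume "p \<in> ?M" "q \<in> ?M"
      then obtain u v where uv: "u \<in> S" "v \<in> S" "p = ?m u" "q = ?m v" by blast
      have *: "p = q" if "l u = l v" "c u = c v" unfolding uv(3,4) that ..
      show "p = q" if "fst p = fst q"
        using * ul[OF uv(1), of v] S(3)[OF uv(1,2)] that unfolding uv(3,4) fst_conv by blast
      show "p = q" if "snd p = snd q"
        using * uc[OF uv(1), of v] S(3)[OF uv(1,2)] that unfolding uv(3,4) snd_conv by blast
    qed
    have "S \<subseteq> (\<Union>p\<in>?M. fst p \<inter> snd p)" using S(1) by auto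
    moreover have "finite (\<Union>p\<in>?M. fst p \<inter> snd p)"
      by (rule finite_subset[of _ "{..<n}"]) auto
    ultimately have "card S \<le> card (\<Union>p\<in>?M. fst p \<inter> snd p)" by (rule card_mono[rotated])
    also have "\<dots> \<le> (\<Sum>p\<in>?M. card (fst p \<inter> snd p))" by (rule card_UN_le[OF finM[OF M]])
    also have "\<dots> = overlap_weight ?M" unfolding overlap_weight_def case_prod_beta ..
    also have "\<dots> \<le> Max ?X" using M by (intro Max_ge[OF fin]) blast
    finally have "card S \<le> Max ?X" .
    moreover have "n - card S \<le> d"
      using S(1,2) card_Diff_subset[of S "{..<n}"] finite_subset[of S "{..<n}"] by simp
    ultimately show "n \<le> Max ?X + d" by linarith
  qed
qed

text \<open>The completion contains \<open>E\<close>, so bounding the difference amounts to bounding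
  the number of pairs of the completion, and this number is a sum over its clusters.\<close>

lemma completion_budget_iff:
  assumes E: "simple_graph {..<n} E" and sub: "arcs E \<subseteq> same_label n l"
  shows "card (sym_diff E (label_graph n l)) \<le> k \<longleftrightarrow> card (same_label n l) \<le> 2 * k + card (arcs E)"
proof -
  have fin: "finite (same_label n l)" using finite_subset[OF same_label_subset] by simp
  have "sym_diff (arcs E) (same_label n l) = same_label n l - arcs E" using sub by blast
  then have "card (sym_diff (arcs E) (same_label n l)) = card (same_label n l) - card (arcs E)"
    using card_Diff_subset[OF finite_arcs[OF E] sub] by simp
  moreover have "card (arcs E) \<le> card (same_label n l)" by (rule card_mono[OF fin sub])
  ultimately show ?thesis
    unfolding card_sym_diff_arcs[OF E simple_label_graph] arcs_label_graph by linarith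
qed

lemma subset_label_graph_iff: "simple_graph {..<n} E \<Longrightarrow> E \<subseteq> label_graph n l \<longleftrightarrow> arcs E \<subseteq> same_label n l"
  using arcs_mono_iff[of "{..<n}" E "label_graph n l"] unfolding arcs_label_graph .

lemma completion_matchingI:
  assumes "simple_graph {..<n} E" "S \<subseteq> {..<n}" "arcs E \<subseteq> same_label n l"
    "card (same_label n l) \<le> 2 * k + card (arcs E)" "card ({..<n} - S) \<le> d"
    "\<And>u v. u \<in> S \<Longrightarrow> v \<in> S \<Longrightarrow> l u = l v \<longleftrightarrow> c u = c v"
  shows "dc_completion matching_dist {..<n} E (label_graph n c) k d"
  unfolding dc_completion_def
proof (intro exI[of _ "label_graph n l"] conjI)
  show "E \<subseteq> label_graph n l" using assms subset_label_graph_iff by blast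
  show "card (sym_diff E (label_graph n l)) \<le> k" using assms completion_budget_iff by blast
  show "matching_dist {..<n} (label_graph n l) (label_graph n c) \<le> d"
    unfolding matching_dist_le_iff by (intro exI[of _ S] conjI ballI assms)
qed (rule cluster_graph_label_graph)

lemma completion_matchingE:
  assumes "simple_graph {..<n} E" "dc_completion matching_dist {..<n} E (label_graph n c) k d"
  obtains l :: "nat \<Rightarrow> nat" and S where "S \<subseteq> {..<n}" "arcs E \<subseteq> same_label n l"
    "card (same_label n l) \<le> 2 * k + card (arcs E)" "card ({..<n} - S) \<le> d"
    "\<And>u v. u \<in> S \<Longrightarrow> v \<in> S \<Longrightarrow> l u = l v \<longleftrightarrow> c u = c v"
proof -
  obtain E' where E': "cluster_graph {..<n} E'" "E \<subseteq> E'" "card (sym_diff E E') \<le> k"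
     "matching_dist {..<n} E' (label_graph n c) \<le> d"
    using assms(2) unfolding dc_completion_def by blast
  obtain l :: "nat \<Rightarrow> nat" where l: "E' = label_graph n l" using cluster_graph_obtain_label[OF E'(1)] .
  have sub: "arcs E \<subseteq> same_label n l" using E'(2) unfolding l subset_label_graph_iff[OF assms(1)] .
  have bud: "card (same_label n l) \<le> 2 * k + card (arcs E)"
    using E'(3) unfolding l completion_budget_iff[OF assms(1) sub] .
  obtain S where "S \<subseteq> {..<n}" "card ({..<n} - S) \<le> d" "\<forall>u\<in>S. \<forall>v\<in>S. l u = l v \<longleftrightarrow> c u = c v"
    using E'(4) unfolding l matching_dist_le_iff by blast
  with sub bud show ?thesis by (intro that[of S l]) blast+
qed

section \<open>The nested knapsack\<close>

lemma card_fibres: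
  assumes "finite X" "finite T" "f ` X \<subseteq> T" "\<And>t. t \<in> T \<Longrightarrow> card {x \<in> X. f x = t} = h t"
  shows "card X = sum h T"
  using sum.group[OF assms(1-3), of "\<lambda>_. 1 :: nat"] assms(4) by simp

context
  fixes n :: nat and L C :: "nat list" and w :: tree
begin

text \<open>A run of both knapsacks is summarised by one predicate \<open>K\<close>, true on the
  components that join the cluster of their representative.\<close>

definition component_choice :: "(nat \<Rightarrow> bool) \<Rightarrow> nat \<Rightarrow> nat \<times> nat \<times> nat" where
  "component_choice K g = component_choices n L C w g ! (if K g then 0 else 1)"

definition assigned :: "nat \<Rightarrow> nat set" where
  "assigned c = {g. g < n \<and> at C (representative n L C w g) = c}"

definition cluster_sum :: "(nat \<Rightarrow> bool) \<Rightarrow> nat \<Rightarrow> nat \<times> nat \<times> nat" where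
  "cluster_sum K c = vsum (component_choice K) (assigned c)"

definition unmatched_total :: "(nat \<Rightarrow> bool) \<Rightarrow> nat" where
  "unmatched_total K = (\<Sum>c\<in>{0..<n}. fst (snd (cluster_sum K c)))"

definition pairs_total :: "(nat \<Rightarrow> bool) \<Rightarrow> nat" where
  "pairs_total K = (\<Sum>c\<in>{0..<n}. fst (cluster_sum K c) * fst (cluster_sum K c) +
     snd (snd (cluster_sum K c)))"

lemma set_cluster_choices:
  "v \<in> set (cluster_choices n L C w c) \<longleftrightarrow> (\<exists>K. cluster_sum K c \<in> set (grid (n * n)) \<and>
     v = (fst (snd (cluster_sum K c)),
       fst (cluster_sum K c) * fst (cluster_sum K c) + snd (snd (cluster_sum K c)), 0))"
proof -
  let ?is = "filter (\<lambda>g. at C (representative n L C w g) = c) [0..<n]"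
  have "set ?is = assigned c" by (auto simp: assigned_def)
  note knap = set_knapsack[of ?is _ "n * n" "component_choices n L C w", unfolded this]
  have kept: "component_choice K g \<in> set (component_choices n L C w g)" for K g
    by (simp add: component_choice_def component_choices_def)
  have choice: "u \<in> set (knapsack (n * n) (map (component_choices n L C w) ?is)) \<longleftrightarrow>
     (\<exists>K. u \<in> set (grid (n * n)) \<and> u = cluster_sum K c)" for u
  proof
    assume "u \<in> set (knapsack (n * n) (map (component_choices n L C w) ?is))"
    then obtain ch where u: "u \<in> set (grid (n * n))"
       "\<forall>g\<in>assigned c. ch g \<in> set (component_choices n L C w g)" "u = vsum ch (assigned c)"
      using knap[of u] by auto
    define K where "K g \<longleftrightarrow> ch g = component_choices n L C w g ! 0" for g
    have "component_choice K g = ch g" if "g \<in> assigned c" for g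
      using u(2) that unfolding component_choice_def K_def component_choices_def by auto
    then have "vsum ch (assigned c) = cluster_sum K c"
      unfolding cluster_sum_def by (intro vsum_cong) simp
    then show "\<exists>K. u \<in> set (grid (n * n)) \<and> u = cluster_sum K c" using u by metis
  next
    assume "\<exists>K. u \<in> set (grid (n * n)) \<and> u = cluster_sum K c"
    then obtain K where u: "u \<in> set (grid (n * n))" "u = cluster_sum K c" by blast
    have "\<exists>ch. (\<forall>g\<in>assigned c. ch g \<in> set (component_choices n L C w g)) \<and> u = vsum ch (assigned c)"
      by (rule exI[of _ "component_choice K"]) (use kept u(2) in \<open>simp add: cluster_sum_def\<close>)
    then show "u \<in> set (knapsack (n * n) (map (component_choices n L C w) ?is))" using knap[of u] u(1) by simp
  qed
  show ?thesis unfolding cluster_choices_def set_map image_iff Bex_def choice by metis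
qed

text \<open>Each cluster brings its own predicate; these can be glued, as a component is assigned to
  one cluster only. Conversely the bounds on the totals keep the inner sums in the grid, a size
  being at most its square.\<close>

lemma completion_knapsack_iff:
  assumes bounds: "\<And>K. unmatched_total K \<le> n * n" "\<And>K. pairs_total K \<le> n * n"
  shows "(\<exists>v\<in>set (knapsack (n * n) (map (cluster_choices n L C w) [0..<n])). fst v \<le> r \<and> fst (snd v) \<le> q) \<longleftrightarrow>
    (\<exists>K. unmatched_total K \<le> r \<and> pairs_total K \<le> q)"
proof
  assume "\<exists>v\<in>set (knapsack (n * n) (map (cluster_choices n L C w) [0..<n])). fst v \<le> r \<and> fst (snd v) \<le> q"
  then obtain v where v: "v \<in> set (knapsack (n * n) (map (cluster_choices n L C w) [0..<n]))" "fst v \<le> r" "fst (snd v) \<le> q"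
    by blast
  then obtain ch where ch: "\<forall>c\<in>{0..<n}. ch c \<in> set (cluster_choices n L C w c)" "v = vsum ch {0..<n}"
    using set_knapsack[of "[0..<n]" v "n * n" "cluster_choices n L C w"] by auto
  have "\<forall>c\<in>{0..<n}. \<exists>K. ch c = (fst (snd (cluster_sum K c)),
       fst (cluster_sum K c) * fst (cluster_sum K c) + snd (snd (cluster_sum K c)), 0)"
    using ch(1) unfolding set_cluster_choices by blast
  then obtain Kc where Kc: "\<And>c. c \<in> {0..<n} \<Longrightarrow> ch c = (fst (snd (cluster_sum (Kc c) c)),
       fst (cluster_sum (Kc c) c) * fst (cluster_sum (Kc c) c) + snd (snd (cluster_sum (Kc c) c)), 0)"
    by metis
  define K where "K g = Kc (at C (representative n L C w g)) g" for g
  have eq: "cluster_sum K c = cluster_sum (Kc c) c" for c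
    unfolding cluster_sum_def by (intro vsum_cong) (simp add: assigned_def component_choice_def K_def)
  have "unmatched_total K = fst v" "pairs_total K = fst (snd v)"
    unfolding unmatched_total_def pairs_total_def ch(2) vsum_def fst_conv snd_conv eq
    using Kc by (auto intro!: sum.cong)
  then have "unmatched_total K \<le> r \<and> pairs_total K \<le> q" using v(2,3) by simp
  then show "\<exists>K. unmatched_total K \<le> r \<and> pairs_total K \<le> q" by (intro exI[of _ K])
next
  assume "\<exists>K. unmatched_total K \<le> r \<and> pairs_total K \<le> q"
  then obtain K where K: "unmatched_total K \<le> r" "pairs_total K \<le> q" by blast
  let ?s = "cluster_sum K"
  let ?ch = "\<lambda>c. (fst (snd (?s c)), fst (?s c) * fst (?s c) + snd (snd (?s c)), 0::nat)"
  have grid: "?s c \<in> set (grid (n * n))" if c: "c \<in> {0..<n}" for c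
  proof -
    have "fst (snd (?s c)) \<le> unmatched_total K"
      unfolding unmatched_total_def by (rule member_le_sum[OF c]) auto
    moreover have "fst (?s c) * fst (?s c) + snd (snd (?s c)) \<le> pairs_total K"
      unfolding pairs_total_def by (rule member_le_sum[OF c]) auto
    moreover have "fst (?s c) \<le> fst (?s c) * fst (?s c)" by (rule le_square)
    ultimately have "fst (?s c) \<le> n * n" "fst (snd (?s c)) \<le> n * n" "snd (snd (?s c)) \<le> n * n"
      using bounds[of K] by linarith+
    then show ?thesis by (simp add: set_grid)
  qed
  have v: "vsum ?ch {0..<n} = (unmatched_total K, pairs_total K, 0)"
    unfolding vsum_def unmatched_total_def pairs_total_def by simp
  have "vsum ?ch {0..<n} \<in> set (knapsack (n * n) (map (cluster_choices n L C w) [0..<n]))"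
    unfolding set_knapsack[OF distinct_upt] set_upt
  proof (intro conjI exI[of _ ?ch] ballI refl)
    show "vsum ?ch {0..<n} \<in> set (grid (n * n))" unfolding v set_grid using bounds[of K] by simp
    show "?ch c \<in> set (cluster_choices n L C w c)" if "c \<in> {0..<n}" for c
      unfolding set_cluster_choices using grid[OF that] by (intro exI[of _ K] conjI refl)
  qed
  then show "\<exists>v\<in>set (knapsack (n * n) (map (cluster_choices n L C w) [0..<n])). fst v \<le> r \<and> fst (snd v) \<le> q"
    using K unfolding v by force
qed

text \<open>Joint clusters are named by clusters of \<open>G\<^sub>c\<close>, the other components
  by their own labels; both names are numbers, and the boolean keeps them apart.\<close>

definition joined_label :: "(nat \<Rightarrow> bool) \<Rightarrow> nat \<Rightarrow> bool \<times> nat" where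
  "joined_label K v = (if K (at L v) then (True, at C (representative n L C w (at L v))) else (False, at L v))"

definition matched :: "(nat \<Rightarrow> bool) \<Rightarrow> nat set" where
  "matched K = {v. v < n \<and> K (at L v) \<and> at C v = at C (representative n L C w (at L v))}"

lemma set_members: "set (members n L g) = {v. v < n \<and> at L v = g}"
  by (auto simp: members_def)

lemma length_members: "length (members n L g) = card {v. v < n \<and> at L v = g}"
  unfolding set_members[symmetric] by (rule distinct_card[symmetric]) (simp add: members_def)

lemma representative_member:
  assumes "v < n" shows "representative n L C w (at L v) < n" "at L (representative n L C w (at L v)) = at L v"
proof -
  have "v \<in> set (members n L (at L v))" using assms by (simp add: set_members)
  then have "representative n L C w (at L v) \<in> set (members n L (at L v))"
    unfolding representative_def nth_or_eq by (cases "members n L (at L v)") auto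
  then show "representative n L C w (at L v) < n" "at L (representative n L C w (at L v)) = at L v"
    by (simp_all add: set_members)
qed

lemma cluster_sum_eq:
  assumes L: "\<And>v. v < n \<Longrightarrow> at L v < n"
  defines "f \<equiv> \<lambda>v. at C (representative n L C w (at L v))"
  shows "fst (cluster_sum K c) = card {v. v < n \<and> K (at L v) \<and> f v = c}"
    "fst (snd (cluster_sum K c)) = card {v. v < n \<and> v \<notin> matched K \<and> f v = c}"
    "snd (snd (cluster_sum K c)) = card {p. fst p < n \<and> snd p < n \<and> \<not> K (at L (fst p)) \<and>
       at L (fst p) = at L (snd p) \<and> f (fst p) = c}"
proof -
  let ?G = "assigned c"
  have finG: "finite ?G" by (simp add: assigned_def)
  have G: "at L v \<in> ?G \<longleftrightarrow> f v = c" if "v < n" for v using L[OF that] by (simp add: assigned_def f_def)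
  have Gf: "f v = c" if "at L v \<in> ?G" for v using that by (simp add: assigned_def f_def)
  have "card {v. v < n \<and> K (at L v) \<and> f v = c} = (\<Sum>g\<in>?G. fst (component_choice K g))"
  proof (rule card_fibres[OF _ finG])
    fix g assume g: "g \<in> ?G"
    show "card {v \<in> {v. v < n \<and> K (at L v) \<and> f v = c}. at L v = g} = fst (component_choice K g)"
    proof (cases "K g")
      case True
      then have "{v \<in> {v. v < n \<and> K (at L v) \<and> f v = c}. at L v = g} = {v. v < n \<and> at L v = g}" using g Gf by auto
      then show ?thesis using True by (simp add: component_choice_def component_choices_def length_members)
    next
      case False
      then have "{v \<in> {v. v < n \<and> K (at L v) \<and> f v = c}. at L v = g} = {}" by auto
      then show ?thesis using False by (simp add: component_choice_def component_choices_def)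
    qed
  qed (use G in auto)
  then show "fst (cluster_sum K c) = card {v. v < n \<and> K (at L v) \<and> f v = c}"
    by (simp add: cluster_sum_def vsum_def)
  have "card {v. v < n \<and> v \<notin> matched K \<and> f v = c} = (\<Sum>g\<in>?G. fst (snd (component_choice K g)))"
  proof (rule card_fibres[OF _ finG])
    fix g assume g: "g \<in> ?G"
    show "card {v \<in> {v. v < n \<and> v \<notin> matched K \<and> f v = c}. at L v = g} = fst (snd (component_choice K g))"
    proof (cases "K g")
      case True
      let ?xs = "filter (\<lambda>v. at C v \<noteq> at C (representative n L C w g)) (members n L g)"
      have "{v \<in> {v. v < n \<and> v \<notin> matched K \<and> f v = c}. at L v = g} = set ?xs"
        using True g Gf by (auto simp: matched_def set_members)
      moreover have "card (set ?xs) = length ?xs" by (rule distinct_card) (simp add: members_def)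
      ultimately show ?thesis using True by (simp add: component_choice_def component_choices_def)
    next
      case False
      then have "{v \<in> {v. v < n \<and> v \<notin> matched K \<and> f v = c}. at L v = g} = {v. v < n \<and> at L v = g}"
        using g Gf by (auto simp: matched_def)
      then show ?thesis using False by (simp add: component_choice_def component_choices_def length_members)
    qed
  qed (use G in auto)
  then show "fst (snd (cluster_sum K c)) = card {v. v < n \<and> v \<notin> matched K \<and> f v = c}"
    by (simp add: cluster_sum_def vsum_def)
  let ?X = "{p. fst p < n \<and> snd p < n \<and> \<not> K (at L (fst p)) \<and> at L (fst p) = at L (snd p) \<and> f (fst p) = c}"
  have "card ?X = (\<Sum>g\<in>?G. snd (snd (component_choice K g)))"
  proof (rule card_fibres[OF finite_pairs finG])
    show "(\<lambda>p. at L (fst p)) ` ?X \<subseteq> ?G" by (rule image_subsetI, elim CollectE conjE, rule iffD2[OF G])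
    fix g assume g: "g \<in> ?G"
    show "card {p \<in> ?X. at L (fst p) = g} = snd (snd (component_choice K g))"
    proof (cases "K g")
      case True
      then have "{p \<in> ?X. at L (fst p) = g} = {}" by auto
      then have "card {p \<in> ?X. at L (fst p) = g} = 0" by (simp only: card.empty)
      then show ?thesis using True by (simp add: component_choice_def component_choices_def)
    next
      case False
      have fg: "f v = c" if "at L v = g" for v using Gf[of v] g that by simp
      have "p \<in> {p \<in> ?X. at L (fst p) = g} \<longleftrightarrow> p \<in> {v. v < n \<and> at L v = g} \<times> {v. v < n \<and> at L v = g}" for p
        using False fg[of "fst p"] unfolding mem_Times_iff mem_Collect_eq by metis
      then have "{p \<in> ?X. at L (fst p) = g} = {v. v < n \<and> at L v = g} \<times> {v. v < n \<and> at L v = g}"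
        by (rule set_eqI)
      then have "card {p \<in> ?X. at L (fst p) = g} = length (members n L g) * length (members n L g)"
        by (simp only: card_cartesian_product length_members)
      then show ?thesis using False by (simp add: component_choice_def component_choices_def)
    qed
  qed
  then show "snd (snd (cluster_sum K c)) = card ?X"
    by (simp add: cluster_sum_def vsum_def)
qed

lemma card_same_label_diagonal: "card (same_label n l \<union> (\<lambda>v. (v, v)) ` {..<n}) = card (same_label n l) + n"
proof -
  have "card (same_label n l \<union> (\<lambda>v. (v, v)) ` {..<n}) = card (same_label n l) + card ((\<lambda>v. (v, v)) ` {..<n})"
  proof (rule card_Un_disjoint)
    show "finite (same_label n l)" by (rule finite_subset[OF same_label_subset]) simp
  qed (auto simp: same_label_def)
  moreover have "card ((\<lambda>v. (v, v)) ` {..<n}) = n" by (subst card_image) (auto simp: inj_on_def)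
  ultimately show ?thesis by simp
qed

text \<open>Vertices and pairs are sorted by the cluster to which the component of the (first)
  vertex is assigned. Squared sizes count the pairs \<open>(v, v)\<close> too, hence the summand
  \<open>n\<close>.\<close>

lemma totals_eq:
  assumes L: "\<And>v. v < n \<Longrightarrow> at L v < n" and C: "\<And>v. v < n \<Longrightarrow> at C v < n"
  shows "unmatched_total K = card ({..<n} - matched K)"
    "pairs_total K = card (same_label n (joined_label K)) + n"
proof -
  let ?f = "\<lambda>v. at C (representative n L C w (at L v))"
  have sums: "fst (cluster_sum K c) = card {v. v < n \<and> K (at L v) \<and> ?f v = c}"
    "fst (snd (cluster_sum K c)) = card {v. v < n \<and> v \<notin> matched K \<and> ?f v = c}"
    "snd (snd (cluster_sum K c)) = card {p. fst p < n \<and> snd p < n \<and> \<not> K (at L (fst p)) \<and>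
       at L (fst p) = at L (snd p) \<and> ?f (fst p) = c}" for c
    by (rule cluster_sum_eq, erule L)+
  have f: "?f v < n" if "v < n" for v by (rule C[OF representative_member(1)[OF that]])
  show "unmatched_total K = card ({..<n} - matched K)"
    unfolding unmatched_total_def sums(2)
    by (rule card_fibres[symmetric, where f = ?f]) (use f in \<open>auto intro: arg_cong[where f = card]\<close>)
  let ?X = "{p. fst p < n \<and> snd p < n \<and> joined_label K (fst p) = joined_label K (snd p)}"
  have "?X = same_label n (joined_label K) \<union> (\<lambda>v. (v, v)) ` {..<n}"
    by (auto simp: same_label_def)
  then have X: "card ?X = card (same_label n (joined_label K)) + n"
    by (simp only: card_same_label_diagonal)
  have "card ?X = pairs_total K"
    unfolding pairs_total_def sums(1,3)
  proof (rule card_fibres[OF finite_pairs])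
    show "(\<lambda>p. ?f (fst p)) ` ?X \<subseteq> {0..<n}" using f by auto
    fix c assume "c \<in> {0..<n}"
    let ?K = "{v. v < n \<and> K (at L v) \<and> ?f v = c}"
    let ?D = "{p. fst p < n \<and> snd p < n \<and> \<not> K (at L (fst p)) \<and> at L (fst p) = at L (snd p) \<and> ?f (fst p) = c}"
    have "p \<in> {p \<in> ?X. ?f (fst p) = c} \<longleftrightarrow> p \<in> ?K \<times> ?K \<union> ?D" for p
      by (cases p, cases "K (at L (fst p))"; cases "K (at L (snd p))") (auto simp: joined_label_def)
    then have "{p \<in> ?X. ?f (fst p) = c} = ?K \<times> ?K \<union> ?D" by (rule set_eqI)
    then have "card {p \<in> ?X. ?f (fst p) = c} = card (?K \<times> ?K \<union> ?D)" by (simp only:)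
    also have "\<dots> = card (?K \<times> ?K) + card ?D"
    proof (rule card_Un_disjoint)
      show "finite ?D" by (rule finite_pairs)
      show "?K \<times> ?K \<inter> ?D = {}"
        by (rule equals0I) (simp only: Int_iff mem_Times_iff mem_Collect_eq, elim conjE, erule (1) notE)
    qed simp
    finally show "card {p \<in> ?X. ?f (fst p) = c} = card ?K * card ?K + card ?D"
      by (simp only: card_cartesian_product)
  qed simp
  then show "pairs_total K = card (same_label n (joined_label K)) + n" using X by simp
qed

end

lemma nth_filter_rank:
  assumes "g < n" "P g" shows "filter P [0..<n] ! length (filter P [0..<g]) = g"
    "length (filter P [0..<g]) < length (filter P [0..<n])"
proof -
  have "[0..<n] = [0..<g] @ g # [Suc g..<n]"
    using assms(1) by (metis le_add_same_cancel1 less_imp_add_positive upt_add_eq_append upt_conv_Cons zero_le)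
  then have "filter P [0..<n] = filter P [0..<g] @ g # filter P [Suc g..<n]" using assms(2) by simp
  then show "filter P [0..<n] ! length (filter P [0..<g]) = g"
    "length (filter P [0..<g]) < length (filter P [0..<n])" by simp_all
qed

lemma length_spine_repr_nat: "length (spine (repr (k::nat))) = k"
  by (induction k) auto

text \<open>Every component meeting \<open>S\<close> gets a representative in the right cluster: an impure component
  has a vertex outside \<open>S\<close>, so there are at most \<open>d\<close> of them, and one of the first \<open>d + 1\<close> vertices
  of each lies in \<open>S\<close>.\<close>

lemma representatives_exist:
  assumes L: "\<And>v. v < n \<Longrightarrow> at L v < n"
    and S: "S \<subseteq> {..<n}" "card ({..<n} - S) \<le> d"
    and agree: "\<And>u v. u \<in> S \<Longrightarrow> v \<in> S \<Longrightarrow> at L u = at L v \<Longrightarrow> at C u = at C v"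
  obtains w where "height w \<le> 2 * d" "\<And>s. s \<in> S \<Longrightarrow> at C (representative n L C w (at L s)) = at C s"
proof -
  define P where "P g \<longleftrightarrow> (\<exists>v\<in>set (members n L g). impure n L C v)" for g
  \<comment> \<open>Components that avoid \<open>S\<close> get the default 0; elsewhere all vertices
    before this position lie outside \<open>S\<close>.\<close>
  define idx where "idx g = (if \<exists>i<length (members n L g). members n L g ! i \<in> S
      then LEAST i. i < length (members n L g) \<and> members n L g ! i \<in> S else 0)" for g
  let ?xs = "filter P [0..<n]"
  let ?w = "repr (map idx ?xs)"
  have impure: "impure n L C v \<longleftrightarrow> (\<exists>u<n. at L u = at L v \<and> at C u \<noteq> at C v)" for v
    unfolding impure_def bex_upt ..
  have "set ?xs \<subseteq> at L ` ({..<n} - S)"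
  proof
    fix g assume "g \<in> set ?xs"
    then obtain v where v: "v < n" "at L v = g" "impure n L C v" unfolding P_def by (auto simp: set_members)
    then obtain u where u: "u < n" "at L u = at L v" "at C u \<noteq> at C v" unfolding impure by blast
    then have "u \<notin> S \<or> v \<notin> S" using agree by blast
    then show "g \<in> at L ` ({..<n} - S)" using u(1,2) v(1,2) by (metis DiffI image_eqI lessThan_iff)
  qed
  then have "card (set ?xs) \<le> card ({..<n} - S)" by (intro surj_card_le) simp
  then have len: "length ?xs \<le> d" using S(2) distinct_card[of ?xs] by simp
  have idx_ex: "idx g < length (members n L g) \<and> members n L g ! idx g \<in> S"
    if ex: "\<exists>i<length (members n L g). members n L g ! i \<in> S" for g
  proof -
    have "idx g = (LEAST i. i < length (members n L g) \<and> members n L g ! i \<in> S)" using ex by (simp add: idx_def)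
    then show ?thesis using LeastI_ex[OF ex] by simp
  qed
  have idx_le: "idx g \<le> d" for g
  proof (cases "\<exists>i<length (members n L g). members n L g ! i \<in> S")
    case True
    have "set (take (idx g) (members n L g)) \<subseteq> {..<n} - S"
    proof
      fix v assume "v \<in> set (take (idx g) (members n L g))"
      then obtain i where i: "i < idx g" "i < length (members n L g)" "v = members n L g ! i"
        by (auto simp: in_set_conv_nth)
      then have "v \<notin> S" using not_less_Least[of i "\<lambda>i. i < length (members n L g) \<and> members n L g ! i \<in> S"] True
        unfolding idx_def by auto
      moreover have "v < n" using i(2,3) nth_mem[of i "members n L g"] by (simp add: set_members)
      ultimately show "v \<in> {..<n} - S" by simp
    qed
    then have "card (set (take (idx g) (members n L g))) \<le> card ({..<n} - S)" by (intro card_mono) auto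
    moreover have "card (set (take (idx g) (members n L g))) = idx g"
      using idx_ex[OF True] by (subst distinct_card) (auto simp: members_def)
    ultimately show ?thesis using S(2) by simp
  next
    case False
    then show ?thesis unfolding idx_def by (simp only: if_False)
  qed
  show ?thesis
  proof (rule that[of ?w])
    have "height ?w \<le> length (map idx ?xs) + d"
      by (rule height_repr_list) (use idx_le in \<open>auto simp: height_repr_nat\<close>)
    then show "height ?w \<le> 2 * d" using len by simp
    fix s assume s: "s \<in> S"
    then have sn: "s < n" using S(1) by auto
    let ?g = "at L s" let ?r = "representative n L C ?w (at L s)"
    show "at C ?r = at C s"
    proof (cases "P ?g")
      case True
      have "s \<in> set (members n L ?g)" using sn by (simp add: set_members)
      then have ex: "\<exists>i<length (members n L ?g). members n L ?g ! i \<in> S" using s by (metis in_set_conv_nth)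
      have rank: "impure_rank n L C ?g = length (filter P [0..<?g])" unfolding impure_rank_def P_def ..
      have "nth_or Leaf (spine ?w) (impure_rank n L C ?g) = repr (idx ?g)"
        unfolding rank spine_repr_list nth_or_eq[of Leaf]
        using nth_filter_rank[of ?g n P, OF L[OF sn] True] by simp
      then have r: "?r = members n L ?g ! idx ?g"
        unfolding representative_def using idx_ex[OF ex]
        by (simp add: length_spine_repr_nat nth_or_eq[of "nth_or 0 (members n L ?g) 0"])
      then have "?r \<in> S" using idx_ex[OF ex] by simp
      then show ?thesis using agree[OF _ s] representative_member(2)[OF sn] by blast
    next
      case False
      have "s \<in> set (members n L ?g)" using sn by (simp add: set_members)
      then have "\<not> impure n L C s" using False unfolding P_def by blast
      then show ?thesis unfolding impure using representative_member[OF sn] by blast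
    qed
  qed
qed

text \<open>Given a solution that agrees with \<open>G\<^sub>c\<close> on \<open>S\<close>, exactly
  the components meeting \<open>S\<close> are joined. Two of them end up together only if their
  vertices in \<open>S\<close> share a cluster of \<open>G\<^sub>c\<close>, hence of the solution,
  so no pair is new; the other components stay alone, which costs no vertex of
  \<open>S\<close>.\<close>

lemma completion_matching_alg_iff:
  assumes E: "simple_graph {..<n} E" and Ec: "cluster_graph {..<n} Ec"
    and A: "set A = arcs E" "distinct A" and B: "set B = arcs Ec"
    and U: "\<And>t. height t \<le> 2 * d \<Longrightarrow> t \<in> set U"
  shows "completion_matching_alg n A B (min (n * n) k) (min (n * n) d) U \<longleftrightarrow> dc_completion matching_dist {..<n} E Ec k d"
proof -
  obtain lc :: "nat \<Rightarrow> nat" where lc: "Ec = label_graph n lc" using cluster_graph_obtain_label[OF Ec] .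
  have Blc: "set B = same_label n lc" unfolding B lc by (rule arcs_label_graph)
  let ?L = "component_labels n A" let ?C = "cluster_reps n B"
  have Aw: "u < n \<and> v < n" if "(u, v) \<in> set A" for u v using arcs_simple[OF E] that A by blast
  have L_less: "at ?L v < n" if "v < n" for v
    unfolding nth_or_eq component_labels_def component_labels_bound(1)
    using that component_labels_bound(2)[OF nth_mem, of v n A] component_labels_bound(1)[of n A] by simp
  have C: "at ?C u = at ?C v \<longleftrightarrow> lc u = lc v" if "u < n" "v < n" for u v using cluster_reps_eq(1)[OF Blc that] .
  have C_less: "at ?C v < n" if "v < n" for v using cluster_reps_eq(2)[OF Blc that that] .
  have totals: "unmatched_total n ?L ?C w K = card ({..<n} - matched n ?L ?C w K)"
    "pairs_total n ?L ?C w K = card (same_label n (joined_label n ?L ?C w K)) + n" for w K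
    by (rule totals_eq, erule L_less, erule C_less)+
  have lenA: "length A = card (arcs E)" using distinct_card[OF A(2)] A(1) by simp
  have um: "unmatched_total n ?L ?C w K \<le> n * n" for w K
  proof -
    have "card ({..<n} - matched n ?L ?C w K) \<le> card {..<n}" by (rule card_mono) auto
    then have "card ({..<n} - matched n ?L ?C w K) \<le> n" by simp
    then show ?thesis unfolding totals(1) by (rule le_trans[OF _ le_square])
  qed
  have pt: "pairs_total n ?L ?C w K \<le> n * n" for w K
  proof -
    let ?l = "joined_label n ?L ?C w K"
    have "card (same_label n ?l \<union> (\<lambda>v. (v, v)) ` {..<n}) \<le> card ({..<n} \<times> {..<n})"
      by (rule card_mono) (auto simp: same_label_def)
    then show ?thesis unfolding totals(2) card_same_label_diagonal by simp
  qed
  have alg: "completion_matching_alg n A B (min (n * n) k) (min (n * n) d) U \<longleftrightarrow>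
     (\<exists>w\<in>set U. \<exists>K. card ({..<n} - matched n ?L ?C w K) \<le> d \<and>
        card (same_label n (joined_label n ?L ?C w K)) \<le> 2 * k + card (arcs E))"
  proof -
    \<comment> \<open>By \<open>um\<close> and \<open>pt\<close> both totals are at most
      \<open>n * n\<close>, so the caps do not affect the comparisons.\<close>
    have "unmatched_total n ?L ?C w K \<le> min (n * n) d \<and> pairs_total n ?L ?C w K \<le> 2 * min (n * n) k + length A + n \<longleftrightarrow>
       card ({..<n} - matched n ?L ?C w K) \<le> d \<and> card (same_label n (joined_label n ?L ?C w K)) \<le> 2 * k + card (arcs E)" for w K
      using um[of w K] pt[of w K] unfolding totals lenA by (auto simp: min_def)
    then show ?thesis unfolding completion_matching_alg_def completion_knapsack_iff[OF um pt] by simp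
  qed
  show ?thesis
  proof
    assume "completion_matching_alg n A B (min (n * n) k) (min (n * n) d) U"
    then obtain w K where wK: "card ({..<n} - matched n ?L ?C w K) \<le> d"
       "card (same_label n (joined_label n ?L ?C w K)) \<le> 2 * k + card (arcs E)" unfolding alg by blast
    show "dc_completion matching_dist {..<n} E Ec k d"
      unfolding lc
    proof (rule completion_matchingI[OF E _ _ wK(2,1)])
      show "matched n ?L ?C w K \<subseteq> {..<n}" by (auto simp: matched_def)
      show "arcs E \<subseteq> same_label n (joined_label n ?L ?C w K)"
      proof
        fix p assume p: "p \<in> arcs E"
        obtain u v where uv: "p = (u, v)" by (cases p)
        have "at ?L u = at ?L v" using component_labels_edge[of A n u v] Aw p A uv by blast
        then show "p \<in> same_label n (joined_label n ?L ?C w K)"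
          using arcs_simple[OF E, of u v] p unfolding uv same_label_def joined_label_def by simp
      qed
      fix u v assume u: "u \<in> matched n ?L ?C w K" and v: "v \<in> matched n ?L ?C w K"
      have "joined_label n ?L ?C w K x = (True, at ?C x)" if "x \<in> matched n ?L ?C w K" for x
        using that by (simp add: matched_def joined_label_def)
      then show "joined_label n ?L ?C w K u = joined_label n ?L ?C w K v \<longleftrightarrow> lc u = lc v"
        using C[of u v] u v by (simp add: matched_def)
    qed
  next
    assume "dc_completion matching_dist {..<n} E Ec k d"
    then obtain l :: "nat \<Rightarrow> nat" and S where S: "S \<subseteq> {..<n}" "arcs E \<subseteq> same_label n l"
      "card (same_label n l) \<le> 2 * k + card (arcs E)" "card ({..<n} - S) \<le> d"
      "\<And>u v. u \<in> S \<Longrightarrow> v \<in> S \<Longrightarrow> l u = l v \<longleftrightarrow> lc u = lc v"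
      unfolding lc using completion_matchingE[OF E] by metis
    have L: "l u = l v" if "u < n" "v < n" "at ?L u = at ?L v" for u v
      by (rule component_labels_finest[OF _ that]) (use S(2) A in \<open>auto simp: same_label_def\<close>)
    have agree: "l u = l v \<longleftrightarrow> at ?C u = at ?C v" if "u \<in> S" "v \<in> S" for u v
      using S(5)[OF that] C[of u v] S(1) that by auto
    obtain w where w: "height w \<le> 2 * d" "\<And>s. s \<in> S \<Longrightarrow> at ?C (representative n ?L ?C w (at ?L s)) = at ?C s"
    proof (rule representatives_exist[of n ?L S d ?C, OF _ S(1,4)])
      show "at ?L v < n" if "v < n" for v using L_less[OF that] .
      show "at ?C u = at ?C v" if "u \<in> S" "v \<in> S" "at ?L u = at ?L v" for u v
        using agree[OF that(1,2)] L[of u v] S(1) that by auto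
    qed (rule that)
    define K where "K g \<longleftrightarrow> (\<exists>s\<in>S. at ?L s = g)" for g
    have "S \<subseteq> matched n ?L ?C w K"
      using S(1) w(2) unfolding matched_def K_def by auto
    then have "card ({..<n} - matched n ?L ?C w K) \<le> card ({..<n} - S)" by (intro card_mono) auto
    moreover have "same_label n (joined_label n ?L ?C w K) \<subseteq> same_label n l"
    proof
      fix p assume p: "p \<in> same_label n (joined_label n ?L ?C w K)"
      obtain u v where uv: "p = (u, v)" by (cases p)
      have n: "u < n" "v < n" "u \<noteq> v" and eq: "joined_label n ?L ?C w K u = joined_label n ?L ?C w K v"
        using p unfolding uv same_label_def by simp_all
      have "l u = l v"
      proof (cases "K (at ?L u)")
        case True
        then have "K (at ?L v)" "at ?C (representative n ?L ?C w (at ?L u)) = at ?C (representative n ?L ?C w (at ?L v))"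
          using eq by (auto simp: joined_label_def split: if_splits)
        moreover obtain s where s: "s \<in> S" "at ?L s = at ?L u" using True unfolding K_def by blast
        moreover obtain t where t: "t \<in> S" "at ?L t = at ?L v" using \<open>K (at ?L v)\<close> unfolding K_def by blast
        ultimately have "at ?C s = at ?C t" using w(2)[OF s(1)] w(2)[OF t(1)] by simp
        then have "l s = l t" using agree[OF s(1) t(1)] by simp
        moreover have "l s = l u" using L[of s u] s S(1) n by auto
        moreover have "l t = l v" using L[of t v] t S(1) n by auto
        ultimately show ?thesis by simp
      next
        case False
        then have "at ?L u = at ?L v" using eq by (auto simp: joined_label_def split: if_splits)
        then show ?thesis by (rule L[OF n(1,2)])
      qed
      then show "p \<in> same_label n l" unfolding uv same_label_def using n by simp
    qed
    then have "card (same_label n (joined_label n ?L ?C w K)) \<le> card (same_label n l)"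
      by (intro card_mono finite_subset[OF same_label_subset]) auto
    ultimately show "completion_matching_alg n A B (min (n * n) k) (min (n * n) d) U"
      unfolding alg using U[OF w(1)] S(3,4) le_trans by blast
  qed
qed

text \<open>As \<open>k + 1 \<le> 2 ^ bits k\<close>, the factor 5 clears \<open>4 * k + 1\<close>,
  the largest height that any of the three algorithms asks for.\<close>

lemma mem_trees_below:
  assumes "height t \<le> 4 * k + 1" shows "t \<in> set (trees_below (depth 5 k))"
proof -
  have "k + 1 \<le> 2 ^ bits k" using less_two_power_bits[of k] by simp
  then have "height t < depth 5 k" using assms by linarith
  then show ?thesis by (simp add: set_trees_below)
qed

theorem theorem26:
  shows "fixed_parameter_tractable (DC_Deletion_by_budget edge_dist) \<and>
         fixed_parameter_tractable (DC_Completion_by_distance matching_dist) \<and>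
         fixed_parameter_tractable (DC_Completion_by_distance edge_dist)"
proof (intro conjI)
  show "fixed_parameter_tractable (DC_Deletion_by_budget edge_dist)"
  proof (rule fixed_parameter_tractableI[OF PT_decide[OF PT_deletion_alg], where a = 5])
    fix x k
    have "decide deletion_alg (Node x (enc_nat k), trees_below (depth 5 k)) \<longleftrightarrow>
      (\<exists>n E Ec d. x = enc_instance n E Ec d \<and> simple_graph {..<n} E \<and> cluster_graph {..<n} Ec \<and>
        dc_deletion edge_dist {..<n} E Ec k d)"
      by (rule decide_iff) (erule (2) deletion_alg_iff, assumption, rule mem_trees_below)
    then show "(x, k) \<in> DC_Deletion_by_budget edge_dist \<longleftrightarrow>
       decide deletion_alg (Node x (enc_nat k), trees_below (depth 5 k))"
      unfolding DC_Deletion_by_budget_def by auto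
  qed simp_all
  show "fixed_parameter_tractable (DC_Completion_by_distance matching_dist)"
  proof (rule fixed_parameter_tractableI[OF PT_decide[OF PT_completion_matching_alg], where a = 5])
    fix x d
    have "decide completion_matching_alg (Node x (enc_nat d), trees_below (depth 5 d)) \<longleftrightarrow>
      (\<exists>n E Ec k. x = enc_instance n E Ec k \<and> simple_graph {..<n} E \<and> cluster_graph {..<n} Ec \<and>
        dc_completion matching_dist {..<n} E Ec k d)"
      by (rule decide_iff) (erule (4) completion_matching_alg_iff, rule mem_trees_below, linarith)
    then show "(x, d) \<in> DC_Completion_by_distance matching_dist \<longleftrightarrow>
       decide completion_matching_alg (Node x (enc_nat d), trees_below (depth 5 d))"
      unfolding DC_Completion_by_distance_def by auto
  qed simp_all
  show "fixed_parameter_tractable (DC_Completion_by_distance edge_dist)"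
  proof (rule fixed_parameter_tractableI[OF PT_decide[OF PT_completion_edge_alg], where a = 5])
    fix x d
    have "decide completion_edge_alg (Node x (enc_nat d), trees_below (depth 5 d)) \<longleftrightarrow>
      (\<exists>n E Ec k. x = enc_instance n E Ec k \<and> simple_graph {..<n} E \<and> cluster_graph {..<n} Ec \<and>
        dc_completion edge_dist {..<n} E Ec k d)"
      by (rule decide_iff) (erule (2) completion_edge_alg_iff, assumption, rule mem_trees_below, linarith)
    then show "(x, d) \<in> DC_Completion_by_distance edge_dist \<longleftrightarrow>
       decide completion_edge_alg (Node x (enc_nat d), trees_below (depth 5 d))"
      unfolding DC_Completion_by_distance_def by auto
  qed simp_all
qed

end
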